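(* Let $m\in\mathbb{Z}$ and $\lambda\in\mathbb{C}\setminus\{0\}$. The following biorthogonality relations hold for $p_2,p_2'\in I_q$, respectively $p_1,p_1'\in I_q$: $$\sum_{p_1\in I_q}s(p_1,p_2;\lambda,m)\,s(p_1,p_2';\lambda^{-1},m)=\delta_{p_2,p_2'},\qquad \sum_{p_2\in I_q}s(p_1,p_2;\lambda,m)\,s(p_1',p_2;\lambda^{-1},m)=\delta_{p_1,p_1'}.$$
   Context: Fix $0<q<1$. $\mathbb{N}=\{1,2,\dots\}$, $I_q=-q^{\mathbb{N}}\cup q^{\mathbb{Z}}$. For $x\in -q^{\mathbb{Z}}\cup q^{\mathbb{Z}}$: $\chi(x)=\log_q|x|$ and $\nu(x)=q^{\frac12(\chi(x)-1)(\chi(x)-2)}$; $\kappa(x)=\mathrm{sgn}(x)x^2$. $(a;q)_\infty=\prod_{k\ge 0}(1-aq^k)$, $(a_1,\dots,a_k;q)_\infty=\prod_i(a_i;q)_\infty$, ${}_r\varphi_s$ is the basic hypergeometric series, $c_q=(\sqrt2\,q\,(q^2,-q^2;q^2)_\infty)^{-1}$. For $p_1,p_2\in I_q$, $m\in\mathbb{Z}$, $\lambda\in\mathbb{C}\setminus\{0\}$, $$s(p_1,p_2;\lambda,m)=c_q^2|p_1p_2|\,p_2^{\chi(p_1p_2)+m}\,\nu(p_1p_2q^{m+1})\nu(p_1)\nu(p_2)\sqrt{(-\kappa(p_1),-\kappa(p_2);q^2)_\infty}$$ $$\times\frac{(q^2,-q^2/\kappa(p_2),-\lambda q^{3-m}/p_1^2\kappa(p_2),-p_1^2\kappa(p_2)q^{m-1}/\lambda,q^{1-m}/\kappa(p_2)\lambda;q^2)_\infty}{(\kappa(p_1)q^{1+m}/\lambda,-q^{-m-1}/\lambda,-q^{3+m}\lambda;q^2)_\infty}$$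 $$\times(\kappa(p_1p_2)q^{2+2m};q^2)_\infty\;{}_2\varphi_1\Bigl(\kappa(p_2)q^{1+m}\lambda,\ \kappa(p_2)q^{1+m}/\lambda;\ \kappa(p_1p_2)q^{2+2m};\ q^2,\,-\tfrac{q^2}{\kappa(p_2)}\Bigr).$$ For all $p_2\in I_q$ (also when the ${}_2\varphi_1$-series does not converge) this is understood via Jackson's transformation ${}_2\varphi_1(a,b;c;q,z)=\frac{(az;q)_\infty}{(z;q)_\infty}\,{}_2\varphi_2(a,c/b;c,az;q,bz)$: the product $(-q^2/\kappa(p_2);q^2)_\infty\,(\kappa(p_1p_2)q^{2+2m};q^2)_\infty\,{}_2\varphi_1(\cdots)$ is replaced by $(c,az;q^2)_\infty\,{}_2\varphi_2(a,c/b;c,az;q^2,bz)$ with $a=\kappa(p_2)q^{1+m}\lambda$, $b=\kappa(p_2)q^{1+m}/\lambda$, $c=\kappa(p_1p_2)q^{2+2m}$, $z=-q^2/\kappa(p_2)$ (with $(c,az;q^2)_\infty$ multiplied into the series termwise). The resulting function of $\lambda$ extends analytically to $\mathbb{C}\setminus\{0\}$, and $s$ denotes this extension. *)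

theory Defs
  imports "HOL-Complex_Analysis.Complex_Analysis"
begin

definition I_q :: "real \<Rightarrow> real set" where
  "I_q q = {- (q ^ n) | n :: nat. n \<ge> 1} \<union> {q powi k | k :: int. True}"

text \<open>On the set of all \<open>x = \<plusminus> q powi k\<close>, where \<open>\<chi>\<close> is used, the logarithm is an
  integer, so that the floor only changes the type (see \<open>of_int_chi\<close> below). Having integer
  values is needed because \<open>\<chi>\<close> occurs in an exponent of a possibly negative base.\<close>

definition chi :: "real \<Rightarrow> real \<Rightarrow> int" where
  "chi q x = \<lfloor>log q \<bar>x\<bar>\<rfloor>"

definition nu :: "real \<Rightarrow> real \<Rightarrow> real" where
  "nu q x = q powr (1 / 2 * (real_of_int (chi q x) - 1) * (real_of_int (chi q x) - 2))"

definition kappa :: "real \<Rightarrow> real" where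
  "kappa x = sgn x * x ^ 2"

definition qpoch :: "'a :: real_normed_field \<Rightarrow> 'a \<Rightarrow> nat \<Rightarrow> 'a" where
  "qpoch a q n = (\<Prod>k<n. 1 - a * q ^ k)"

definition qpoch_inf :: "'a :: real_normed_field \<Rightarrow> 'a \<Rightarrow> 'a" where
  "qpoch_inf a q = (\<Prod>k. 1 - a * q ^ k)"

definition qpochs_inf :: "'a :: real_normed_field list \<Rightarrow> 'a \<Rightarrow> 'a" where
  "qpochs_inf as q = (\<Prod>a\<leftarrow>as. qpoch_inf a q)"

definition c_q :: "real \<Rightarrow> real" where
  "c_q q = inverse (sqrt 2 * q * qpochs_inf [q ^ 2, - (q ^ 2)] (q ^ 2))"

text \<open>The product \<open>(c, d; q)\<^sub>\<infinity> \<^sub>2\<phi>\<^sub>2(a, b; c, d; q, z)\<close>, with the infinite products multiplied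
  into the series termwise by means of \<open>(c; q)\<^sub>\<infinity> / (c; q)\<^sub>n = (c q\<^sup>n; q)\<^sub>\<infinity>\<close>. Unlike the
  \<open>\<^sub>2\<phi>\<^sub>2\<close>-series itself, this makes sense for all \<open>c\<close> and \<open>d\<close>.\<close>

definition phi22_reg ::
    "complex \<Rightarrow> complex \<Rightarrow> complex \<Rightarrow> complex \<Rightarrow> complex \<Rightarrow> complex \<Rightarrow> complex" where
  "phi22_reg a b c d q z =
     (\<Sum>n. qpoch a q n * qpoch b q n / qpoch q q n
          * qpochs_inf [c * q ^ n, d * q ^ n] q
          * ((- 1) ^ n * q ^ (n choose 2)) * z ^ n)"

text \<open>The explicit expression for \<open>s(p\<^sub>1, p\<^sub>2; \<lambda>, m)\<close>, in which
  \<open>(z; q\<^sup>2)\<^sub>\<infinity> (c; q\<^sup>2)\<^sub>\<infinity> \<^sub>2\<phi>\<^sub>1(a, b; c; q\<^sup>2, z)\<close> with \<open>z = - q\<^sup>2 / \<kappa>(p\<^sub>2)\<close> has been replaced by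
  \<open>(c, a z; q\<^sup>2)\<^sub>\<infinity> \<^sub>2\<phi>\<^sub>2(a, c / b; c, a z; q\<^sup>2, b z)\<close> (Jackson's transformation). It is only
  meaningful where the denominator is nonzero.\<close>

definition s_formula :: "real \<Rightarrow> real \<Rightarrow> real \<Rightarrow> int \<Rightarrow> complex \<Rightarrow> complex" where
  "s_formula q p1 p2 m l =
    (let Q = complex_of_real q;
         P1 = complex_of_real p1;
         K1 = complex_of_real (kappa p1);
         K2 = complex_of_real (kappa p2);
         K12 = complex_of_real (kappa (p1 * p2));
         a = K2 * Q powi (1 + m) * l;
         b = K2 * Q powi (1 + m) / l;
         c = K12 * Q powi (2 + 2 * m);
         z = - (Q ^ 2) / K2
     in complex_of_real
          (c_q q ^ 2 * \<bar>p1 * p2\<bar> * p2 powi (chi q (p1 * p2) + m)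
           * nu q (p1 * p2 * q powi (m + 1)) * nu q p1 * nu q p2
           * sqrt (qpochs_inf [- kappa p1, - kappa p2] (q ^ 2)))
        * (qpochs_inf
             [Q ^ 2,
              - (l * Q powi (3 - m)) / (P1 ^ 2 * K2),
              - (P1 ^ 2 * K2 * Q powi (m - 1)) / l,
              Q powi (1 - m) / (K2 * l)] (Q ^ 2)
           / qpochs_inf
             [K1 * Q powi (1 + m) / l,
              - (Q powi (- m - 1)) / l,
              - (Q powi (3 + m) * l)] (Q ^ 2))
        * phi22_reg a (c / b) c (a * z) (Q ^ 2) (b * z))"

text \<open>The analytic extension of \<^term>\<open>s_formula\<close> to all \<open>\<lambda> \<noteq> 0\<close>: the singularities of
  the formula are isolated in the punctured plane, and the value of the extension at \<open>\<lambda>\<close> is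
  the limit of the formula at \<open>\<lambda>\<close> (cf. \<open>s_fun_eqI\<close> below).\<close>

definition s_fun :: "real \<Rightarrow> real \<Rightarrow> real \<Rightarrow> complex \<Rightarrow> int \<Rightarrow> complex" where
  "s_fun q p1 p2 l m = remove_sings (s_formula q p1 p2 m) l"

lemma of_int_chi:
  assumes "0 < q" "q < 1" "\<bar>x\<bar> = q powi k"
  shows "chi q x = k" and "real_of_int (chi q x) = log q \<bar>x\<bar>"
proof -
  have "log q \<bar>x\<bar> = real_of_int k"
    using assms by (simp add: powr_real_of_int' [symmetric])
  then show "chi q x = k" and "real_of_int (chi q x) = log q \<bar>x\<bar>"
    by (simp_all add: chi_def)
qed

lemma s_fun_eqI:
  assumes "g holomorphic_on - {0}"
    and "\<And>z. z \<noteq> 0 \<Longrightarrow> \<forall>\<^sub>F w in at z. g w = s_formula q p1 p2 m w"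
    and "l \<noteq> 0"
  shows "s_fun q p1 p2 l m = g l"
proof -
  have "isCont g l"
    using holomorphic_on_imp_continuous_on [OF assms(1)] assms(3)
    by (simp add: continuous_on_eq_continuous_at open_Compl)
  then have "(g \<longlongrightarrow> g l) (at l)"
    by (simp add: isCont_def)
  then have "(s_formula q p1 p2 m \<longlongrightarrow> g l) (at l)"
    using assms(2) [OF assms(3)] by (rule Lim_transform_eventually)
  then show ?thesis
    unfolding s_fun_def by (rule remove_sings_eqI)
qed

end

theory Submission
  imports Defs
begin

text \<open>
  Put \<open>Q = q\<^sup>2\<close>, \<open>A = q\<^sup>1\<^sup>+\<^sup>m / \<lambda>\<close> and \<open>B = q\<^sup>1\<^sup>+\<^sup>m \<lambda>\<close>, so that \<open>\<lambda> \<mapsto> 1 / \<lambda>\<close> exchanges \<open>A\<close> and \<open>B\<close>. Up to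
  elementary factors, \<open>s(p\<^sub>1, p\<^sub>2; \<lambda>, m)\<close> is a function \<open>J(x, y)\<close> that is symmetric in \<open>x = \<kappa>(p\<^sub>1)\<close> and
  \<open>y = \<kappa>(p\<^sub>2)\<close>, which turns the second relation into the first one. In each variable \<open>J\<close> satisfies a
  three-term recurrence, that is, it is an eigenfunction of a second order \<open>Q\<close>-difference operator, and
  Casoratians telescope to the orthogonality for generic \<open>\<lambda>\<close>. The recurrence in \<open>y\<close> also shows that the
  norms, after multiplication by a weight, depend only on the sign of \<open>y\<close>. For \<open>|\<lambda>| = 1\<close> the functions
  form an orthogonal system in a Hilbert space that is symmetric under transposition, and Bessel's
  inequality forces the constants for the two signs to agree; by analyticity they agree for all \<open>\<lambda>\<close>.
  The common constant is invariant under \<open>\<lambda> \<mapsto> Q \<lambda>\<close> and analytic on the punctured plane, hence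
  independent of \<open>\<lambda>\<close>, and it is read off at a point where the sum has only one nonzero term.
\<close>

text \<open>The lattice has four ends: 0 from either side, infinity, and -1, the point just beyond
  -Q. The Casoratian has equal limits at 0 from both sides because J is holomorphic there. At
  infinity the weight decays faster than any power, and J is shown to grow at most like a power by
  using that A B is an integral power of Q. At -1 a factor 1 + x vanishes. The recurrence in y moves
  only by powers of Q and never changes the sign, so it cannot compare the norms at y = 1 and y =
  -Q. This is the gap that the Hilbert space argument fills; it needs one nonzero entry linking the
  signs, which J at y = -Q supplies. There J does not depend on the other variable, so the norm is a
  multiple of the total mass of the weight, and its invariance becomes a shift relation for this
  mass. At exceptional \<lambda> the weight has poles. A theta factor removes them from each
  summand, and bounds on good circles, extended by the maximum modulus principle, carry the
  summation across.\<close>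

lemma qpoch_0 [simp]: "qpoch a q 0 = 1"
  by (simp add: qpoch_def)

lemma qpoch_Suc: "qpoch a q (Suc n) = qpoch a q n * (1 - a * q ^ n)"
  by (simp add: qpoch_def)

lemma qpoch_Suc': "qpoch a q (Suc n) = (1 - a) * qpoch (a * q) q n"
  unfolding qpoch_def prod.lessThan_Suc_shift by (simp add: mult.assoc)

lemma qpoch_add: "qpoch a q (n + k) = qpoch a q n * qpoch (a * q ^ n) q k"
  by (induction k) (simp_all add: qpoch_Suc power_add mult_ac)

lemma qpoch_eq_0_iff: "qpoch a q n = 0 \<longleftrightarrow> (\<exists>k<n. a * q ^ k = 1)"
  by (auto simp: qpoch_def)

lemma of_real_qpoch: "of_real (qpoch a q n) = qpoch (of_real a) (of_real q) n"
  by (simp add: qpoch_def)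

lemma has_sum_zero_unique:
  fixes f :: "'a \<Rightarrow> complex"
  assumes "(f has_sum S) A" "\<And>x. f x = 0"
  shows "S = 0"
  using has_sum_unique[OF assms(1) has_sum_0[of A f]] assms(2) by simp

lemma has_sum_sum:
  fixes f :: "'a \<Rightarrow> 'b \<Rightarrow> complex"
  assumes "\<And>i. i \<in> F \<Longrightarrow> (f i has_sum S i) A"
  shows "((\<lambda>x. \<Sum>i\<in>F. f i x) has_sum (\<Sum>i\<in>F. S i)) A"
  using assms by (induction F rule: infinite_finite_induct) (auto intro!: has_sum_add has_sum_0)

no_notation Infinite_Set_Sum.abs_summable_on (infix "abs'_summable'_on" 50)

section \<open>Shifted factorials to a real base between 0 and 1\<close>

locale q_base =
  fixes Q :: real
  assumes Q_pos: "0 < Q" and Q_less_1: "Q < 1"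
begin

abbreviation CQ :: complex where "CQ \<equiv> complex_of_real Q"
abbreviation pinf :: "complex \<Rightarrow> complex" where "pinf a \<equiv> qpoch_inf a CQ"

lemma Q_nz: "Q \<noteq> 0" "CQ \<noteq> 0"
  using Q_pos by auto

lemma abs_convergent_prod_qpoch:
  fixes a :: "'a :: {real_normed_field, banach}"
  shows "abs_convergent_prod (\<lambda>k. 1 - a * of_real Q ^ k)"
proof -
  have "summable (\<lambda>k. norm a * Q ^ k)"
    using Q_pos Q_less_1 by (intro summable_mult summable_geometric) auto
  then show ?thesis
    using Q_pos
    by (intro summable_imp_abs_convergent_prod) (simp add: norm_mult norm_power)
qed

lemma qpoch_LIMSEQ:
  fixes a :: "'a :: {real_normed_field, banach}"
  shows "(\<lambda>n. qpoch a (of_real Q) n) \<longlonglongrightarrow> qpoch_inf a (of_real Q)"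
proof -
  have "(\<lambda>n. \<Prod>k\<le>n. 1 - a * of_real Q ^ k) \<longlonglongrightarrow> (\<Prod>k. 1 - a * of_real Q ^ k)"
    by (intro convergent_prod_LIMSEQ abs_convergent_prod_imp_convergent_prod
        abs_convergent_prod_qpoch)
  then show ?thesis
    unfolding qpoch_def qpoch_inf_def
    using LIMSEQ_lessThan_iff_atMost[of "\<lambda>A. \<Prod>k\<in>A. 1 - a * of_real Q ^ k"] by simp
qed

lemma qpoch_inf_split:
  fixes a :: "'a :: {real_normed_field, banach}"
  shows "qpoch_inf a (of_real Q) = qpoch a (of_real Q) n * qpoch_inf (a * of_real Q ^ n) (of_real Q)"
proof -
  have "(\<lambda>k. qpoch a (of_real Q) (k + n)) \<longlonglongrightarrow> qpoch_inf a (of_real Q)"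
    by (rule LIMSEQ_ignore_initial_segment[OF qpoch_LIMSEQ])
  moreover have "(\<lambda>k. qpoch a (of_real Q) n * qpoch (a * of_real Q ^ n) (of_real Q) k)
      \<longlonglongrightarrow> qpoch a (of_real Q) n * qpoch_inf (a * of_real Q ^ n) (of_real Q)"
    by (intro tendsto_intros qpoch_LIMSEQ)
  ultimately show ?thesis
    unfolding add.commute[of _ n] qpoch_add by (rule LIMSEQ_unique)
qed

lemma qpoch_inf_rec:
  fixes a :: "'a :: {real_normed_field, banach}"
  shows "qpoch_inf a (of_real Q) = (1 - a) * qpoch_inf (a * of_real Q) (of_real Q)"
  using qpoch_inf_split[of a 1] by (simp add: qpoch_Suc')

lemma of_real_qpoch_inf: "complex_of_real (qpoch_inf a Q) = pinf (of_real a)"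
proof -
  have "(\<lambda>n. complex_of_real (qpoch a Q n)) \<longlonglongrightarrow> complex_of_real (qpoch_inf a Q)"
    using qpoch_LIMSEQ[of a] by (intro tendsto_of_real) simp
  then show ?thesis
    using qpoch_LIMSEQ[of "complex_of_real a"] by (simp add: of_real_qpoch LIMSEQ_unique)
qed

lemma qpoch_inf_eq_0_iff:
  fixes a :: "'a :: {real_normed_field, banach}"
  shows "qpoch_inf a (of_real Q) = 0 \<longleftrightarrow> (\<exists>k. a * of_real Q ^ k = 1)"
proof
  assume "qpoch_inf a (of_real Q) = 0"
  then show "\<exists>k. a * of_real Q ^ k = 1"
    using prodinf_nonzero[OF abs_convergent_prod_imp_convergent_prod[OF abs_convergent_prod_qpoch[of a]]]
    unfolding qpoch_inf_def by (metis eq_iff_diff_eq_0)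
next
  assume "\<exists>k. a * of_real Q ^ k = 1"
  then obtain k where k: "a * of_real Q ^ k = 1" ..
  then have "qpoch a (of_real Q) (Suc k) = 0"
    by (auto simp: qpoch_eq_0_iff)
  then show "qpoch_inf a (of_real Q) = 0"
    using qpoch_inf_split[of a "Suc k"] by simp
qed

text \<open>The inequality \<open>1 + t \<le> exp t\<close> in each factor and a geometric series
  give a bound that does not depend on \<open>n\<close>, so it passes to the infinite product and
  serves in majorants of series.\<close>

lemma norm_qpoch_le:
  fixes a :: "'a :: {real_normed_field, banach}"
  shows "norm (qpoch a (of_real Q) n) \<le> exp (norm a / (1 - Q))"
proof -
  have "norm (qpoch a (of_real Q) n) = (\<Prod>k<n. norm (1 - a * of_real Q ^ k))"
    by (simp add: qpoch_def prod_norm)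
  also have "\<dots> \<le> (\<Prod>k<n. exp (norm a * Q ^ k))"
  proof (intro prod_mono conjI norm_ge_zero)
    fix k
    have "norm (1 - a * of_real Q ^ k) \<le> norm (1::'a) + norm (a * of_real Q ^ k)"
      by (rule norm_triangle_ineq4)
    also have "\<dots> = 1 + norm a * Q ^ k"
      using Q_pos by (simp add: norm_mult norm_power)
    also have "\<dots> \<le> exp (norm a * Q ^ k)"
      using exp_ge_add_one_self by blast
    finally show "norm (1 - a * of_real Q ^ k) \<le> exp (norm a * Q ^ k)" .
  qed
  also have "\<dots> = exp (norm a * (\<Sum>k<n. Q ^ k))"
    by (simp add: exp_sum sum_distrib_left)
  also have "\<dots> \<le> exp (norm a * (1 / (1 - Q)))"
  proof -
    have "(\<Sum>k<n. Q ^ k) \<le> 1 / (1 - Q)"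
      using Q_pos Q_less_1 by (simp add: sum_gp_strict divide_simps)
    then show ?thesis
      by (simp add: mult_left_mono del: times_divide_eq_right)
  qed
  finally show ?thesis by simp
qed

lemma norm_qpoch_inf_le:
  fixes a :: "'a :: {real_normed_field, banach}"
  shows "norm (qpoch_inf a (of_real Q)) \<le> exp (norm a / (1 - Q))"
  by (rule LIMSEQ_le_const2[OF tendsto_norm[OF qpoch_LIMSEQ]]) (use norm_qpoch_le in blast)

lemma qpoch_inf_pos: "qpoch_inf a Q > 0" if "a < 1"
proof -
  have *: "a * Q ^ k < 1" for k
  proof (cases "a \<le> 0")
    case True
    then have "a * Q ^ k \<le> 0" using Q_pos by (simp add: mult_le_0_iff)
    then show ?thesis by linarith
  next
    case False
    then have "a * Q ^ k \<le> a * 1"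
      using Q_pos Q_less_1 by (intro mult_left_mono power_le_one) auto
    then show ?thesis using that by linarith
  qed
  have "qpoch a Q n \<ge> 0" for n
    unfolding qpoch_def using * by (intro prod_nonneg) (auto intro: less_imp_le)
  then have "qpoch_inf a Q \<ge> 0"
    using qpoch_LIMSEQ[of a] by (intro LIMSEQ_le_const) auto
  moreover have "qpoch_inf a Q \<noteq> 0"
    using qpoch_inf_eq_0_iff[of a] * by (auto simp: less_le)
  ultimately show ?thesis by simp
qed

lemma holomorphic_qpoch [holomorphic_intros]:
  "f holomorphic_on S \<Longrightarrow> (\<lambda>z. qpoch (f z) CQ n) holomorphic_on S"
  unfolding qpoch_def by (intro holomorphic_intros)

text \<open>The partial products are polynomials in \<open>a\<close>, and the deviations of their
  factors from 1 have a geometric majorant on each closed unit disc, so they converge locally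
  uniformly.\<close>

lemma pinf_holomorphic_UNIV: "pinf holomorphic_on UNIV"
proof (rule holomorphic_uniform_sequence[where f = "\<lambda>n a. qpoch a CQ n"])
  fix x :: complex
  show "\<exists>d>0. cball x d \<subseteq> UNIV \<and>
      uniform_limit (cball x d) (\<lambda>n a. qpoch a CQ n) pinf sequentially"
  proof (intro exI[of _ 1] conjI)
    have "uniformly_convergent_on (cball x 1) (\<lambda>N a. \<Sum>n<N. norm ((1 - a * CQ ^ n) - 1))"
    proof (rule Weierstrass_m_test')
      fix n a assume "a \<in> cball x (1::real)"
      then have "norm a \<le> norm x + 1"
        using norm_triangle_sub[of a x] by (auto simp: dist_norm norm_minus_commute)
      then show "norm (norm ((1 - a * CQ ^ n) - 1)) \<le> (norm x + 1) * Q ^ n"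
        using Q_pos by (simp add: norm_mult norm_power mult_right_mono)
    next
      show "summable (\<lambda>n. (norm x + 1) * Q ^ n)"
        using Q_pos Q_less_1 by (intro summable_mult summable_geometric) auto
    qed
    then have "uniformly_convergent_on (cball x 1) (\<lambda>N a. \<Prod>n<N. 1 - a * CQ ^ n)"
      by (intro uniformly_convergent_on_prod') (auto intro!: continuous_intros)
    then obtain l where l: "uniform_limit (cball x 1) (\<lambda>N a. \<Prod>n<N. 1 - a * CQ ^ n) l sequentially"
      by (auto simp: uniformly_convergent_on_def)
    moreover have "l a = pinf a" if "a \<in> cball x 1" for a
      using tendsto_uniform_limitI[OF l that] qpoch_LIMSEQ[of a]
      by (metis LIMSEQ_unique qpoch_def[abs_def] ext)
    ultimately show "uniform_limit (cball x 1) (\<lambda>n a. qpoch a CQ n) pinf sequentially"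
      unfolding qpoch_def by (rule_tac uniform_limit_cong'[THEN iffD1]) auto
  qed auto
qed (auto intro!: holomorphic_intros)

lemma holomorphic_pinf [holomorphic_intros]:
  assumes "f holomorphic_on S" shows "(\<lambda>z. pinf (f z)) holomorphic_on S"
  using holomorphic_on_compose[OF assms holomorphic_on_subset[OF pinf_holomorphic_UNIV]]
  by (simp add: o_def)

lemma continuous_on_pinf [continuous_intros]:
  assumes "continuous_on S f" shows "continuous_on S (\<lambda>z. pinf (f z))"
  using continuous_on_compose2[OF holomorphic_on_imp_continuous_on[OF pinf_holomorphic_UNIV] assms]
  by simp

lemma tendsto_pinf [tendsto_intros]:
  assumes "(f \<longlongrightarrow> a) F" shows "((\<lambda>z. pinf (f z)) \<longlongrightarrow> pinf a) F"
  using holomorphic_on_imp_continuous_on[OF pinf_holomorphic_UNIV] assms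
  by (intro isCont_tendsto_compose[where g=pinf]) (auto simp: continuous_on_eq_continuous_at)

lemma pinf_0 [simp]: "pinf 0 = 1"
  by (simp add: qpoch_inf_def)

section \<open>The regularized series as an entire function of its parameters\<close>

text \<open>The ratio of consecutive terms is \<open>Q ^ n * r\<close>, which tends to 0: the
  Gaussian factor beats every geometric growth, so the series in \<open>phi22_reg\<close> converges
  for all arguments.\<close>

lemma summable_gauss: "summable (\<lambda>n. Q ^ (n choose 2) * r ^ n)" for r :: real
proof -
  have "(\<lambda>n. Q ^ n * \<bar>r\<bar>) \<longlonglongrightarrow> 0"
    using Q_pos Q_less_1 by (intro tendsto_mult_left_zero LIMSEQ_power_zero) auto
  then have "eventually (\<lambda>n. Q ^ n * \<bar>r\<bar> < 1/2) sequentially"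
    by (rule order_tendstoD) simp
  then obtain N where N: "\<And>n. n \<ge> N \<Longrightarrow> Q ^ n * \<bar>r\<bar> < 1/2"
    by (auto simp: eventually_sequentially)
  show ?thesis
  proof (rule summable_ratio_test[of "1/2" N])
    fix n assume "n \<ge> N"
    have "norm (Q ^ (Suc n choose 2) * r ^ Suc n)
        = (Q ^ n * \<bar>r\<bar>) * norm (Q ^ (n choose 2) * r ^ n)"
      using Q_pos by (simp add: numeral_2_eq_2 power_add abs_mult power_abs mult_ac)
    also have "\<dots> \<le> 1/2 * norm (Q ^ (n choose 2) * r ^ n)"
      using N[OF \<open>n \<ge> N\<close>] by (intro mult_right_mono) auto
    finally show "norm (Q ^ (Suc n choose 2) * r ^ Suc n) \<le> 1/2 * norm (Q ^ (n choose 2) * r ^ n)" .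
  qed simp
qed

text \<open>Keeps the denominators of the series away from 0 uniformly in \<open>n\<close>: the
  discarded tail of the infinite product has factors between 0 and 1.\<close>

lemma qpoch_Q_ge: "qpoch Q Q n \<ge> qpoch_inf Q Q"
proof -
  have "qpoch_inf Q Q = qpoch Q Q n * qpoch_inf (Q * Q ^ n) Q"
    using qpoch_inf_split[of Q n] by simp
  moreover have "qpoch_inf (Q * Q ^ n) Q \<le> 1"
  proof (rule LIMSEQ_le_const2[OF qpoch_LIMSEQ[where ?'a=real, simplified]])
    show "\<exists>N. \<forall>k\<ge>N. qpoch (Q * Q ^ n) Q k \<le> 1"
      unfolding qpoch_def using Q_pos Q_less_1
      by (intro exI[of _ 0] allI impI prod_le_1 conjI)
         (auto intro!: mult_le_one power_le_one simp flip: power_Suc power_add)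
  qed
  moreover have "qpoch Q Q n \<ge> 0"
    unfolding qpoch_def using Q_pos Q_less_1
    by (intro prod_nonneg) (auto intro!: power_le_one simp flip: power_Suc)
  ultimately show ?thesis
    by (simp add: mult_left_le)
qed

lemma qpoch_Q_nz: "qpoch CQ CQ n \<noteq> 0"
proof -
  have "Q * Q ^ k \<noteq> 1" for k
    using Q_pos Q_less_1 power_Suc_less_one[of Q k] by auto
  then show ?thesis
    by (auto simp: qpoch_eq_0_iff simp flip: of_real_power of_real_mult)
qed

definition phi_term where
  "phi_term a b c d z n = qpoch a CQ n * qpoch b CQ n / qpoch CQ CQ n
     * (pinf (c * CQ ^ n) * pinf (d * CQ ^ n)) * ((-1) ^ n * CQ ^ (n choose 2)) * z ^ n"

lemma phi22_reg_eq: "phi22_reg a b c d CQ z = (\<Sum>n. phi_term a b c d z n)"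
  by (simp add: phi22_reg_def phi_term_def qpochs_inf_def)

text \<open>The fourth power accounts for two finite and two infinite products, each at most
  \<open>exp (r / (1 - Q))\<close> when its argument is bounded by \<open>r\<close>; the denominator
  is the lower bound for \<open>qpoch Q Q n\<close>.\<close>

definition phi_bd where
  "phi_bd r = exp (r / (1 - Q)) ^ 4 / qpoch_inf Q Q"

lemma phi_bd_nonneg: "phi_bd r \<ge> 0"
  using qpoch_inf_pos[OF Q_less_1] by (simp add: phi_bd_def)

lemma norm_phi_term_le:
  assumes "norm a \<le> r" "norm b \<le> r" "norm c \<le> r" "norm d \<le> r" "norm z \<le> r"
  shows "norm (phi_term a b c d z n) \<le> phi_bd r * (Q ^ (n choose 2) * r ^ n)"
proof -
  have r: "r \<ge> 0" using assms(1) norm_ge_zero order_trans by blast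
  define e where "e = exp (r / (1 - Q))"
  have e: "norm (qpoch w CQ n) \<le> e" "norm (pinf (w * CQ ^ n)) \<le> e" if "norm w \<le> r" for w
  proof -
    have 1: "norm v \<le> r \<Longrightarrow> exp (norm v / (1 - Q)) \<le> e" for v :: complex
      unfolding e_def using Q_less_1 by (auto intro!: divide_right_mono)
    show "norm (qpoch w CQ n) \<le> e"
      using norm_qpoch_le[of w n] 1[OF that] by simp
    have "norm (w * CQ ^ n) \<le> norm w"
      using Q_pos Q_less_1 by (simp add: norm_mult norm_power mult_left_le power_le_one)
    then show "norm (pinf (w * CQ ^ n)) \<le> e"
      using norm_qpoch_inf_le[of "w * CQ ^ n"] 1[of "w * CQ ^ n"] that by simp
  qed
  have "norm (qpoch CQ CQ n) = \<bar>qpoch Q Q n\<bar>"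
    by (simp flip: of_real_qpoch)
  then have q: "norm (qpoch CQ CQ n) \<ge> qpoch_inf Q Q"
    using qpoch_Q_ge[of n] by simp
  have pq: "qpoch_inf Q Q > 0" by (rule qpoch_inf_pos[OF Q_less_1])
  have e0: "e \<ge> 0" by (simp add: e_def)
  have "norm (phi_term a b c d z n) = norm (qpoch a CQ n) * norm (qpoch b CQ n) / norm (qpoch CQ CQ n)
     * (norm (pinf (c * CQ ^ n)) * norm (pinf (d * CQ ^ n))) * Q ^ (n choose 2) * norm z ^ n"
    using Q_pos by (simp add: phi_term_def norm_mult norm_divide norm_power)
  also have "\<dots> \<le> e * e / qpoch_inf Q Q * (e * e) * Q ^ (n choose 2) * r ^ n"
    using assms e q pq e0 Q_pos r
    by (intro mult_mono frac_le power_mono) (auto intro!: mult_nonneg_nonneg divide_nonneg_nonneg)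
  finally show ?thesis
    by (simp add: phi_bd_def e_def power4_eq_xxxx mult_ac)
qed

lemma summable_phi_bd: "summable (\<lambda>n. phi_bd r * (Q ^ (n choose 2) * r ^ n))"
  by (intro summable_mult summable_gauss)

lemma summable_phi_term: "summable (\<lambda>n. norm (phi_term a b c d z n))"
proof (rule summable_comparison_test)
  define r where "r = norm a + norm b + norm c + norm d + norm z"
  have "norm a \<le> r" "norm b \<le> r" "norm c \<le> r" "norm d \<le> r" "norm z \<le> r"
    unfolding r_def using norm_ge_zero[of a] norm_ge_zero[of b] norm_ge_zero[of c]
      norm_ge_zero[of d] norm_ge_zero[of z] by linarith+
  from norm_phi_term_le[OF this]
  show "\<exists>N. \<forall>n\<ge>N. norm (norm (phi_term a b c d z n)) \<le> phi_bd r * (Q ^ (n choose 2) * r ^ n)"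
    by simp
qed (rule summable_phi_bd)

definition phi_sup where "phi_sup r = (\<Sum>n. phi_bd r * (Q ^ (n choose 2) * r ^ n))"

lemma norm_phi22_le:
  assumes "norm a \<le> r" "norm b \<le> r" "norm c \<le> r" "norm d \<le> r" "norm z \<le> r"
  shows "norm (phi22_reg a b c d CQ z) \<le> phi_sup r"
  unfolding phi22_reg_eq phi_sup_def
  by (rule norm_suminf_le[OF norm_phi_term_le[OF assms] summable_phi_bd])

text \<open>The termwise regularized form has no poles in the lower parameters, and the majorant is
  uniform on compact sets, so the M-test gives analyticity along any holomorphic choice of the five
  arguments.\<close>

lemma holomorphic_phi22 [holomorphic_intros]:
  assumes "open S" and hol: "a holomorphic_on S" "b holomorphic_on S" "c holomorphic_on S"
    "d holomorphic_on S" "z holomorphic_on S"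
  shows "(\<lambda>s. phi22_reg (a s) (b s) (c s) (d s) CQ (z s)) holomorphic_on S"
proof (rule holomorphic_uniform_sequence[OF \<open>open S\<close>,
      where f = "\<lambda>N s. \<Sum>n<N. phi_term (a s) (b s) (c s) (d s) (z s) n"])
  show "(\<lambda>s. \<Sum>n<N. phi_term (a s) (b s) (c s) (d s) (z s) n) holomorphic_on S" for N
    unfolding phi_term_def by (intro holomorphic_intros hol) (rule qpoch_Q_nz)
  fix x assume "x \<in> S"
  then obtain e where e: "e > 0" "cball x e \<subseteq> S"
    using \<open>open S\<close> open_contains_cball by blast
  define K where "K = cball x e"
  have cont: "continuous_on K f" if "f holomorphic_on S" for f
    using holomorphic_on_imp_continuous_on[OF that] e continuous_on_subset unfolding K_def by blast
  have "continuous_on K (\<lambda>s. norm (a s) + norm (b s) + norm (c s) + norm (d s) + norm (z s))"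
    by (intro continuous_intros cont hol)
  then have "bounded ((\<lambda>s. norm (a s) + norm (b s) + norm (c s) + norm (d s) + norm (z s)) ` K)"
    by (intro compact_imp_bounded compact_continuous_image) (simp_all add: K_def)
  then have "\<exists>r. \<forall>s\<in>K. norm (a s) + norm (b s) + norm (c s) + norm (d s) + norm (z s) \<le> r"
    by (auto simp: bounded_real)
  then obtain r where r: "\<And>s. s \<in> K \<Longrightarrow> norm (a s) + norm (b s) + norm (c s) + norm (d s) + norm (z s) \<le> r"
    by blast
  have r': "norm (a s) \<le> r" "norm (b s) \<le> r" "norm (c s) \<le> r" "norm (d s) \<le> r" "norm (z s) \<le> r"
    if "s \<in> K" for s
    using r[OF that] norm_ge_zero[of "a s"] norm_ge_zero[of "b s"] norm_ge_zero[of "c s"]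
      norm_ge_zero[of "d s"] norm_ge_zero[of "z s"] by linarith+
  have "uniform_limit K (\<lambda>N s. \<Sum>n<N. phi_term (a s) (b s) (c s) (d s) (z s) n)
      (\<lambda>s. \<Sum>n. phi_term (a s) (b s) (c s) (d s) (z s) n) sequentially"
    by (rule Weierstrass_m_test[OF norm_phi_term_le[OF r'] summable_phi_bd])
  then show "\<exists>d'>0. cball x d' \<subseteq> S \<and> uniform_limit (cball x d')
      (\<lambda>N s. \<Sum>n<N. phi_term (a s) (b s) (c s) (d s) (z s) n)
      (\<lambda>s. phi22_reg (a s) (b s) (c s) (d s) CQ (z s)) sequentially"
    using e unfolding K_def phi22_reg_eq by blast
qed

subsection \<open>The function \<open>J\<close> and its recurrence\<close>

lemma phi22_sums: "phi_term a b c d z sums phi22_reg a b c d CQ z"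
  unfolding phi22_reg_eq by (intro summable_sums summable_norm_cancel[OF summable_phi_term])

lemma phi_term_tendsto_0: "phi_term a b c d z \<longlonglongrightarrow> 0"
  by (intro summable_LIMSEQ_zero summable_norm_cancel[OF summable_phi_term])

text \<open>With base \<open>Q = q\<^sup>2\<close>, \<open>x = \<kappa>(p\<^sub>1)\<close>, \<open>y = \<kappa>(p\<^sub>2)\<close>, \<open>A = q\<^sup>1\<^sup>+\<^sup>m / \<lambda>\<close> and \<open>B = q\<^sup>1\<^sup>+\<^sup>m \<lambda>\<close>,
  this is the hypergeometric factor of \<open>s(p\<^sub>1, p\<^sub>2; \<lambda>, m)\<close>.\<close>

definition J :: "complex \<Rightarrow> complex \<Rightarrow> complex \<Rightarrow> complex \<Rightarrow> complex" where
  "J A B x y = phi22_reg (y * B) (x * B) (x * y * A * B) (- (CQ * B)) CQ (- (CQ * A))"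

lemma J_commute: "J A B x y = J A B y x"
  by (simp add: J_def phi22_reg_def mult_ac)

lemma holomorphic_J [holomorphic_intros]:
  assumes "open S" "A holomorphic_on S" "B holomorphic_on S" "x holomorphic_on S" "y holomorphic_on S"
  shows "(\<lambda>s. J (A s) (B s) (x s) (y s)) holomorphic_on S"
  unfolding J_def by (intro holomorphic_intros assms)

text \<open>A certificate for creative telescoping: the left side collects the three shifted
  summands of \<open>J_rec\<close> after division by their common factors, the right side is the
  increment of \<open>G\<close> there, and \<open>N\<close> stands for
  \<open>CQ ^ n\<close>.\<close>

lemma J_rec_poly:
  fixes A B N c :: complex
  assumes "c = x * y * A * B" "p = CQ * x\<^sup>2 * B * (1 - y * A)"
  shows "(1 - CQ * x * A) * (1 - x * B * N) * (1 - CQ * x * B * N)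
      + CQ * (1 + x) * (1 - x * B) * (1 - c * N) * (1 - CQ * c * N)
      + (CQ * x\<^sup>2 * y * A * B + CQ * x * (A + B - 1) - (CQ + 1)) * (1 - x * B * N) * (1 - CQ * c * N)
    = p * ((1 - y * B * N) * N * CQ * A * (1 - x * B * N) - (1 - N) * (1 + B * N) * (1 - CQ * c * N))"
  unfolding assms by (simp add: algebra_simps power2_eq_square)

lemma J_rec:
  "(1 - CQ * x * A) * (1 - CQ * x * B) * J A B (CQ * (CQ * x)) y + CQ * (1 + x) * J A B x y
    + (CQ * x\<^sup>2 * y * A * B + CQ * x * (A + B - 1) - (CQ + 1)) * J A B (CQ * x) y = 0"
proof -
  define c where "c = x * y * A * B"
  define p where "p = CQ * x\<^sup>2 * B * (1 - y * A)"
  define \<beta> where "\<beta> = CQ * x\<^sup>2 * y * A * B + CQ * x * (A + B - 1) - (CQ + 1)"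
  define d where "d = - (CQ * B)"
  define z where "z = - (CQ * A)"
  define \<tau> where "\<tau> = (\<lambda>n. qpoch (y * B) CQ n / qpoch CQ CQ n * pinf (d * CQ ^ n)
    * ((-1) ^ n * CQ ^ (n choose 2)) * z ^ n)"
  define t where "t = (\<lambda>b c n. phi_term (y * B) b c d z n)"
  have t: "t b c n = \<tau> n * qpoch b CQ n * pinf (c * CQ ^ n)" for b c n
    by (simp add: t_def \<tau>_def phi_term_def)
  text \<open>The recurrence holds termwise up to the telescoping sum of the increments of \<open>G\<close>.\<close>
  define G where "G = (\<lambda>n. p * \<tau> n * (1 - CQ ^ n) * (1 + B * CQ ^ n) * qpoch (CQ * x * B) CQ (n - 1)
    * pinf (CQ * c * CQ ^ n))"
  have pinf_rec: "pinf w = (1 - w) * pinf (w * CQ)" for w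
    using qpoch_inf_rec[of w] by simp
  \<comment> \<open>The first factor removes the newest factor of
    \<open>qpoch CQ CQ (Suc n)\<close>, the second restores the one that
    \<open>pinf (d * CQ ^ n)\<close> loses in passing to \<open>Suc n\<close>.\<close>
  have \<tau>_Suc: "\<tau> (Suc n) * (1 - CQ ^ Suc n) * (1 + B * CQ ^ Suc n)
      = \<tau> n * (1 - y * B * CQ ^ n) * CQ ^ n * CQ * A" for n
  proof -
    have nz: "1 - CQ * CQ ^ n \<noteq> 0" "qpoch CQ CQ n \<noteq> 0"
      using qpoch_Q_nz[of "Suc n"] by (auto simp: qpoch_Suc)
    have "pinf (d * CQ ^ n) = (1 + B * CQ ^ Suc n) * pinf (d * CQ ^ Suc n)"
      using pinf_rec[of "d * CQ ^ n"] by (simp add: d_def mult_ac)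
    then show ?thesis
      using nz by (simp add: \<tau>_def qpoch_Suc z_def field_simps numeral_2_eq_2 power_add)
  qed
  have G_Suc: "G (Suc n) = p * (1 - y * B * CQ ^ n) * CQ ^ n * CQ * A * t (CQ * x * B) (CQ * CQ * c) n" for n
  proof -
    have "G (Suc n) = p * (\<tau> (Suc n) * (1 - CQ ^ Suc n) * (1 + B * CQ ^ Suc n)) * qpoch (CQ * x * B) CQ n
        * pinf (CQ * c * CQ ^ Suc n)"
      by (simp add: G_def)
    also have "\<dots> = p * (1 - y * B * CQ ^ n) * CQ ^ n * CQ * A * t (CQ * x * B) (CQ * CQ * c) n"
      unfolding \<tau>_Suc t by (simp add: mult_ac)
    finally show ?thesis .
  qed
  have "(\<lambda>n. G (Suc n)) \<longlonglongrightarrow> p * (1 - y * B * 0) * 0 * CQ * A * 0"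
    unfolding G_Suc t_def using Q_pos Q_less_1
    by (intro tendsto_intros phi_term_tendsto_0 LIMSEQ_power_zero) auto
  then have "G \<longlonglongrightarrow> 0"
    by (simp add: filterlim_sequentially_Suc)
  then have G_sums: "(\<lambda>n. G (Suc n) - G n) sums 0"
    using telescope_sums[of G 0] by (simp add: G_def)
  have key: "(1 - CQ * x * A) * (1 - CQ * x * B) * t (CQ * (CQ * x) * B) (CQ * CQ * c) n
      + CQ * (1 + x) * t (x * B) c n + \<beta> * t (CQ * x * B) (CQ * c) n = G (Suc n) - G n" for n
  proof -
    define N where "N = CQ ^ n"
    define E where "E = pinf (CQ * CQ * c * N)"
    have E: "pinf (CQ * c * N) = (1 - CQ * c * N) * E" "pinf (c * N) = (1 - c * N) * (1 - CQ * c * N) * E"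
      using pinf_rec[of "CQ * c * N"] pinf_rec[of "c * N"] by (simp_all add: E_def mult_ac)
    show ?thesis
    proof (cases n)
      \<comment> \<open>At \<open>n = 0\<close> there is no common factor
        \<open>qpoch (CQ * x * B) CQ (n - 1)\<close> to divide out, and \<open>G 0 = 0\<close>
        because of \<open>1 - CQ ^ 0\<close>, so this case is a polynomial identity of its
        own.\<close>
      case 0
      have "(1 - CQ * x * A) * (1 - CQ * x * B) + CQ * (1 + x) * (1 - c) * (1 - CQ * c)
            + \<beta> * (1 - CQ * c) = p * (1 - y * B) * CQ * A"
        by (simp add: c_def p_def \<beta>_def algebra_simps power2_eq_square)
      then have poly: "\<tau> 0 * E * ((1 - CQ * x * A) * (1 - CQ * x * B) + CQ * (1 + x) * (1 - c) * (1 - CQ * c)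
            + \<beta> * (1 - CQ * c)) = \<tau> 0 * E * (p * (1 - y * B) * CQ * A)"
        by simp
      have N1: "N = 1" by (simp add: N_def 0)
      have 1: "G 0 = 0" by (simp add: G_def)
      have 2: "G (Suc 0) = \<tau> 0 * E * (p * (1 - y * B) * CQ * A)"
        using G_Suc[of 0] by (simp add: t E_def N1 mult_ac)
      have 3: "t (CQ * (CQ * x) * B) (CQ * CQ * c) 0 = \<tau> 0 * E"
        "t (x * B) c 0 = \<tau> 0 * E * ((1 - c) * (1 - CQ * c))"
        "t (CQ * x * B) (CQ * c) 0 = \<tau> 0 * E * (1 - CQ * c)"
        using E by (simp_all add: t E_def N1 mult_ac)
      show ?thesis
        unfolding 0 1 2 3 poly[symmetric] by (simp only: distrib_left mult_ac diff_0_right)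
    next
      case (Suc k)
      define M where "M = CQ ^ k"
      define R where "R = qpoch (CQ * x * B) CQ k"
      have N: "N = CQ * M" by (simp add: N_def M_def Suc)
      have R: "qpoch (CQ * x * B) CQ n = R * (1 - x * B * N)"
        "(1 - CQ * x * B) * qpoch (CQ * (CQ * x) * B) CQ n = R * (1 - x * B * N) * (1 - CQ * x * B * N)"
        "qpoch (x * B) CQ n = (1 - x * B) * R"
      proof -
        show 1: "qpoch (CQ * x * B) CQ n = R * (1 - x * B * N)"
          by (simp add: Suc qpoch_Suc R_def N M_def mult_ac)
        have "(1 - CQ * x * B) * qpoch (CQ * (CQ * x) * B) CQ n = qpoch (CQ * x * B) CQ (Suc n)"
          unfolding qpoch_Suc' by (simp add: mult_ac)
        then show "(1 - CQ * x * B) * qpoch (CQ * (CQ * x) * B) CQ n = R * (1 - x * B * N) * (1 - CQ * x * B * N)"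
          unfolding qpoch_Suc[of _ _ n] 1 by (simp add: N_def mult_ac)
        show "qpoch (x * B) CQ n = (1 - x * B) * R"
          by (simp add: Suc qpoch_Suc' R_def mult_ac)
      qed
      have 1: "(1 - CQ * x * A) * (1 - CQ * x * B) * t (CQ * (CQ * x) * B) (CQ * CQ * c) n
        = \<tau> n * E * R * ((1 - CQ * x * A) * (1 - x * B * N) * (1 - CQ * x * B * N))"
      proof -
        have "(1 - CQ * x * A) * (1 - CQ * x * B) * t (CQ * (CQ * x) * B) (CQ * CQ * c) n
          = (1 - CQ * x * A) * \<tau> n * E * ((1 - CQ * x * B) * qpoch (CQ * (CQ * x) * B) CQ n)"
          unfolding t by (simp add: E_def N_def mult_ac)
        then show ?thesis unfolding R by (simp add: mult_ac)
      qed
      have 2: "CQ * (1 + x) * t (x * B) c n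
        = \<tau> n * E * R * (CQ * (1 + x) * (1 - x * B) * (1 - c * N) * (1 - CQ * c * N))"
        unfolding t R E N_def[symmetric] by (simp add: mult_ac)
      have 3: "\<beta> * t (CQ * x * B) (CQ * c) n
        = \<tau> n * E * R * (\<beta> * (1 - x * B * N) * (1 - CQ * c * N))"
        unfolding t R E N_def[symmetric] by (simp add: mult_ac)
      have 4: "G (Suc n) = \<tau> n * E * R * (p * ((1 - y * B * N) * N * CQ * A * (1 - x * B * N)))"
        unfolding G_Suc t R N_def[symmetric] E_def[symmetric] by (simp add: mult_ac)
      have 5: "G n = \<tau> n * E * R * (p * ((1 - N) * (1 + B * N) * (1 - CQ * c * N)))"
        unfolding G_def N_def[symmetric] E by (simp add: R_def Suc mult_ac)
      have *: "X + Y + Z = P * (V - W) \<Longrightarrow> T * X + T * Y + T * Z = T * (P * V) - T * (P * W)"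
        for T X Y Z V W P :: complex by (metis distrib_left right_diff_distrib)
      show ?thesis
        unfolding 1 2 3 4 5
        by (rule *, unfold \<beta>_def, rule J_rec_poly) (simp_all add: c_def p_def)
    qed
  qed
  have J: "J A B (CQ * (CQ * x)) y = (\<Sum>n. t (CQ * (CQ * x) * B) (CQ * CQ * c) n)"
    "J A B x y = (\<Sum>n. t (x * B) c n)" "J A B (CQ * x) y = (\<Sum>n. t (CQ * x * B) (CQ * c) n)"
    by (simp_all add: J_def t_def phi22_reg_eq d_def z_def c_def mult_ac)
  have summ: "summable (t b c)" for b c
    unfolding t_def by (intro summable_norm_cancel[OF summable_phi_term])
  have "(\<lambda>n. (1 - CQ * x * A) * (1 - CQ * x * B) * t (CQ * (CQ * x) * B) (CQ * CQ * c) n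
      + CQ * (1 + x) * t (x * B) c n + \<beta> * t (CQ * x * B) (CQ * c) n)
     sums ((1 - CQ * x * A) * (1 - CQ * x * B) * J A B (CQ * (CQ * x)) y + CQ * (1 + x) * J A B x y
      + \<beta> * J A B (CQ * x) y)"
    unfolding J by (intro sums_add sums_mult summable_sums summ)
  then have "(\<lambda>n. G (Suc n) - G n) sums ((1 - CQ * x * A) * (1 - CQ * x * B) * J A B (CQ * (CQ * x)) y
      + CQ * (1 + x) * J A B x y + \<beta> * J A B (CQ * x) y)"
    unfolding key .
  from sums_unique2[OF this G_sums] show ?thesis
    by (simp add: \<beta>_def)
qed

lemma pinf_rec: "pinf w = (1 - w) * pinf (w * CQ)"
  using qpoch_inf_rec[of w] by simp

lemma pinf_split: "pinf w = qpoch w CQ n * pinf (w * CQ ^ n)"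
  using qpoch_inf_split[of w n] by simp

lemma CQ_power_LIMSEQ: "(\<lambda>n. w * CQ ^ n) \<longlonglongrightarrow> 0"
  using Q_pos Q_less_1 by (intro tendsto_mult_right_zero LIMSEQ_power_zero) auto

text \<open>The difference of the values at \<open>e\<close> and \<open>e q\<close> solves \<open>g(z) = - e z g(q z)\<close>, which has no
  nonzero solution that is bounded at the origin; hence the sum does not depend on \<open>e\<close>.\<close>

lemma phi11_sum: "phi22_reg 0 e (e * z) 0 CQ z = pinf z"
proof -
  define f where "f = (\<lambda>e z. phi22_reg 0 e (e * z) 0 CQ z)"
  define s where "s = (\<lambda>z n. (-1) ^ n * CQ ^ (n choose 2) * z ^ n / qpoch CQ CQ n :: complex)"
  have trm: "phi_term 0 e c 0 z n = s z n * (qpoch e CQ n * pinf (c * CQ ^ n))" for e c z n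
    by (simp add: phi_term_def s_def qpoch_def)
  have s_Suc: "s z (Suc n) * (1 - CQ ^ Suc n) = - z * (s (z * CQ) n)" for z n
  proof -
    have nz: "1 - CQ * CQ ^ n \<noteq> 0" "qpoch CQ CQ n \<noteq> 0"
      using qpoch_Q_nz[of "Suc n"] by (auto simp: qpoch_Suc)
    then show ?thesis
      by (simp add: s_def qpoch_Suc field_simps numeral_2_eq_2 power_add)
  qed
  have sCQ: "s (z * CQ) n = s z n * CQ ^ n" for z n
    by (simp add: s_def power_mult_distrib)
  define D where "D = (\<lambda>e z n. phi_term 0 e (e * z) 0 z n - phi_term 0 (e * CQ) (e * CQ * z) 0 z n)"
  have D_sums: "D e z sums (f e z - f (e * CQ) z)" for e z
    unfolding D_def f_def by (intro sums_diff phi22_sums)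
  have D: "D e z n = - e * (s z n * (1 - CQ ^ n) * (qpoch (e * CQ) CQ (n - 1) * pinf (e * CQ * z * CQ ^ n)))
      - e * z * phi_term 0 e (e * (z * CQ)) 0 (z * CQ) n" for e z n
  proof (cases n)
    case 0
    then show ?thesis
      using pinf_rec[of "e * z"] by (simp add: D_def trm s_def algebra_simps numeral_2_eq_2)
  next
    case (Suc k)
    have 1: "qpoch e CQ n = (1 - e) * qpoch (e * CQ) CQ k"
      "qpoch (e * CQ) CQ n = qpoch (e * CQ) CQ k * (1 - e * CQ ^ n)"
      unfolding Suc by (rule qpoch_Suc', simp add: qpoch_Suc mult_ac)
    have 2: "pinf (e * z * CQ ^ n) = (1 - e * z * CQ ^ n) * pinf (e * CQ * z * CQ ^ n)"
      "pinf (e * (z * CQ) * CQ ^ n) = pinf (e * CQ * z * CQ ^ n)"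
      using pinf_rec[of "e * z * CQ ^ n"] by (simp_all add: mult_ac)
    have "n - 1 = k" by (simp add: Suc)
    then show ?thesis
      unfolding D_def trm 1 2 sCQ by (simp add: algebra_simps)
  qed
  define U where "U = (\<lambda>e z n. - e * (s z n * (1 - CQ ^ n) * (qpoch (e * CQ) CQ (n - 1) * pinf (e * CQ * z * CQ ^ n))))"
  have U_Suc: "U e z (Suc n) = e * z * phi_term 0 (e * CQ) (e * CQ * (z * CQ)) 0 (z * CQ) n" for e z n
  proof -
    have "U e z (Suc n) = - e * (s z (Suc n) * (1 - CQ ^ Suc n)) * (qpoch (e * CQ) CQ n * pinf (e * CQ * z * CQ ^ Suc n))"
      by (simp add: U_def)
    then show ?thesis unfolding s_Suc trm by (simp add: mult_ac)
  qed
  have U_sums: "U e z sums (e * z * f (e * CQ) (z * CQ))" for e z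
  proof -
    have "(\<lambda>n. U e z (Suc n)) sums (e * z * f (e * CQ) (z * CQ))"
      unfolding U_Suc f_def by (intro sums_mult phi22_sums)
    then show ?thesis
      using sums_Suc_iff[of "U e z"] by (simp add: U_def)
  qed
  have step: "f e z - f (e * CQ) z = - (e * z) * (f e (z * CQ) - f (e * CQ) (z * CQ))" for e z
  proof -
    have "D e z sums (e * z * f (e * CQ) (z * CQ) - e * z * f e (z * CQ))"
      using sums_diff[OF U_sums[of e z] sums_mult[OF phi22_sums[of 0 e "e * (z * CQ)" 0 "z * CQ"], of "e * z"]]
      unfolding U_def f_def D .
    from sums_unique2[OF D_sums[of e z] this] show ?thesis
      by (simp add: algebra_simps)
  qed
  have iter: "f e z - f (e * CQ) z = (- (e * z)) ^ n * CQ ^ (n choose 2)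
      * (f e (z * CQ ^ n) - f (e * CQ) (z * CQ ^ n))" for e z n
  proof (induction n)
    case (Suc n)
    then show ?case
      using step[of e "z * CQ ^ n"] by (simp add: mult_ac numeral_2_eq_2 power_add)
  qed (simp add: numeral_2_eq_2)
  have holf: "(\<lambda>w. f (fst w) (snd w)) \<circ> (\<lambda>v. (a v, b v)) holomorphic_on UNIV"
    if "a holomorphic_on UNIV" "b holomorphic_on UNIV" for a b :: "complex \<Rightarrow> complex"
    unfolding f_def o_def by (auto intro!: holomorphic_intros that)
  have f_lim: "(\<lambda>n. f (a (w * CQ ^ n)) (b (w * CQ ^ n))) \<longlonglongrightarrow> f (a 0) (b 0)"
    if "a holomorphic_on UNIV" "b holomorphic_on UNIV" for a b w
  proof -
    have "isCont (\<lambda>v. f (a v) (b v)) 0"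
      using holomorphic_on_imp_continuous_on[OF holf[OF that]]
      by (simp add: o_def continuous_on_eq_continuous_at)
    then show ?thesis
      by (rule isCont_tendsto_compose) (rule CQ_power_LIMSEQ)
  qed
  have indep: "f e z = f (e * CQ) z" for e z
  proof -
    \<comment> \<open>The Gaussian factor overcomes the geometric one, while the bracket in
      \<open>iter\<close> converges by continuity at \<open>z = 0\<close>.\<close>
    have "(\<lambda>n. (- (e * z)) ^ n * CQ ^ (n choose 2)) \<longlonglongrightarrow> 0"
    proof (rule tendsto_norm_zero_cancel)
      show "(\<lambda>n. norm ((- (e * z)) ^ n * CQ ^ (n choose 2))) \<longlonglongrightarrow> 0"
        using summable_LIMSEQ_zero[OF summable_gauss[of "norm (e * z)"]] Q_pos
        by (simp add: norm_mult norm_power mult_ac)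
    qed
    moreover have "(\<lambda>n. f e (z * CQ ^ n) - f (e * CQ) (z * CQ ^ n)) \<longlonglongrightarrow> f e 0 - f (e * CQ) 0"
      using f_lim[of "\<lambda>_. e" "\<lambda>v. v"] f_lim[of "\<lambda>_. e * CQ" "\<lambda>v. v"]
      by (intro tendsto_diff) (auto intro!: holomorphic_intros)
    ultimately have "(\<lambda>n. (- (e * z)) ^ n * CQ ^ (n choose 2)
      * (f e (z * CQ ^ n) - f (e * CQ) (z * CQ ^ n))) \<longlonglongrightarrow> 0 * (f e 0 - f (e * CQ) 0)"
      by (rule tendsto_mult)
    then have "(\<lambda>n::nat. f e z - f (e * CQ) z) \<longlonglongrightarrow> 0"
      unfolding iter[symmetric] by simp
    then show ?thesis by (simp add: LIMSEQ_const_iff)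
  qed
  have "f e z = f (e * CQ ^ n) z" for n
  proof (induction n)
    case (Suc n)
    then show ?case using indep[of "e * CQ ^ n"] by (simp add: mult_ac)
  qed simp
  then have "f e z = f 0 z"
    using f_lim[of "\<lambda>v. v" "\<lambda>_. z" e] by (simp add: LIMSEQ_const_iff holomorphic_intros)
  \<comment> \<open>At \<open>e = 0\<close> the sum is Euler's series for \<open>pinf z\<close>,
    evaluated through its first order recurrence and its value 1 at the origin.\<close>
  have f0_sums: "s z sums f 0 z" for z
    using phi22_sums[of 0 0 0 0 z] by (simp add: trm[abs_def] f_def qpoch_def)
  have f0_rec: "f 0 z = (1 - z) * f 0 (z * CQ)" for z
  proof -
    have "(\<lambda>n. s z (Suc n) * (1 - CQ ^ Suc n)) sums (- z * f 0 (z * CQ))"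
      unfolding s_Suc by (intro sums_mult f0_sums)
    then have "(\<lambda>n. s z n * (1 - CQ ^ n)) sums (- z * f 0 (z * CQ))"
      using sums_Suc_iff[of "\<lambda>n. s z n * (1 - CQ ^ n)"] by simp
    moreover have "(\<lambda>n. s z n - s (z * CQ) n) sums (f 0 z - f 0 (z * CQ))"
      by (intro sums_diff f0_sums)
    moreover have "(\<lambda>n. s z n - s (z * CQ) n) = (\<lambda>n. s z n * (1 - CQ ^ n))"
      by (simp add: sCQ algebra_simps)
    ultimately have "f 0 z - f 0 (z * CQ) = - z * f 0 (z * CQ)"
      using sums_unique2 by metis
    then show ?thesis by (simp add: algebra_simps)
  qed
  have "f 0 z = qpoch z CQ n * f 0 (z * CQ ^ n)" for n
  proof (induction n)
    case (Suc n)
    then show ?case using f0_rec[of "z * CQ ^ n"] by (simp add: qpoch_Suc mult_ac)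
  qed simp
  moreover have "(\<lambda>n. qpoch z CQ n * f 0 (z * CQ ^ n)) \<longlonglongrightarrow> pinf z * f 0 0"
    using qpoch_LIMSEQ[of z] f_lim[of "\<lambda>_. 0" "\<lambda>v. v" z]
    by (intro tendsto_mult) (auto intro!: holomorphic_intros)
  ultimately have "f 0 z = pinf z * f 0 0"
    by (simp add: LIMSEQ_const_iff)
  moreover have "f 0 0 = 1"
  proof -
    have "s 0 sums sum (s 0) {0}"
      by (rule sums_finite) (simp_all add: s_def)
    then have "f 0 0 = sum (s 0) {0}"
      using f0_sums[of 0] by (rule sums_unique2[symmetric])
    then show ?thesis by (simp add: s_def numeral_2_eq_2)
  qed
  ultimately show ?thesis
    using \<open>f e z = f 0 z\<close> by (simp add: f_def)
qed

text \<open>At \<open>y = - CQ\<close> the upper parameter \<open>y * B\<close> coincides with the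
  lower parameter \<open>- (CQ * B)\<close>, so their products merge into a factor free of
  \<open>n\<close>, and \<open>phi11_sum\<close> sums the rest. The value is free of
  \<open>x\<close>: it starts the recursion in \<open>y\<close>, supplies a nonvanishing entry and
  ties one norm to the mass of the weight.\<close>

lemma J_minus_Q: "J A B x (- CQ) = pinf (- (CQ * A)) * pinf (- (CQ * B))"
proof -
  have "phi_term (- CQ * B) (x * B) (x * (- CQ) * A * B) (- (CQ * B)) (- (CQ * A)) n
    = pinf (- (CQ * B)) * phi_term 0 (x * B) (x * B * (- (CQ * A))) 0 (- (CQ * A)) n" for n
    using pinf_split[of "- (CQ * B)" n] by (simp add: phi_term_def qpoch_def[of 0] mult_ac)
  then have "J A B x (- CQ) = (\<Sum>n. pinf (- (CQ * B)) * phi_term 0 (x * B) (x * B * (- (CQ * A))) 0 (- (CQ * A)) n)"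
    unfolding J_def phi22_reg_eq by presburger
  also have "\<dots> = pinf (- (CQ * B)) * phi22_reg 0 (x * B) (x * B * (- (CQ * A))) 0 CQ (- (CQ * A))"
    unfolding phi22_reg_eq by (intro suminf_mult summable_norm_cancel[OF summable_phi_term])
  finally show ?thesis
    unfolding phi11_sum by simp
qed

text \<open>Under the assumption \<open>pinf (c * CQ ^ n)\<close> vanishes for \<open>n < r\<close>,
  so the series starts at \<open>r\<close>; reindexing is the analogue of relating Bessel functions
  of orders \<open>- n\<close> and \<open>n\<close>. The extracted prefactor gives the growth bound
  for large \<open>x\<close> and later cancels poles in \<open>B\<close>.\<close>

lemma phi22_shift:
  assumes "c * CQ ^ r = CQ"
  shows "phi22_reg a b c d CQ z = qpoch a CQ r * qpoch b CQ r * (- z) ^ r * CQ ^ (r choose 2)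
    * phi22_reg (a * CQ ^ r) (b * CQ ^ r) (CQ ^ Suc r) (d * CQ ^ r) CQ (z * CQ ^ r)"
proof -
  define C where "C = qpoch a CQ r * qpoch b CQ r * (- z) ^ r * CQ ^ (r choose 2)"
  have 0: "phi_term a b c d z n = 0" if "n < r" for n
  proof -
    have "c * CQ ^ n * CQ ^ (r - n) = CQ"
      using assms that by (simp add: mult.assoc flip: power_add)
    then have "c * CQ ^ n * CQ ^ (r - n - 1) = 1"
      using that Q_nz by (cases "r - n") (auto simp: mult_ac)
    then have "pinf (c * CQ ^ n) = 0"
      using qpoch_inf_eq_0_iff[of "c * CQ ^ n"] by auto
    then show ?thesis by (simp add: phi_term_def)
  qed
  have 1: "phi_term a b c d z (n + r)
    = C * phi_term (a * CQ ^ r) (b * CQ ^ r) (CQ ^ Suc r) (d * CQ ^ r) (z * CQ ^ r) n" for n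
  proof -
    have ch: "(n + r) choose 2 = (n choose 2) + (r choose 2) + n * r"
      by (induction n) (simp_all add: numeral_2_eq_2)
    have pw: "(CQ ^ n) ^ r = (CQ ^ r) ^ n"
      by (simp add: mult.commute flip: power_mult)
    have "pinf CQ = qpoch CQ CQ n * pinf (CQ * CQ ^ n)"
      "pinf CQ = qpoch CQ CQ (n + r) * pinf (CQ * CQ ^ (n + r))"
      by (rule pinf_split)+
    \<comment> \<open>The regularizing product and the factorial exchange their roles, which turns
      the lower parameter into \<open>CQ ^ Suc r\<close>.\<close>
    then have Qf: "pinf (CQ * CQ ^ n) / qpoch CQ CQ (n + r) = pinf (CQ * CQ ^ (n + r)) / qpoch CQ CQ n"
      using qpoch_Q_nz by (simp add: field_simps)
    have cf: "c * CQ ^ (n + r) = CQ * CQ ^ n"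
      using assms by (simp add: power_add mult_ac)
    have "phi_term a b c d z (n + r) = qpoch a CQ (n + r) * qpoch b CQ (n + r)
       * (pinf (CQ * CQ ^ n) / qpoch CQ CQ (n + r)) * pinf (d * CQ ^ (n + r))
       * ((-1) ^ (n + r) * CQ ^ ((n + r) choose 2)) * z ^ (n + r)"
      by (simp add: phi_term_def cf)
    also have "\<dots> = C * phi_term (a * CQ ^ r) (b * CQ ^ r) (CQ ^ Suc r) (d * CQ ^ r) (z * CQ ^ r) n"
      unfolding Qf ch
      by (simp add: phi_term_def C_def qpoch_add add.commute[of n r] power_add power_mult_distrib
          power_minus[of z] power_mult pw mult_ac)
    finally show ?thesis .
  qed
  have "phi22_reg a b c d CQ z = (\<Sum>n. phi_term a b c d z (n + r)) + (\<Sum>n<r. phi_term a b c d z n)"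
    unfolding phi22_reg_eq
    by (intro suminf_split_initial_segment summable_norm_cancel[OF summable_phi_term])
  also have "\<dots> = (\<Sum>n. C * phi_term (a * CQ ^ r) (b * CQ ^ r) (CQ ^ Suc r) (d * CQ ^ r) (z * CQ ^ r) n)"
    using 0 1 by simp
  also have "\<dots> = C * phi22_reg (a * CQ ^ r) (b * CQ ^ r) (CQ ^ Suc r) (d * CQ ^ r) CQ (z * CQ ^ r)"
    unfolding phi22_reg_eq by (intro suminf_mult summable_norm_cancel[OF summable_phi_term])
  finally show ?thesis by (simp add: C_def)
qed

subsection \<open>Sums over the lattice\<close>

lemma I_q_cases [consumes 1, case_names small large neg]:
  assumes "x \<in> I_q Q"
  obtains n where "x = Q ^ n" | n where "x = inverse Q ^ Suc n" | n where "x = - (Q ^ Suc n)"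
proof -
  from assms consider k :: int where "x = Q powi k" | n where "x = - (Q ^ n)" "n \<ge> 1"
    by (auto simp: I_q_def)
  then show ?thesis
  proof cases
    case 1
    show ?thesis
    proof (cases "k \<ge> 0")
      case True
      then show ?thesis using 1 that(1)[of "nat k"] by (simp add: power_int_def)
    next
      case False
      then have "nat (- k) = Suc (nat (- k - 1))" by simp
      then show ?thesis using 1 False that(2)[of "nat (- k - 1)"] by (simp add: power_int_def)
    qed
  next
    case 2
    then show ?thesis using that(3)[of "n - 1"] by simp
  qed
qed

lemma I_q_intros [simp, intro]:
  "Q powi k \<in> I_q Q" "Q ^ n \<in> I_q Q" "inverse Q ^ n \<in> I_q Q" "- (Q * Q ^ n) \<in> I_q Q" "- Q \<in> I_q Q"
proof -
  show 1: "Q powi k \<in> I_q Q" for k by (auto simp: I_q_def)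
  show "Q ^ n \<in> I_q Q" using 1[of "int n"] by simp
  show "inverse Q ^ n \<in> I_q Q" using 1[of "- int n"] by (simp only: power_int_minus power_int_of_nat power_inverse)
  show 2: "- (Q * Q ^ n) \<in> I_q Q" for n
    unfolding I_q_def by (auto intro!: exI[of _ "Suc n"])
  show "- Q \<in> I_q Q" using 2[of 0] by simp
qed

lemma I_q_nz: "x \<in> I_q Q \<Longrightarrow> x \<noteq> 0"
  using Q_pos by (elim I_q_cases) auto

lemma I_q_scale:
  assumes "x \<in> I_q Q"
  shows "Q * x \<in> I_q Q"
  using assms
proof (cases rule: I_q_cases)
  case (small n)
  then show ?thesis using I_q_intros(2)[of "Suc n"] by simp
next
  case (large n)
  then have "Q * x = inverse Q ^ n" using Q_pos by simp
  then show ?thesis using I_q_intros(3)[of n] by (simp only:)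
next
  case (neg n)
  then show ?thesis using I_q_intros(4)[of "Suc n"] by simp
qed

lemma I_q_has_sum:
  fixes f :: "real \<Rightarrow> 'a :: banach"
  assumes "summable (\<lambda>n. norm (f (Q ^ n)))" "summable (\<lambda>n. norm (f (inverse Q ^ Suc n)))"
    "summable (\<lambda>n. norm (f (- (Q ^ Suc n))))"
    and "(\<lambda>n. f (Q ^ n)) sums s1" "(\<lambda>n. f (inverse Q ^ Suc n)) sums s2"
    "(\<lambda>n. f (- (Q ^ Suc n))) sums s3"
  shows "(f has_sum (s1 + s2 + s3)) (I_q Q)"
proof -
  define A1 where "A1 = range (\<lambda>n. Q ^ n)"
  define A2 where "A2 = range (\<lambda>n. inverse Q ^ Suc n)"
  define A3 where "A3 = range (\<lambda>n. - (Q ^ Suc n))"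
  have inj: "inj (\<lambda>n. Q ^ n)" "inj (\<lambda>n. inverse Q ^ Suc n)" "inj (\<lambda>n. - (Q ^ Suc n))"
    using Q_pos Q_less_1 by (auto simp: inj_def power_inject_exp' field_simps)
  have A: "(f has_sum s1) A1" "(f has_sum s2) A2" "(f has_sum s3) A3"
    unfolding A1_def A2_def A3_def has_sum_reindex[OF inj(1)] has_sum_reindex[OF inj(2)]
      has_sum_reindex[OF inj(3)] o_def
    by (intro norm_summable_imp_has_sum assms)+
  have 1: "0 < x \<and> x \<le> 1" if "x \<in> A1" for x
    using that Q_pos Q_less_1 by (auto simp: A1_def power_le_one)
  have 2: "x > 1" if "x \<in> A2" for x
    using that Q_pos Q_less_1 by (auto simp: A2_def one_less_inverse intro!: one_less_power simp del: power_Suc)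
  have 3: "x < 0" if "x \<in> A3" for x
    using that Q_pos by (auto simp: A3_def)
  have "A1 \<inter> A2 = {}" "(A1 \<union> A2) \<inter> A3 = {}"
    using 1 2 3 by force+
  then have "(f has_sum (s1 + s2 + s3)) (A1 \<union> A2 \<union> A3)"
    by (intro has_sum_Un_disjoint A)
  moreover have "A1 \<union> A2 \<union> A3 = I_q Q"
  proof
    show "I_q Q \<subseteq> A1 \<union> A2 \<union> A3"
      by (rule subsetI, erule I_q_cases) (auto simp: A1_def A2_def A3_def simp del: power_Suc)
  next
    have "inverse Q ^ Suc n \<in> I_q Q" for n by (rule I_q_intros)
    then show "A1 \<union> A2 \<union> A3 \<subseteq> I_q Q"
      by (auto simp: A1_def A2_def A3_def simp del: power_Suc) (simp add: power_Suc)
  qed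
  ultimately show ?thesis by simp
qed

lemma I_q_abs_summable:
  fixes f :: "real \<Rightarrow> 'a :: banach"
  assumes "summable (\<lambda>n. norm (f (Q ^ n)))" "summable (\<lambda>n. norm (f (inverse Q ^ Suc n)))"
    "summable (\<lambda>n. norm (f (- (Q ^ Suc n))))"
  shows "f abs_summable_on I_q Q"
  using I_q_has_sum[of "\<lambda>x. norm (f x)", OF _ _ _ summable_sums summable_sums summable_sums] assms
  by (auto intro: has_sum_imp_summable)

lemma abs_summable_I_q_sequences:
  fixes f :: "real \<Rightarrow> 'a :: banach"
  assumes "f abs_summable_on I_q Q"
  shows "summable (\<lambda>n. norm (f (Q ^ n)))" "summable (\<lambda>n. norm (f (inverse Q ^ Suc n)))"
    "summable (\<lambda>n. norm (f (- (Q ^ Suc n))))"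
proof -
  have *: "summable (\<lambda>n. norm (f (h n)))" if "inj h" "range h \<subseteq> I_q Q" for h :: "nat \<Rightarrow> real"
  proof -
    have "(\<lambda>x. norm (f x)) summable_on range h"
      using assms that(2) summable_on_subset_banach by blast
    then have "((\<lambda>x. norm (f x)) \<circ> h) summable_on UNIV"
      using summable_on_reindex[OF that(1)] by blast
    then show ?thesis
      by (simp add: o_def summable_on_UNIV_nonneg_real_iff)
  qed
  have inj: "inj (\<lambda>n. Q ^ n)" "inj (\<lambda>n. inverse Q ^ Suc n)" "inj (\<lambda>n. - (Q ^ Suc n))"
    using Q_pos Q_less_1 by (auto simp: inj_def power_inject_exp' field_simps)
  show "summable (\<lambda>n. norm (f (Q ^ n)))" "summable (\<lambda>n. norm (f (inverse Q ^ Suc n)))"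
    "summable (\<lambda>n. norm (f (- (Q ^ Suc n))))"
    using *[OF inj(1)] *[OF inj(2)] *[OF inj(3)] I_q_intros(2) I_q_intros(3)[of "Suc _"] I_q_intros(4)
    by (simp_all add: image_subset_iff del: power_inverse)
qed

text \<open>A discrete Stokes theorem. Each half-lattice telescopes; the contributions at 0 from the
  two sides have opposite signs and cancel because both limits are \<open>L\<close>, the end at
  infinity contributes 0, and the negative half-lattice ends with \<open>V (- 1)\<close>.\<close>

lemma I_q_telescope:
  fixes V g :: "real \<Rightarrow> complex"
  assumes g: "g abs_summable_on I_q Q"
    and eq: "\<And>x. x \<in> I_q Q \<Longrightarrow> g x = of_real (sgn x) * (V x - V (x / Q))"
    and lim: "(\<lambda>n. V (Q ^ n)) \<longlonglongrightarrow> L" "(\<lambda>n. V (- (Q ^ n))) \<longlonglongrightarrow> L" "(\<lambda>n. V (inverse Q ^ n)) \<longlonglongrightarrow> 0"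
    and V1: "V (- 1) = 0"
  shows "(g has_sum 0) (I_q Q)"
proof -
  have eq_pos: "g x = V x - V (x / Q)" if "x > 0" "x \<in> I_q Q" for x
    unfolding eq[OF that(2)] sgn_pos[OF that(1)] by simp
  have eq_neg: "g x = V (x / Q) - V x" if "x < 0" "x \<in> I_q Q" for x
    unfolding eq[OF that(2)] sgn_neg[OF that(1)] by simp
  have "(\<lambda>n. g (Q ^ n)) sums (L - V (inverse Q))"
  proof -
    have "(\<lambda>n. V (Q ^ Suc n / Q) - V (Q ^ n / Q)) sums (L - V (Q ^ 0 / Q))"
      by (rule telescope_sums, rule LIMSEQ_imp_Suc) (use lim(1) Q_pos in simp)
    moreover have "g (Q ^ n) = V (Q ^ Suc n / Q) - V (Q ^ n / Q)" for n
      using eq_pos[of "Q ^ n"] Q_pos by simp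
    ultimately show ?thesis by (simp add: inverse_eq_divide)
  qed
  moreover have "(\<lambda>n. g (inverse Q ^ Suc n)) sums (V (inverse Q) - 0)"
  proof -
    have "(\<lambda>n. V (inverse Q ^ Suc n) - V (inverse Q ^ Suc (Suc n))) sums (V (inverse Q ^ Suc 0) - 0)"
      by (rule telescope_sums') (rule LIMSEQ_Suc[OF lim(3)])
    moreover have "g (inverse Q ^ Suc n) = V (inverse Q ^ Suc n) - V (inverse Q ^ Suc (Suc n))" for n
    proof -
      have "inverse Q ^ Suc n / Q = inverse Q ^ Suc (Suc n)"
        by (simp add: divide_inverse mult_ac)
      then show ?thesis
        using eq_pos[OF _ I_q_intros(3)[of "Suc n"]] Q_pos by (simp del: power_inverse)
    qed
    ultimately show ?thesis by simp
  qed
  moreover have "(\<lambda>n. g (- (Q ^ Suc n))) sums (0 - L)"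
  proof -
    have "(\<lambda>n. V (- (Q ^ n)) - V (- (Q ^ Suc n))) sums (V (- (Q ^ 0)) - L)"
      by (rule telescope_sums') (rule lim(2))
    moreover have "g (- (Q ^ Suc n)) = V (- (Q ^ n)) - V (- (Q ^ Suc n))" for n
      using eq_neg[of "- (Q ^ Suc n)"] I_q_intros(4)[of n] Q_pos by simp
    ultimately show ?thesis using V1 by simp
  qed
  ultimately have "(g has_sum ((L - V (inverse Q)) + (V (inverse Q) - 0) + (0 - L))) (I_q Q)"
    by (intro I_q_has_sum abs_summable_I_q_sequences g)
  then show ?thesis by simp
qed

section \<open>The weight and its decay\<close>

definition regular :: "complex \<Rightarrow> bool" where
  "regular A \<longleftrightarrow> A \<noteq> 0 \<and> (\<forall>x\<in>I_q Q. pinf (of_real x * A) \<noteq> 0)"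

lemma regular_nz: "regular A \<Longrightarrow> A \<noteq> 0" "regular A \<Longrightarrow> x \<in> I_q Q \<Longrightarrow> pinf (of_real x * A) \<noteq> 0"
  by (auto simp: regular_def)

lemma regular_factor: "regular A \<Longrightarrow> x \<in> I_q Q \<Longrightarrow> 1 - of_real x * A \<noteq> 0"
  using regular_nz(2)[of A x] pinf_rec[of "of_real x * A"] by auto

text \<open>Together with the factor \<open>\<bar>x\<bar>\<close>, which accompanies it in the sums,
  this is the density of a Jackson integral over both half-lattices.\<close>

definition weight :: "complex \<Rightarrow> complex \<Rightarrow> real \<Rightarrow> complex" where
  "weight A B x = pinf (- of_real x) / (pinf (of_real x * A) * pinf (of_real x * B))"

text \<open>The discrete Pearson equation. Up to a constant its coefficients are the outer ones of
  \<open>jj_rec\<close> at \<open>x\<close> and at \<open>Q * x\<close>, which makes the difference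
  operator symmetric with respect to the weight.\<close>

lemma weight_rec:
  assumes "regular A" "regular B" "x \<in> I_q Q"
  shows "weight A B x * ((1 - of_real x * A) * (1 - of_real x * B))
    = (1 + of_real x) * weight A B (Q * x)"
proof -
  have "pinf (of_real x * A) = (1 - of_real x * A) * pinf (of_real (Q * x) * A)"
    "pinf (of_real x * B) = (1 - of_real x * B) * pinf (of_real (Q * x) * B)"
    "pinf (- of_real x) = (1 + of_real x) * pinf (- of_real (Q * x))"
    using pinf_rec[of "of_real x * A"] pinf_rec[of "of_real x * B"] pinf_rec[of "- of_real x"]
    by (simp_all add: mult_ac)
  then show ?thesis
    using regular_factor[OF assms(1,3)] regular_factor[OF assms(2,3)]
    by (simp add: weight_def)
qed

lemma weight_commute: "weight A B x = weight B A x"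
  by (simp add: weight_def mult_ac)

lemma Q_power_LIMSEQ: "(\<lambda>n. w * Q ^ n) \<longlonglongrightarrow> 0"
  using Q_pos Q_less_1 by (intro tendsto_mult_right_zero LIMSEQ_power_zero) auto

lemma weight_lim:
  assumes "(f \<longlongrightarrow> 0) F" shows "((\<lambda>n. weight A B (f n)) \<longlongrightarrow> 1) F"
proof -
  have "((\<lambda>n. weight A B (f n)) \<longlongrightarrow> pinf (- of_real 0) / (pinf (of_real 0 * A) * pinf (of_real 0 * B))) F"
    unfolding weight_def by (intro tendsto_intros assms) simp
  then show ?thesis by simp
qed

text \<open>Towards 0 the weight tends to 1 and \<open>\<bar>x\<bar>\<close> is geometric. Towards
  infinity the ratio of consecutive weights in \<open>weight_rec\<close> has a linear numerator and
  a quadratic denominator in \<open>x\<close>, so the weight decays faster than every power.\<close>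

lemma weight_abs_summable:
  assumes A: "regular A" and B: "regular B"
  shows "(\<lambda>x. of_real (\<bar>x\<bar> * max 1 \<bar>x\<bar> ^ N) * weight A B x) abs_summable_on I_q Q"
proof (rule I_q_abs_summable)
  have geo: "summable (\<lambda>n. norm (of_real (\<bar>s * Q ^ n\<bar> * max 1 \<bar>s * Q ^ n\<bar> ^ N) * weight A B (s * Q ^ n)))"
    if "\<bar>s\<bar> \<le> 1" for s
  proof -
    have "(\<lambda>n. weight A B (s * Q ^ n)) \<longlonglongrightarrow> 1"
      by (rule weight_lim) (rule Q_power_LIMSEQ)
    then have "Bseq (\<lambda>n. weight A B (s * Q ^ n))"
      by (intro convergent_imp_Bseq convergentI)
    then obtain C where C: "\<And>n. norm (weight A B (s * Q ^ n)) \<le> C"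
      by (auto simp: Bseq_def)
    show ?thesis
    proof (rule summable_comparison_test)
      show "summable (\<lambda>n. C * Q ^ n)"
        using Q_pos Q_less_1 by (intro summable_mult summable_geometric) auto
      have "norm (of_real (\<bar>s * Q ^ n\<bar> * max 1 \<bar>s * Q ^ n\<bar> ^ N) * weight A B (s * Q ^ n)) \<le> C * Q ^ n" for n
      proof -
        have 1: "\<bar>s * Q ^ n\<bar> \<le> 1 * Q ^ n"
          unfolding abs_mult using that Q_pos by (intro mult_mono) auto
        also have "\<dots> \<le> 1"
          using Q_pos Q_less_1 by (simp add: power_le_one)
        finally have "max 1 \<bar>s * Q ^ n\<bar> = 1" by simp
        then have "norm (of_real (\<bar>s * Q ^ n\<bar> * max 1 \<bar>s * Q ^ n\<bar> ^ N) * weight A B (s * Q ^ n))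
          = \<bar>s * Q ^ n\<bar> * norm (weight A B (s * Q ^ n))"
          by (simp add: norm_mult)
        also have "\<dots> \<le> Q ^ n * C"
          using 1 C by (intro mult_mono) auto
        finally show ?thesis by (simp add: mult.commute)
      qed
      then show "\<exists>M. \<forall>n\<ge>M. norm (norm (of_real (\<bar>s * Q ^ n\<bar> * max 1 \<bar>s * Q ^ n\<bar> ^ N) * weight A B (s * Q ^ n))) \<le> C * Q ^ n"
        by simp
    qed
  qed
  show "summable (\<lambda>n. norm (of_real (\<bar>Q ^ n\<bar> * max 1 \<bar>Q ^ n\<bar> ^ N) * weight A B (Q ^ n)))"
    using geo[of 1] by simp
  show "summable (\<lambda>n. norm (of_real (\<bar>- (Q ^ Suc n)\<bar> * max 1 \<bar>- (Q ^ Suc n)\<bar> ^ N) * weight A B (- (Q ^ Suc n))))"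
    using geo[of "- Q"] Q_pos Q_less_1 by simp
  define g where "g = (\<lambda>n. norm (of_real (\<bar>inverse Q ^ Suc n\<bar> * max 1 \<bar>inverse Q ^ Suc n\<bar> ^ N) * weight A B (inverse Q ^ Suc n)))"
  \<comment> \<open>The ratio of consecutive terms, written in \<open>Q ^ (n + 2)\<close>, the
    inverse of the lattice point, so that the limit 0 can be read off: the denominators tend to the
    nonzero norms of \<open>A\<close> and \<open>B\<close>.\<close>
  define \<rho> where "\<rho> = (\<lambda>n. inverse Q ^ Suc N * (Q ^ (n + 2) * (Q ^ (n + 2) + 1) /
     (norm (CQ ^ (n + 2) - A) * norm (CQ ^ (n + 2) - B))))"
  have step: "g (Suc n) = \<rho> n * g n" for n
  proof -
    define X where "X = inverse Q ^ (n + 2)"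
    have X: "X > 0" "inverse Q ^ Suc n = Q * X" "inverse Q ^ Suc (Suc n) = X" "X \<in> I_q Q"
      using Q_pos I_q_intros(3)[of "n + 2"] by (auto simp: X_def simp del: I_q_intros)
    have "X \<ge> 1" "Q * X \<ge> 1"
      using Q_pos Q_less_1 X(2)[symmetric] one_le_power[of "inverse Q"]
      by (auto simp: X_def one_le_inverse simp del: power_Suc)
    have g1: "g (Suc n) = X ^ Suc N * norm (weight A B X)"
      unfolding g_def X(3) using X(1) \<open>X \<ge> 1\<close> by (simp add: norm_mult norm_power max_def)
    have g2: "g n = (Q * X) ^ Suc N * norm (weight A B (Q * X))"
      unfolding g_def X(2) using X(1) \<open>Q * X \<ge> 1\<close> Q_pos by (simp add: norm_mult norm_power max_def abs_mult)
    have nz: "norm (1 - of_real X * A) \<noteq> 0" "norm (1 - of_real X * B) \<noteq> 0"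
      using regular_factor[OF A X(4)] regular_factor[OF B X(4)] by auto
    have "norm (weight A B X) * (norm (1 - of_real X * A) * norm (1 - of_real X * B))
        = (1 + X) * norm (weight A B (Q * X))"
    proof -
      have "norm (1 + complex_of_real X) = 1 + X"
        using X(1) by (metis abs_of_pos add_pos_pos norm_of_real of_real_1 of_real_add zero_less_one)
      then show ?thesis
        using arg_cong[OF weight_rec[OF A B X(4)], of norm] by (simp add: norm_mult)
    qed
    then have w: "norm (weight A B X) = (1 + X) * norm (weight A B (Q * X)) /
        (norm (1 - of_real X * A) * norm (1 - of_real X * B))"
      using nz by (simp add: field_simps)
    have XQ1: "X * Q ^ (n + 2) = 1"
      unfolding X_def power_mult_distrib[symmetric] using Q_pos by simp
    have XQ2: "complex_of_real X * CQ ^ (n + 2) = 1"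
      unfolding of_real_power[symmetric] of_real_mult[symmetric] XQ1 by simp
    note XQ = XQ1 XQ2
    have XC: "norm (CQ ^ (n + 2) - C) = Q ^ (n + 2) * norm (1 - of_real X * C)" for C
    proof -
      have "CQ ^ (n + 2) * (of_real X * C) = (of_real X * CQ ^ (n + 2)) * C"
        by (simp only: mult_ac)
      then have "CQ ^ (n + 2) - C = CQ ^ (n + 2) * (1 - of_real X * C)"
        unfolding XQ2 right_diff_distrib by simp
      then show ?thesis
        using Q_pos by (simp add: norm_mult norm_power)
    qed
    have "Q ^ (n + 2) + 1 = Q ^ (n + 2) * (1 + X)"
      unfolding distrib_left mult.commute[of _ X] XQ1 by simp
    then have \<rho>: "\<rho> n = inverse Q ^ Suc N * ((1 + X) / (norm (1 - of_real X * A) * norm (1 - of_real X * B)))"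
      unfolding \<rho>_def XC using Q_pos by simp
    show ?thesis
    proof -
      have *: "b * c = 1 \<Longrightarrow> X * (u * W / D) = b * (u / D) * (c * X * W)" for b c D W u X :: real
        by (metis (no_types, lifting) mult.assoc mult.commute mult_1 times_divide_eq_left)
      have "inverse Q ^ Suc N * Q ^ Suc N = 1"
        unfolding power_mult_distrib[symmetric] using Q_pos by simp
      then show ?thesis
        unfolding g1 g2 \<rho> w power_mult_distrib by (rule *)
    qed
  qed
  have "\<rho> \<longlonglongrightarrow> inverse Q ^ Suc N * (0 * (0 + 1) / (norm (0 - A) * norm (0 - B)))"
    unfolding \<rho>_def using regular_nz(1)[OF A] regular_nz(1)[OF B] Q_pos Q_less_1
    by (intro tendsto_intros LIMSEQ_ignore_initial_segment LIMSEQ_power_zero) auto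
  then have "eventually (\<lambda>n. \<rho> n < 1/2) sequentially"
    by (intro order_tendstoD) auto
  then obtain M where M: "\<And>n. n \<ge> M \<Longrightarrow> \<rho> n < 1/2"
    by (auto simp: eventually_sequentially)
  have "summable g"
  proof (rule summable_ratio_test[of "1/2" M])
    fix n assume "n \<ge> M"
    have "g n \<ge> 0" "g (Suc n) \<ge> 0" by (auto simp: g_def)
    then show "norm (g (Suc n)) \<le> 1/2 * norm (g n)"
      using mult_right_mono[OF less_imp_le[OF M[OF \<open>n \<ge> M\<close>]], of "g n"] unfolding step by simp
  qed simp
  then show "summable (\<lambda>n. norm (of_real (\<bar>inverse Q ^ Suc n\<bar> * max 1 \<bar>inverse Q ^ Suc n\<bar> ^ N) * weight A B (inverse Q ^ Suc n)))"
    by (simp only: g_def)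
qed

subsection \<open>Growth along the lattice\<close>

text \<open>Polynomial growth on the lattice, uniformly in an index: sets of pairs
  \<open>(A, B)\<close> serve the bounds on circles, the one-point set \<open>{()}\<close> serves
  fixed parameters.\<close>

definition tempered :: "'i set \<Rightarrow> ('i \<Rightarrow> real \<Rightarrow> complex) \<Rightarrow> bool" where
  "tempered S f \<longleftrightarrow> (\<exists>C N. \<forall>i\<in>S. \<forall>x\<in>I_q Q. norm (f i x) \<le> C * max 1 \<bar>x\<bar> ^ N)"

lemma temperedI:
  assumes "\<And>i x. i \<in> S \<Longrightarrow> x \<in> I_q Q \<Longrightarrow> norm (f i x) \<le> C * max 1 \<bar>x\<bar> ^ N"
  shows "tempered S f"
  unfolding tempered_def using assms by blast

lemma temperedD:
  assumes "tempered S f"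
  shows "\<exists>C N. C \<ge> 0 \<and> (\<forall>i x. i \<in> S \<longrightarrow> x \<in> I_q Q \<longrightarrow> norm (f i x) \<le> C * max 1 \<bar>x\<bar> ^ N)"
proof -
  from assms obtain C N where C: "\<And>i x. i \<in> S \<Longrightarrow> x \<in> I_q Q \<Longrightarrow> norm (f i x) \<le> C * max 1 \<bar>x\<bar> ^ N"
    unfolding tempered_def by blast
  have "C * max 1 \<bar>x\<bar> ^ N \<le> max C 0 * max 1 \<bar>x\<bar> ^ N" for x :: real
    by (intro mult_right_mono) auto
  then show ?thesis
    using C by (intro exI[of _ "max C 0"] exI[of _ N]) (meson max.cobounded2 order_trans)
qed

lemma tempered_mult:
  assumes "tempered S f" "tempered S g"
  shows "tempered S (\<lambda>i x. f i x * g i x)"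
proof -
  obtain C N where 1: "C \<ge> 0" "\<And>i x. i \<in> S \<Longrightarrow> x \<in> I_q Q \<Longrightarrow> norm (f i x) \<le> C * max 1 \<bar>x\<bar> ^ N"
    using temperedD[OF assms(1)] by blast
  obtain D M where 2: "D \<ge> 0" "\<And>i x. i \<in> S \<Longrightarrow> x \<in> I_q Q \<Longrightarrow> norm (g i x) \<le> D * max 1 \<bar>x\<bar> ^ M"
    using temperedD[OF assms(2)] by blast
  show ?thesis
  proof (rule temperedI[where C = "C * D" and N = "N + M"])
    fix i x assume "i \<in> S" "x \<in> I_q Q"
    then have "norm (f i x) * norm (g i x) \<le> (C * max 1 \<bar>x\<bar> ^ N) * (D * max 1 \<bar>x\<bar> ^ M)"
      using 1 2 by (intro mult_mono) auto
    then show "norm (f i x * g i x) \<le> C * D * max 1 \<bar>x\<bar> ^ (N + M)"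
      by (simp add: norm_mult power_add mult_ac)
  qed
qed

lemma tempered_add:
  assumes "tempered S f" "tempered S g"
  shows "tempered S (\<lambda>i x. f i x + g i x)"
proof -
  obtain C N where 1: "C \<ge> 0" "\<And>i x. i \<in> S \<Longrightarrow> x \<in> I_q Q \<Longrightarrow> norm (f i x) \<le> C * max 1 \<bar>x\<bar> ^ N"
    using temperedD[OF assms(1)] by blast
  obtain D M where 2: "D \<ge> 0" "\<And>i x. i \<in> S \<Longrightarrow> x \<in> I_q Q \<Longrightarrow> norm (g i x) \<le> D * max 1 \<bar>x\<bar> ^ M"
    using temperedD[OF assms(2)] by blast
  show ?thesis
  proof (rule temperedI[where C = "C + D" and N = "N + M"])
    fix i x assume *: "i \<in> S" "x \<in> I_q Q"
    have "norm (f i x + g i x) \<le> C * max 1 \<bar>x\<bar> ^ N + D * max 1 \<bar>x\<bar> ^ M"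
      using norm_triangle_ineq[of "f i x" "g i x"] 1(2)[OF *] 2(2)[OF *] by linarith
    also have "\<dots> \<le> C * max 1 \<bar>x\<bar> ^ (N + M) + D * max 1 \<bar>x\<bar> ^ (N + M)"
      using 1 2 by (intro add_mono mult_left_mono power_increasing) auto
    finally show "norm (f i x + g i x) \<le> (C + D) * max 1 \<bar>x\<bar> ^ (N + M)"
      by (simp add: distrib_right)
  qed
qed

lemma tempered_bounded:
  assumes "\<And>i. i \<in> S \<Longrightarrow> norm (f i) \<le> C"
  shows "tempered S (\<lambda>i x. f i)"
  by (rule temperedI[where C = C and N = 0]) (use assms in auto)

lemma tempered_const: "tempered S (\<lambda>i x. c)"
  by (rule tempered_bounded[where C = "norm c"]) auto

lemma tempered_x: "tempered S (\<lambda>i x. of_real x)"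
  by (rule temperedI[where C = 1 and N = 1]) auto

lemma tempered_uminus: "tempered S f \<Longrightarrow> tempered S (\<lambda>i x. - f i x)"
  using tempered_mult[OF tempered_const[of S "- 1"]] by simp

lemma tempered_diff: "tempered S f \<Longrightarrow> tempered S g \<Longrightarrow> tempered S (\<lambda>i x. f i x - g i x)"
  using tempered_add[OF _ tempered_uminus, of S f g] by simp

lemma tempered_cong:
  "(\<And>i x. i \<in> S \<Longrightarrow> x \<in> I_q Q \<Longrightarrow> f i x = g i x) \<Longrightarrow> tempered S f \<longleftrightarrow> tempered S g"
  by (auto simp: tempered_def)

lemma tempered_reindex: "tempered S f \<Longrightarrow> h ` S' \<subseteq> S \<Longrightarrow> tempered S' (\<lambda>i. f (h i))"
  unfolding tempered_def by (metis image_subset_iff)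

lemma tempered_scale:
  assumes "tempered S f"
  shows "tempered S (\<lambda>i x. f i (Q * x))"
proof -
  obtain C N where 1: "C \<ge> 0" "\<And>i x. i \<in> S \<Longrightarrow> x \<in> I_q Q \<Longrightarrow> norm (f i x) \<le> C * max 1 \<bar>x\<bar> ^ N"
    using temperedD[OF assms] by blast
  show ?thesis
  proof (rule temperedI[where C = C and N = N])
    fix i x assume *: "i \<in> S" "x \<in> I_q Q"
    have "\<bar>Q * x\<bar> \<le> 1 * \<bar>x\<bar>"
      unfolding abs_mult using Q_pos Q_less_1 by (intro mult_right_mono) auto
    then have "C * max 1 \<bar>Q * x\<bar> ^ N \<le> C * max 1 \<bar>x\<bar> ^ N"
      using 1(1) by (intro mult_left_mono power_mono) auto
    then show "norm (f i (Q * x)) \<le> C * max 1 \<bar>x\<bar> ^ N"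
      using 1(2)[OF *(1) I_q_scale[OF *(2)]] by linarith
  qed
qed

lemmas tempered_intros = tempered_mult tempered_add tempered_diff tempered_uminus tempered_const
  tempered_x

lemma tempered_weight_abs_summable:
  assumes "regular A" "regular B" "tempered {()} (\<lambda>_. f)"
  shows "(\<lambda>x. of_real \<bar>x\<bar> * weight A B x * f x) abs_summable_on I_q Q"
proof -
  obtain C N where C: "C \<ge> 0" "\<And>x. x \<in> I_q Q \<Longrightarrow> norm (f x) \<le> C * max 1 \<bar>x\<bar> ^ N"
    using temperedD[OF assms(3)] by auto
  have "(\<lambda>x. of_real C * (of_real (\<bar>x\<bar> * max 1 \<bar>x\<bar> ^ N) * weight A B x)) abs_summable_on I_q Q"
    unfolding norm_mult[of "of_real C"]
    by (intro summable_on_cmult_right weight_abs_summable assms)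
  then show ?thesis
  proof (rule Infinite_Sum.abs_summable_on_comparison_test)
    fix x assume "x \<in> I_q Q"
    have "norm (of_real \<bar>x\<bar> * weight A B x * f x) = \<bar>x\<bar> * norm (weight A B x) * norm (f x)"
      by (simp add: norm_mult)
    also have "\<dots> \<le> \<bar>x\<bar> * norm (weight A B x) * (C * max 1 \<bar>x\<bar> ^ N)"
      using C(2)[OF \<open>x \<in> I_q Q\<close>] by (intro mult_left_mono) auto
    also have "\<dots> = norm (of_real C * (of_real (\<bar>x\<bar> * max 1 \<bar>x\<bar> ^ N) * weight A B x))"
      using C(1) by (simp add: norm_mult norm_power mult_ac)
    finally show "norm (of_real \<bar>x\<bar> * weight A B x * f x)
      \<le> norm (of_real C * (of_real (\<bar>x\<bar> * max 1 \<bar>x\<bar> ^ N) * weight A B x))" .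
  qed
qed

lemma J_bounded:
  "\<exists>C. \<forall>A B x. norm A \<le> R \<and> norm B \<le> R \<and> norm x \<le> X \<longrightarrow> norm (J A B x y) \<le> C"
proof -
  define r where "r = (1 + norm y) * (1 + \<bar>X\<bar>) * (1 + \<bar>R\<bar>) * (1 + \<bar>R\<bar>)"
  have "norm (J A B x y) \<le> phi_sup r" if *: "norm A \<le> R" "norm B \<le> R" "norm x \<le> X" for A B x
    unfolding J_def
  proof (rule norm_phi22_le)
    have m: "a * b * c * d \<le> r" if "a \<le> 1 + norm y" "b \<le> 1 + \<bar>X\<bar>" "c \<le> 1 + \<bar>R\<bar>" "d \<le> 1 + \<bar>R\<bar>"
      "a \<ge> 0" "b \<ge> 0" "c \<ge> 0" "d \<ge> 0" for a b c d
      unfolding r_def using that by (intro mult_mono) auto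
    have X: "norm x \<le> 1 + \<bar>X\<bar>" "norm A \<le> 1 + \<bar>R\<bar>" "norm B \<le> 1 + \<bar>R\<bar>" using * by auto
    show "norm (y * B) \<le> r" using m[of "norm y" 1 1 "norm B"] X by (simp add: norm_mult)
    show "norm (x * B) \<le> r" using m[of 1 "norm x" 1 "norm B"] X by (simp add: norm_mult)
    show "norm (x * y * A * B) \<le> r"
      using m[of "norm y" "norm x" "norm A" "norm B"] X by (simp add: norm_mult mult_ac)
    have "Q * norm B \<le> 1 * norm B" "Q * norm A \<le> 1 * norm A"
      using Q_less_1 by (intro mult_right_mono; simp)+
    then show "norm (- (CQ * B)) \<le> r" "norm (- (CQ * A)) \<le> r"
      using m[of 1 1 1 "norm B"] m[of 1 1 1 "norm A"] X Q_pos by (simp_all add: norm_mult)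
  qed
  then show ?thesis by blast
qed

text \<open>Solving the recurrence upwards from \<open>y = - q\<close>, where the coefficient of the third term
  vanishes at the start, shows that at \<open>y = - q\<^sup>l\<close> the function is a polynomial in the other variable,
  up to a factor.\<close>

fun J_poly :: "complex \<Rightarrow> complex \<Rightarrow> nat \<Rightarrow> complex \<Rightarrow> complex" where
  "J_poly A B 0 x = 1"
| "J_poly A B (Suc 0) x = - (CQ * x * A * B - CQ * (A + B - 1) - (CQ + 1))"
| "J_poly A B (Suc (Suc l)) x =
    - (CQ * (1 - CQ ^ Suc l) * (1 + CQ ^ Suc l * A) * (1 + CQ ^ Suc l * B) * J_poly A B l x
      + (CQ * (CQ ^ Suc l)\<^sup>2 * x * A * B - CQ * CQ ^ Suc l * (A + B - 1) - (CQ + 1)) * J_poly A B (Suc l) x)"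

lemma J_eq_J_poly:
  assumes A: "regular A" and B: "regular B"
  shows "J A B x (- (CQ ^ Suc l)) = pinf (- (CQ ^ Suc l) * A) * pinf (- (CQ ^ Suc l) * B) * J_poly A B l x"
proof -
  have "1 + CQ ^ Suc l * C \<noteq> 0" if "regular C" for l C
    using regular_factor[OF that I_q_intros(4)[of l]] by simp
  note nz = this[OF A] this[OF B]
  have rec: "(1 - CQ * y * A) * (1 - CQ * y * B) * J A B x (CQ * (CQ * y))
    = - (CQ * (1 + y) * J A B x y
      + (CQ * y\<^sup>2 * x * A * B + CQ * y * (A + B - 1) - (CQ + 1)) * J A B x (CQ * y))" for y
    using J_rec[of y A B x] unfolding J_commute[of A B _ x]
    by (simp only: eq_neg_iff_add_eq_0 add.assoc)
  have pr: "pinf (- (CQ ^ Suc l) * C) = (1 + CQ ^ Suc l * C) * pinf (- (CQ ^ Suc (Suc l)) * C)" for l C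
    using pinf_rec[of "- (CQ ^ Suc l) * C"] by (simp add: mult_ac)
  have cancel: "u \<noteq> 0 \<Longrightarrow> v \<noteq> 0 \<Longrightarrow> u * v * X = u * v * Y \<Longrightarrow> X = Y" for u v X Y :: complex
    by simp
  show ?thesis
  proof (induction l rule: induct_nat_012)
    case 0
    then show ?case by (simp add: J_minus_Q)
  next
    case 1
    define a where "a = pinf (- (CQ ^ Suc (Suc 0)) * A)"
    define b where "b = pinf (- (CQ ^ Suc (Suc 0)) * B)"
    have 1: "J A B x (- CQ) = (1 + CQ ^ Suc 0 * A) * (1 + CQ ^ Suc 0 * B) * (a * b)"
      using pr[of 0 A] pr[of 0 B] unfolding a_def b_def J_minus_Q by simp
    \<comment> \<open>The recurrence at \<open>y = - 1\<close>, a point outside the lattice: the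
      coefficient \<open>1 + y\<close> vanishes, so the value at \<open>- CQ\<close> alone
      determines the next one.\<close>
    have 2: "(1 + CQ ^ Suc 0 * A) * (1 + CQ ^ Suc 0 * B) * J A B x (- (CQ ^ Suc (Suc 0)))
      = J_poly A B (Suc 0) x * J A B x (- CQ)"
      unfolding J_poly.simps minus_mult_left[symmetric] using rec[of "- 1"] by simp
    have "(1 + CQ ^ Suc 0 * A) * (1 + CQ ^ Suc 0 * B) * J A B x (- (CQ ^ Suc (Suc 0)))
      = (1 + CQ ^ Suc 0 * A) * (1 + CQ ^ Suc 0 * B) * (a * b * J_poly A B (Suc 0) x)"
      unfolding 2 unfolding 1 by (simp only: mult_ac)
    from cancel[OF nz(1)[of 0] nz(2)[of 0] this] show ?case
      unfolding a_def b_def .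
  next
    case (ge2 l)
    define k where "k = CQ ^ Suc l"
    define a where "a = pinf (- (CQ ^ Suc (Suc (Suc l))) * A)"
    define b where "b = pinf (- (CQ ^ Suc (Suc (Suc l))) * B)"
    have k: "CQ * k = CQ ^ Suc (Suc l)" by (simp add: k_def)
    have 1: "J A B x (- (CQ * k)) = (1 + CQ * k * A) * (1 + CQ * k * B) * (a * b * J_poly A B (Suc l) x)"
      using ge2(2) unfolding pr[of "Suc l"] k a_def b_def by (simp only: mult_ac)
    have 2: "J A B x (- k) = (1 + k * A) * (1 + k * B) * (1 + CQ * k * A) * (1 + CQ * k * B) * (a * b * J_poly A B l x)"
      using ge2(1) unfolding pr[of l] pr[of "Suc l"] unfolding k a_def b_def unfolding k_def by (simp only: mult_ac)
    have "(1 + CQ * k * A) * (1 + CQ * k * B) * J A B x (- (CQ * (CQ * k)))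
      = (1 + CQ * k * A) * (1 + CQ * k * B) * (a * b *
        - (CQ * (1 - k) * (1 + k * A) * (1 + k * B) * J_poly A B l x
      + (CQ * k\<^sup>2 * x * A * B - CQ * k * (A + B - 1) - (CQ + 1)) * J_poly A B (Suc l) x))"
    proof -
      have "(1 + CQ * k * A) * (1 + CQ * k * B) * J A B x (- (CQ * (CQ * k)))
        = - (CQ * (1 - k) * J A B x (- k)
          + (CQ * k\<^sup>2 * x * A * B - CQ * k * (A + B - 1) - (CQ + 1)) * J A B x (- (CQ * k)))"
        using rec[of "- k"] by simp
      moreover have "- (c * (q * r * u * v * (a * b * P)) + d * (u * v * (a * b * R)))
          = u * v * (a * b * - (c * q * r * P + d * R))" for c d q r u v P R :: complex
        by (simp add: algebra_simps)
      ultimately show ?thesis unfolding 1 2 by (simp only:)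
    qed
    from cancel[OF nz(1)[of "Suc l", folded k] nz(2)[of "Suc l", folded k] this]
    show ?case
      unfolding J_poly.simps k_def[symmetric] a_def[symmetric] b_def[symmetric] k[symmetric]
      by (simp add: k_def)
  qed
qed

lemma norm_pinf_bounded: "norm a \<le> r \<Longrightarrow> norm (pinf a) \<le> exp (r / (1 - Q))"
  using norm_qpoch_inf_le[of a] Q_less_1 by (meson divide_right_mono diff_ge_0_iff_ge exp_le_cancel_iff less_imp_le order_trans)

lemma norm_qpoch_bounded: "norm a \<le> r \<Longrightarrow> norm (qpoch a CQ n) \<le> exp (r / (1 - Q))"
  using norm_qpoch_le[of a n] Q_less_1 by (meson divide_right_mono diff_ge_0_iff_ge exp_le_cancel_iff less_imp_le order_trans)

text \<open>For \<open>y < 0\<close> the function is a polynomial in \<open>x\<close> with bounded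
  coefficients, up to a bounded factor. For \<open>y > 0\<close> and large \<open>x\<close> the
  lower parameter is a negative integral power of \<open>Q\<close>, since \<open>A * B\<close> is a
  power of \<open>Q\<close>, and \<open>phi22_shift\<close> applies. The shifted parameters stay
  bounded, and the prefactor grows at most geometrically in the number \<open>r\<close> of vanishing
  terms, that is, polynomially in \<open>x\<close>.\<close>

lemma J_tempered:
  assumes S: "\<And>A B. (A, B) \<in> S \<Longrightarrow> norm A \<le> R \<and> norm B \<le> R \<and> regular A \<and> regular B \<and> A * B = of_real (Q powi p)"
    and y: "y \<in> I_q Q"
  shows "tempered S (\<lambda>(A, B) x. J A B (of_real x) (of_real y))"
proof -
  have "(\<exists>n. y = - (Q ^ Suc n)) \<or> (\<exists>k. y = Q powi k)"
    using y unfolding I_q_def by (auto simp: gr0_conv_Suc) (metis Suc_le_D power_Suc)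
  then show ?thesis
  proof (elim disjE exE)
    fix l assume l: "y = - (Q ^ Suc l)"
    have bA: "tempered S (\<lambda>i x. fst i)" and bB: "tempered S (\<lambda>i x. snd i)"
      by (rule tempered_bounded[where C = R]; use S in fastforce)+
    have "tempered S (\<lambda>i x. J_poly (fst i) (snd i) l (of_real x))"
    proof (induction l rule: induct_nat_012)
      case 0
      show ?case by (simp add: tempered_const)
    next
      case 1
      show ?case unfolding J_poly.simps by (intro tempered_intros bA bB)
    next
      case (ge2 l)
      show ?case unfolding J_poly.simps by (intro tempered_intros bA bB ge2)
    qed
    moreover have "tempered S (\<lambda>i x. pinf (- (CQ ^ Suc l) * fst i) * pinf (- (CQ ^ Suc l) * snd i))"
    proof (intro tempered_mult tempered_bounded[where C = "exp (R / (1 - Q))"] norm_pinf_bounded)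
      fix i assume i: "i \<in> S"
      have "Q ^ Suc l \<le> 1" using Q_pos Q_less_1 by (intro power_le_one) auto
      then have *: "Q ^ Suc l * norm v \<le> 1 * norm v" for v :: complex by (intro mult_right_mono) auto
      show "norm (- (CQ ^ Suc l) * fst i) \<le> R" "norm (- (CQ ^ Suc l) * snd i) \<le> R"
        using *[of "fst i"] *[of "snd i"] S[of "fst i" "snd i"] i Q_pos
        by (auto simp: norm_mult norm_power simp del: power_Suc)
    qed
    ultimately have "tempered S (\<lambda>i x. pinf (- (CQ ^ Suc l) * fst i) * pinf (- (CQ ^ Suc l) * snd i)
        * J_poly (fst i) (snd i) l (of_real x))"
      by (rule tempered_mult[rotated])
    moreover have "J A B (of_real x) (of_real y) = pinf (- (CQ ^ Suc l) * A) * pinf (- (CQ ^ Suc l) * B)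
        * J_poly A B l (of_real x)" if "(A, B) \<in> S" for A B x
      using J_eq_J_poly[of A B "of_real x" l] S[OF that] by (simp add: l)
    ultimately show ?thesis
      by (subst tempered_cong) (auto simp: split_beta)
  next
    fix l :: int assume l: "y = Q powi l"
    define X where "X = max 1 (Q powi (- (l + p)))"
    obtain C1 where C1: "\<And>A B x. norm A \<le> R \<Longrightarrow> norm B \<le> R \<Longrightarrow> norm x \<le> X \<Longrightarrow> norm (J A B x (of_real y)) \<le> C1"
      using J_bounded[of R X "of_real y"] by blast
    \<comment> \<open>At \<open>x = Q powi k\<close> the condition \<open>x > e\<close> amounts to
      \<open>k + l + p < 0\<close>, where the shift is applied; then \<open>x * Q ^ r\<close> has
      the fixed value \<open>Q * e\<close>.\<close>
    define e where "e = Q powi (- (l + p))"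
    have e: "e > 0" using Q_pos by (simp add: e_def)
    define R' where "R' = max 1 R"
    define D where "D = (1 + e * R') * R'"
    define r0 where "r0 = max 1 (R' * max 1 (max y (Q * e)))"
    define C2 where "C2 = exp (r0 / (1 - Q)) * phi_sup r0"
    \<comment> \<open>This converts the geometric bound \<open>D ^ r\<close> into a power of
      \<open>x\<close>, because \<open>inverse (Q ^ r)\<close> is a constant multiple of
      \<open>x\<close>.\<close>
    obtain M where M: "max 1 D < inverse Q ^ M"
      using real_arch_pow[of "inverse Q" "max 1 D"] Q_pos Q_less_1 one_less_inverse by blast
    define C3 where "C3 = C2 * inverse (Q * e) ^ M"
    have phis0: "phi_sup r0 \<ge> 0"
      unfolding phi_sup_def by (intro suminf_nonneg summable_phi_bd)
        (auto intro!: mult_nonneg_nonneg phi_bd_nonneg simp: r0_def less_imp_le[OF Q_pos])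
    show ?thesis
    proof (rule temperedI[where C = "max C1 C3" and N = M], clarify)
      fix A B x assume AB: "(A, B) \<in> S" and x: "x \<in> I_q Q"
      note S' = S[OF AB]
      have m1: "1 \<le> max 1 \<bar>x\<bar> ^ M" by (simp add: one_le_power)
      show "norm (J A B (of_real x) (of_real y)) \<le> max C1 C3 * max 1 \<bar>x\<bar> ^ M"
      proof (cases "\<bar>x\<bar> \<le> X")
        case True
        then have c1: "norm (J A B (of_real x) (of_real y)) \<le> C1"
          using C1 S' by simp
        then have "C1 \<ge> 0" using norm_ge_zero order_trans by blast
        then have "C1 \<le> max C1 C3 * max 1 \<bar>x\<bar> ^ M"
          using m1 mult_mono[of C1 "max C1 C3" 1 "max 1 \<bar>x\<bar> ^ M"] by simp
        then show ?thesis using c1 by linarith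
      next
        case False
        have "\<bar>v\<bar> \<le> 1" if "v = - (Q ^ n)" for v n using that Q_pos Q_less_1 by (simp add: power_le_one)
        then obtain k :: int where k: "x = Q powi k"
          using x False unfolding I_q_def X_def by force
        have xpos: "x > 0" using k Q_pos by simp
        then have x1: "x > 1" "x > e" using False by (auto simp: X_def e_def)
        have "k + (l + p) < 0"
        proof (rule ccontr)
          assume "\<not> ?thesis"
          then have "Q powi k \<le> Q powi (- (l + p))"
            using Q_pos Q_less_1 by (intro power_int_decreasing) auto
          then show False using x1(2) by (simp add: e_def k)
        qed
        define r where "r = nat (1 - (k + l + p))"
        have r: "int r = 1 - (k + l + p)" "r \<ge> 1" using \<open>k + (l + p) < 0\<close> by (auto simp: r_def)
        have Qr: "Q ^ r = Q powi (1 - (k + l + p))" using r(1) by (metis power_int_of_nat)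
        have c: "of_real x * of_real y * A * B * CQ ^ r = CQ"
        proof -
          have "x * y * Q powi p * Q ^ r = Q"
            unfolding k l Qr using Q_nz by (simp flip: power_int_add)
          then have "complex_of_real x * of_real y * of_real (Q powi p) * of_real (Q ^ r) = CQ"
            by (simp only: of_real_mult[symmetric])
          moreover have "A * B = of_real (Q powi p)" using S' by blast
          ultimately show ?thesis by (simp only: mult.assoc of_real_power)
        qed
        have xr: "x * Q ^ r = Q * e"
        proof -
          have "Q powi k * Q powi (1 - (k + l + p)) = Q powi (1 + - (l + p))"
            using Q_nz by (simp flip: power_int_add)
          then show ?thesis
            unfolding k Qr e_def using Q_nz power_int_add[of Q 1 "- (l + p)"] by simp
        qed
        have RA: "norm A \<le> R'" "norm B \<le> R'" "R' \<ge> 1" using S' by (auto simp: R'_def)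
        have ypos: "y > 0" using l Q_pos by simp
        have r0: "R' * y \<le> r0" "R' * (Q * e) \<le> r0" "R' \<le> r0" "1 \<le> r0"
          using RA(3) by (auto simp: r0_def max_mult_distrib_left)
        have Qr1: "Q ^ n \<le> 1" for n using Q_pos Q_less_1 by (simp add: power_le_one)
        have yB: "norm (of_real y * B) \<le> r0"
        proof -
          have "norm (of_real y * B) = y * norm B" using ypos by (simp add: norm_mult)
          also have "\<dots> \<le> y * R'" using RA(2) ypos by (intro mult_left_mono) auto
          also have "\<dots> \<le> r0" using r0(1) by (simp only: mult.commute)
          finally show ?thesis .
        qed
        have p1: "norm (qpoch (of_real y * B) CQ r) \<le> exp (r0 / (1 - Q))"
          by (rule norm_qpoch_bounded[OF yB])
        have small: "norm (v * CQ ^ n) \<le> s" if "norm v \<le> s" for v :: complex and s n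
        proof -
          have "norm v * Q ^ n \<le> s * 1"
            using that Qr1[of n] order_trans[OF norm_ge_zero that] Q_pos by (intro mult_mono) auto
          then show ?thesis using Q_pos by (simp add: norm_mult norm_power)
        qed
        have p2: "norm (phi22_reg (of_real y * B * CQ ^ r) (of_real x * B * CQ ^ r) (CQ ^ Suc r)
            (- (CQ * B) * CQ ^ r) CQ (- (CQ * A) * CQ ^ r)) \<le> phi_sup r0"
        proof (rule norm_phi22_le)
          show "norm (of_real y * B * CQ ^ r) \<le> r0" by (rule small[OF yB])
          have "norm (of_real x * B * CQ ^ r) = (x * Q ^ r) * norm B"
            using xpos Q_pos by (simp add: norm_mult norm_power)
          also have "\<dots> \<le> (Q * e) * R'"
            unfolding xr using RA(2) e Q_pos by (intro mult_left_mono) auto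
          also have "\<dots> \<le> r0" using r0(2) by (simp add: mult.commute)
          finally show "norm (of_real x * B * CQ ^ r) \<le> r0" .
          show "norm (CQ ^ Suc r) \<le> r0"
            using Qr1[of "Suc r"] r0(4) Q_pos by (simp add: norm_power norm_mult del: power_Suc)
          have "Q * norm B \<le> 1 * R'" "Q * norm A \<le> 1 * R'"
            using Q_less_1 Q_pos RA by (intro mult_mono; simp)+
          then show "norm (- (CQ * B) * CQ ^ r) \<le> r0" "norm (- (CQ * A) * CQ ^ r) \<le> r0"
            using r0(3) Q_pos by (intro small; simp add: norm_mult)+
        qed
        have gauss: "Q ^ (n choose 2) = (\<Prod>i<n. Q ^ i)" for n
          by (induction n) (simp_all add: numeral_2_eq_2 power_add)
        \<comment> \<open>The factor at \<open>i\<close> is at most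
          \<open>1 + x * norm B * Q ^ i\<close>. It is paired with the factor
          \<open>Q ^ (r - Suc i)\<close> of the Gaussian power, and
          \<open>x * Q ^ i * Q ^ (r - Suc i)\<close> is the constant \<open>e\<close>.\<close>
        have p3: "norm (qpoch (of_real x * B) CQ r) * Q ^ (r choose 2) \<le> (1 + e * R') ^ r"
        proof -
          have "norm (qpoch (of_real x * B) CQ r) * Q ^ (r choose 2)
            = (\<Prod>i<r. norm (1 - of_real x * B * CQ ^ i)) * (\<Prod>i<r. Q ^ (r - Suc i))"
            unfolding gauss qpoch_def by (simp add: prod_norm prod.nat_diff_reindex)
          also have "\<dots> = (\<Prod>i<r. norm (1 - of_real x * B * CQ ^ i) * Q ^ (r - Suc i))"
            by (rule prod.distrib[symmetric])
          also have "\<dots> \<le> (\<Prod>i<r. 1 + e * R')"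
          proof (intro prod_mono conjI mult_nonneg_nonneg norm_ge_zero)
            fix i assume i: "i \<in> {..<r}"
            have q1: "Q * (Q ^ i * Q ^ (r - Suc i)) = Q ^ r"
              using i by (simp flip: power_add power_Suc)
            have xq: "x * (Q ^ i * Q ^ (r - Suc i)) = e"
              using xr q1 Q_pos by (metis mult.left_commute mult_cancel_left Q_nz(1))
            have "norm (1 - of_real x * B * CQ ^ i) \<le> 1 + x * norm B * Q ^ i"
              using norm_triangle_ineq4[of 1 "of_real x * B * CQ ^ i"] xpos Q_pos
              by (simp add: norm_mult norm_power)
            then have "norm (1 - of_real x * B * CQ ^ i) * Q ^ (r - Suc i)
              \<le> (1 + x * norm B * Q ^ i) * Q ^ (r - Suc i)"
              using Q_pos by (intro mult_right_mono) auto
            also have "\<dots> = Q ^ (r - Suc i) + e * norm B"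
              by (simp add: distrib_right flip: xq)
            also have "\<dots> \<le> 1 + e * R'"
              using Qr1 e RA by (intro add_mono mult_left_mono) auto
            finally show "norm (1 - of_real x * B * CQ ^ i) * Q ^ (r - Suc i) \<le> 1 + e * R'" .
          qed (use Q_pos in auto)
          finally show ?thesis by simp
        qed
        have p4: "norm (CQ * A) ^ r \<le> R' ^ r"
          using mult_mono[of Q 1 "norm A" R'] Q_pos Q_less_1 RA by (intro power_mono) (auto simp: norm_mult)
        have eR: "1 + e * R' \<ge> 0" using e RA(3) by simp
        define F where "F = phi22_reg (of_real y * B * CQ ^ r) (of_real x * B * CQ ^ r) (CQ ^ Suc r)
            (- (CQ * B) * CQ ^ r) CQ (- (CQ * A) * CQ ^ r)"
        have "norm (J A B (of_real x) (of_real y)) =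
            norm (qpoch (of_real y * B) CQ r) * (norm (qpoch (of_real x * B) CQ r) * Q ^ (r choose 2))
             * norm (CQ * A) ^ r * norm F"
          unfolding J_def phi22_shift[OF c] F_def[symmetric] minus_minus
            norm_mult[of _ F] norm_mult[of _ "CQ ^ (r choose 2)"] norm_mult[of _ "(CQ * A) ^ r"]
            norm_mult[of "qpoch _ _ _"] norm_power
          using Q_pos by simp
        also have "\<dots> \<le> exp (r0 / (1 - Q)) * (1 + e * R') ^ r * R' ^ r * phi_sup r0"
          using p1 p2[folded F_def] p3 p4 eR RA(3) Q_pos
          by (intro mult_mono) (auto intro!: mult_nonneg_nonneg)
        also have "\<dots> = C2 * D ^ r"
          by (simp add: C2_def D_def power_mult_distrib mult_ac)
        also have "\<dots> \<le> C2 * ((inverse Q ^ M) ^ r)"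
          using M eR RA(3) phis0 by (intro mult_left_mono power_mono) (auto simp: C2_def D_def)
        also have "(inverse Q ^ M) ^ r = (inverse (Q ^ r)) ^ M"
          unfolding power_inverse[symmetric] power_mult[symmetric] by (simp only: mult.commute)
        also have "inverse (Q ^ r) = x * inverse (Q * e)"
          unfolding xr[symmetric] using xpos by simp
        also have "C2 * (x * inverse (Q * e)) ^ M = C3 * x ^ M"
          unfolding C3_def power_mult_distrib by (simp only: mult_ac)
        also have "\<dots> \<le> max C1 C3 * max 1 \<bar>x\<bar> ^ M"
        proof -
          have "C3 \<ge> 0" using phis0 e Q_pos by (simp add: C3_def C2_def)
          then show ?thesis using x1 xpos by (intro mult_mono power_mono) auto
        qed
        finally show ?thesis .
      qed
    qed
  qed
qed

subsection \<open>Orthogonality\<close>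

abbreviation jj :: "complex \<Rightarrow> complex \<Rightarrow> real \<Rightarrow> real \<Rightarrow> complex" where
  "jj A B y x \<equiv> J A B (of_real x) (of_real y)"

lemma I_q_gt: "x \<in> I_q Q \<Longrightarrow> - 1 < x"
proof (elim I_q_cases)
  fix n assume "x = Q ^ n"
  then show ?thesis using zero_less_power[OF Q_pos, of n] by linarith
next
  fix n assume "x = inverse Q ^ Suc n"
  moreover have "inverse Q ^ Suc n > 0" using Q_pos by (intro zero_less_power) auto
  ultimately show ?thesis by linarith
next
  fix n assume "x = - (Q ^ Suc n)"
  then show ?thesis using power_Suc_less_one[OF Q_pos Q_less_1, of n] by linarith
qed

lemma jj_commute: "jj A B y x = jj A B x y"
  by (rule J_commute)

lemma jj_tempered:
  assumes "regular A" "regular B" "A * B = of_real (Q powi p)" "y \<in> I_q Q"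
  shows "tempered {()} (\<lambda>_. jj A B y)"
proof -
  have "tempered {(A, B)} (\<lambda>(A, B) x. J A B (of_real x) (of_real y))"
    by (rule J_tempered[where R = "max (norm A) (norm B)" and p = p]) (use assms in auto)
  from tempered_reindex[OF this, of "\<lambda>_. (A, B)" "{()}"] show ?thesis by simp
qed

lemma jj_rec:
  "(1 - of_real x * A) * (1 - of_real x * B) * jj A B y (Q * x) + CQ * (1 + of_real (x / Q)) * jj A B y (x / Q)
   + (of_real (x\<^sup>2 / Q * y) * A * B + of_real x * (A + B - 1) - (CQ + 1)) * jj A B y x = 0"
  using J_rec[of "of_real (x / Q)" A B "of_real y"] Q_nz by (simp add: power2_eq_square)

text \<open>The increments of the Casoratian of two solutions of the recurrence, suitably weighted, are
  the terms of the inner product.\<close>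

lemma orthogonality_has_sum:
  assumes A: "regular A" and B: "regular B" and AB: "A * B = of_real (Q powi p)"
    and y: "y \<in> I_q Q" "y' \<in> I_q Q" and "y \<noteq> y'"
  shows "((\<lambda>x. of_real \<bar>x\<bar> * weight A B x * (jj A B y x * jj B A y' x)) has_sum 0) (I_q Q)"
proof -
  define u where "u = jj A B y"
  define v where "v = jj B A y'"
  have BA: "B * A = of_real (Q powi p)" using AB by (simp add: mult.commute)
  have tu: "tempered {()} (\<lambda>_. u)" unfolding u_def by (rule jj_tempered[OF A B AB y(1)])
  have tv: "tempered {()} (\<lambda>_. v)" unfolding v_def by (rule jj_tempered[OF B A BA y(2)])
  define w where "w = weight A B"
  \<comment> \<open>The form \<open>(1 + of_real x) * w (Q * x)\<close> of the Pearson equation,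
    rather than the one with \<open>w x\<close>, makes it evident that \<open>V\<close> vanishes at
    \<open>x = - 1\<close>, which is not covered by \<open>regular\<close>.\<close>
  define V where "V = (\<lambda>x. (1 + of_real x) * w (Q * x) / of_real x * (u (Q * x) * v x - u x * v (Q * x)))"
  \<comment> \<open>The constant is the difference of the two eigenvalues, in the scaling of
    \<open>jj_rec\<close>.\<close>
  define g where "g = (\<lambda>x. of_real ((y' - y) * Q powi p / Q) * (of_real \<bar>x\<bar> * w x * (u x * v x)))"
  have wr: "w x * ((1 - of_real x * A) * (1 - of_real x * B)) = (1 + of_real x) * w (Q * x)" if "x \<in> I_q Q" for x
    unfolding w_def by (rule weight_rec[OF A B that])
  have g_summable: "g abs_summable_on I_q Q"
    unfolding g_def norm_mult[of "of_real ((y' - y) * Q powi p / Q)"] w_def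
    by (intro summable_on_cmult_right tempered_weight_abs_summable A B tempered_mult tu tv)
  have der: "\<exists>D. ((\<lambda>h. (f h - f 0) / h) \<longlongrightarrow> D) (at 0)" if "f holomorphic_on UNIV" for f :: "complex \<Rightarrow> complex"
  proof -
    have "f field_differentiable (at 0)" using that by (simp add: holomorphic_on_def)
    then show ?thesis by (auto simp: field_differentiable_def has_field_derivative_iff)
  qed
  define U' where "U' = (\<lambda>x. J A B x (of_real y))"
  define V' where "V' = (\<lambda>x. J B A x (of_real y'))"
  have hol: "U' holomorphic_on UNIV" "V' holomorphic_on UNIV"
    unfolding U'_def V'_def by (auto intro!: holomorphic_intros)
  obtain D E where D: "((\<lambda>h. (U' h - U' 0) / h) \<longlongrightarrow> D) (at 0)" and E: "((\<lambda>h. (V' h - V' 0) / h) \<longlongrightarrow> E) (at 0)"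
    using der[OF hol(1)] der[OF hol(2)] by blast
  have cont: "isCont U' 0" "isCont V' 0"
    using hol[THEN holomorphic_on_imp_continuous_on] by (auto simp: continuous_on_eq_continuous_at)
  \<comment> \<open>The Casoratian is divided by \<open>x\<close>, but both functions are
    holomorphic at 0, so difference quotients converge. The limit does not depend on
    \<open>s\<close>, hence is the same on both half-lattices.\<close>
  have lim: "(\<lambda>n. V (s * Q ^ n)) \<longlonglongrightarrow> (CQ * D - D) * V' 0 - U' 0 * (CQ * E - E)" if s: "s \<noteq> 0" for s
  proof -
    define z where "z = (\<lambda>n. complex_of_real (s * Q ^ n))"
    have z: "z \<longlonglongrightarrow> 0"
      unfolding z_def using tendsto_of_real[OF Q_power_LIMSEQ[of s]] by simp
    have Qz: "(\<lambda>n. CQ * z n) \<longlonglongrightarrow> 0"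
      using tendsto_mult_right_zero[OF z] by simp
    have z0: "z n \<noteq> 0" for n using s Q_pos by (simp add: z_def)
    have Qz0: "CQ * z n \<noteq> 0" for n using z0 Q_nz by simp
    have at0: "filterlim z (at 0) sequentially" "filterlim (\<lambda>n. CQ * z n) (at 0) sequentially"
      using z Qz z0 Qz0 by (auto simp: filterlim_at)
    note D1 = filterlim_compose[OF D at0(1)] and D2 = filterlim_compose[OF D at0(2)]
    note E1 = filterlim_compose[OF E at0(1)] and E2 = filterlim_compose[OF E at0(2)]
    note U1 = isCont_tendsto_compose[OF cont(1) z] and V1 = isCont_tendsto_compose[OF cont(2) z]
    have wl: "(\<lambda>n. w (Q * (s * Q ^ n))) \<longlonglongrightarrow> 1"
      unfolding w_def by (rule weight_lim) (rule tendsto_mult_right_zero[OF Q_power_LIMSEQ])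
    have "(\<lambda>n. (1 + z n) * w (Q * (s * Q ^ n)) *
       ((CQ * ((U' (CQ * z n) - U' 0) / (CQ * z n)) - (U' (z n) - U' 0) / z n) * V' (z n)
        - U' (z n) * (CQ * ((V' (CQ * z n) - V' 0) / (CQ * z n)) - (V' (z n) - V' 0) / z n)))
      \<longlonglongrightarrow> (1 + 0) * 1 * ((CQ * D - D) * V' 0 - U' 0 * (CQ * E - E))"
      by (intro tendsto_intros z wl D1 D2 E1 E2 U1 V1)
    moreover have "V (s * Q ^ n) = (1 + z n) * w (Q * (s * Q ^ n)) *
       ((CQ * ((U' (CQ * z n) - U' 0) / (CQ * z n)) - (U' (z n) - U' 0) / z n) * V' (z n)
        - U' (z n) * (CQ * ((V' (CQ * z n) - V' 0) / (CQ * z n)) - (V' (z n) - V' 0) / z n))" for n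
    proof -
      have "u (Q * (s * Q ^ n)) = U' (CQ * z n)" "u (s * Q ^ n) = U' (z n)"
        "v (Q * (s * Q ^ n)) = V' (CQ * z n)" "v (s * Q ^ n) = V' (z n)"
        by (simp_all add: u_def v_def U'_def V'_def z_def)
      then have "V (s * Q ^ n) = (1 + z n) * w (Q * (s * Q ^ n)) *
        ((U' (CQ * z n) * V' (z n) - U' (z n) * V' (CQ * z n)) / z n)"
        by (simp add: V_def z_def)
      also have "(U' (CQ * z n) * V' (z n) - U' (z n) * V' (CQ * z n)) / z n =
        (CQ * ((U' (CQ * z n) - U' 0) / (CQ * z n)) - (U' (z n) - U' 0) / z n) * V' (z n)
        - U' (z n) * (CQ * ((V' (CQ * z n) - V' 0) / (CQ * z n)) - (V' (z n) - V' 0) / z n)"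
        using z0[of n] Q_nz by (simp add: diff_divide_distrib algebra_simps)
      finally show ?thesis .
    qed
    ultimately show ?thesis by simp
  qed
  have "(g has_sum 0) (I_q Q)"
  proof (rule I_q_telescope[where V = V, OF g_summable])
    fix x assume x: "x \<in> I_q Q"
    have x0: "x \<noteq> 0" "complex_of_real x \<noteq> 0" using I_q_nz[OF x] by auto
    define \<beta> where "\<beta> = of_real x * (A + B - 1) - (CQ + 1)"
    define P where "P = (1 - of_real x * A) * (1 - of_real x * B)"
    have ru: "P * u (Q * x) = - (CQ * (1 + of_real (x / Q)) * u (x / Q)) - (of_real (x\<^sup>2 / Q * y) * of_real (Q powi p) + \<beta>) * u x"
      using jj_rec[of x A B y] unfolding u_def P_def \<beta>_def AB[symmetric]
      by (simp add: algebra_simps add_eq_0_iff)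
    have rv: "P * v (Q * x) = - (CQ * (1 + of_real (x / Q)) * v (x / Q)) - (of_real (x\<^sup>2 / Q * y') * of_real (Q powi p) + \<beta>) * v x"
      using jj_rec[of x B A y'] unfolding v_def P_def \<beta>_def AB[symmetric]
      by (simp add: algebra_simps add_eq_0_iff)
    have 1: "V x = w x / of_real x * ((P * u (Q * x)) * v x - u x * (P * v (Q * x)))"
      unfolding V_def wr[OF x, symmetric] P_def[symmetric] by (simp add: algebra_simps diff_divide_distrib)
    have 2: "V (x / Q) = w x / of_real x * (CQ * (1 + of_real (x / Q)) * (u x * v (x / Q) - u (x / Q) * v x))"
      unfolding V_def using Q_pos x0 by (simp add: divide_simps)
    have "V x - V (x / Q) = w x / of_real x * (of_real (x\<^sup>2 / Q * (y' - y)) * of_real (Q powi p) * (u x * v x))"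
    proof -
      have alg: "k * ((- (c * u') - (e + \<beta>) * u) * v - u * (- (c * v') - (f + \<beta>) * v)) - k * (c * (u * v' - u' * v))
          = k * ((f - e) * (u * v))" for k c u u' v v' e f :: complex
        by (simp add: algebra_simps)
      have "of_real (x\<^sup>2 / Q * y') * of_real (Q powi p) - of_real (x\<^sup>2 / Q * y) * of_real (Q powi p)
          = complex_of_real (x\<^sup>2 / Q * (y' - y)) * of_real (Q powi p)"
        by (simp add: left_diff_distrib right_diff_distrib diff_divide_distrib)
      then show ?thesis unfolding 1 2 ru rv alg by (simp only:)
    qed
    also have "of_real (sgn x) * \<dots> = g x"
      unfolding g_def using x0 Q_nz by (simp add: abs_sgn power2_eq_square mult_ac)
    finally show "g x = of_real (sgn x) * (V x - V (x / Q))" by simp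
  next
    show "(\<lambda>n. V (Q ^ n)) \<longlonglongrightarrow> (CQ * D - D) * V' 0 - U' 0 * (CQ * E - E)"
      using lim[of 1] by simp
    show "(\<lambda>n. V (- (Q ^ n))) \<longlonglongrightarrow> (CQ * D - D) * V' 0 - U' 0 * (CQ * E - E)"
      using lim[of "- 1"] by simp
    \<comment> \<open>On the lattice \<open>V x\<close> is \<open>w x * h x / of_real x\<close> with
      \<open>h\<close> of polynomial growth, so near infinity it is dominated by the terms of a
      convergent series.\<close>
    define h where "h = (\<lambda>x. (1 - of_real x * A) * (1 - of_real x * B) * (u (Q * x) * v x - u x * v (Q * x)))"
    have Vh: "norm (V (inverse Q ^ n)) \<le> norm (of_real \<bar>inverse Q ^ n\<bar> * w (inverse Q ^ n) * h (inverse Q ^ n))" for n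
    proof -
      define x where "x = inverse Q ^ n"
      have x: "x \<in> I_q Q" "x \<ge> 1"
        using one_le_power[of "inverse Q" n] Q_pos Q_less_1
        by (auto simp: x_def one_le_inverse simp del: power_inverse)
      have "V x = w x * h x / of_real x"
        unfolding V_def wr[OF x(1), symmetric] h_def by (simp add: mult_ac)
      then have "norm (V x) = norm (w x * h x) / x" using x(2) by (simp add: norm_divide)
      also have "\<dots> \<le> x * norm (w x * h x)"
      proof -
        have "norm (w x * h x) \<le> x * x * norm (w x * h x)"
          using mult_mono[of 1 x 1 x] x(2) mult_right_mono[of 1 "x * x" "norm (w x * h x)"] by simp
        then show ?thesis using x(2) by (simp add: divide_le_eq mult_ac)
      qed
      also have "\<dots> = norm (of_real \<bar>x\<bar> * w x * h x)"
        using x(2) by (simp add: norm_mult)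
      finally show ?thesis unfolding x_def .
    qed
    have "tempered {()} (\<lambda>_. h)"
      unfolding h_def
      by (intro tempered_mult tempered_diff tempered_const tempered_x tu tv
          tempered_scale[OF tu] tempered_scale[OF tv])
    from abs_summable_I_q_sequences(2)[OF tempered_weight_abs_summable[OF A B this]]
    have "(\<lambda>n. norm (of_real \<bar>inverse Q ^ Suc n\<bar> * weight A B (inverse Q ^ Suc n) * h (inverse Q ^ Suc n))) \<longlonglongrightarrow> 0"
      by (rule summable_LIMSEQ_zero)
    then have "(\<lambda>n. norm (of_real \<bar>inverse Q ^ n\<bar> * w (inverse Q ^ n) * h (inverse Q ^ n))) \<longlonglongrightarrow> 0"
      unfolding w_def by (rule LIMSEQ_imp_Suc)
    then show "(\<lambda>n. V (inverse Q ^ n)) \<longlonglongrightarrow> 0"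
      by (rule Lim_null_comparison[rotated]) (use Vh in auto)
    show "V (- 1) = 0" by (simp add: V_def)
  qed
  then have "((\<lambda>x. inverse (of_real ((y' - y) * Q powi p / Q)) * g x) has_sum (inverse (of_real ((y' - y) * Q powi p / Q)) * 0)) (I_q Q)"
    by (rule has_sum_cmult_right)
  moreover have "inverse (of_real ((y' - y) * Q powi p / Q)) * g x = of_real \<bar>x\<bar> * weight A B x * (jj A B y x * jj B A y' x)" for x
    using \<open>y \<noteq> y'\<close> Q_pos by (simp add: g_def w_def u_def v_def)
  ultimately show ?thesis by simp
qed

text \<open>A bilinear substitute for a squared norm: in the second factor \<open>A\<close> and
  \<open>B\<close> are exchanged rather than conjugated, which is compatible with analytic
  continuation. For \<open>A = cnj B\<close> it is a squared norm.\<close>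

definition nrm :: "complex \<Rightarrow> complex \<Rightarrow> real \<Rightarrow> complex" where
  "nrm A B y = (\<Sum>\<^sub>\<infinity>x\<in>I_q Q. of_real \<bar>x\<bar> * weight A B x * (jj A B y x * jj B A y x))"

lemma inner_abs_summable:
  assumes A: "regular A" and B: "regular B" and AB: "A * B = of_real (Q powi p)"
    and y: "y \<in> I_q Q" "y' \<in> I_q Q"
  shows "(\<lambda>x. of_real \<bar>x\<bar> * weight A B x * (jj A B y x * jj B A y' x)) abs_summable_on I_q Q"
    "(\<lambda>x. of_real \<bar>x\<bar> * weight A B x * (of_real x * (jj A B y x * jj B A y' x))) abs_summable_on I_q Q"
proof -
  have BA: "B * A = of_real (Q powi p)" using AB by (simp add: mult.commute)
  show "(\<lambda>x. of_real \<bar>x\<bar> * weight A B x * (jj A B y x * jj B A y' x)) abs_summable_on I_q Q"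
    "(\<lambda>x. of_real \<bar>x\<bar> * weight A B x * (of_real x * (jj A B y x * jj B A y' x))) abs_summable_on I_q Q"
    by (intro tempered_weight_abs_summable A B tempered_mult tempered_x
        jj_tempered[OF A B AB y(1)] jj_tempered[OF B A BA y(2)])+
qed

lemma nrm_has_sum:
  assumes "regular A" "regular B" "A * B = of_real (Q powi p)" "y \<in> I_q Q"
  shows "((\<lambda>x. of_real \<bar>x\<bar> * weight A B x * (jj A B y x * jj B A y x)) has_sum nrm A B y) (I_q Q)"
  unfolding nrm_def
  by (rule has_sum_infsum[OF abs_summable_summable[OF inner_abs_summable(1)[OF assms assms(4)]]])

text \<open>As for orthogonal polynomials, the recurrence in the index is paired with neighbouring
  functions. The relation around \<open>Q * y\<close> paired with the function at \<open>y\<close>,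
  and the one around \<open>y\<close> paired with the function at \<open>Q * y\<close>, each leave
  one norm and the same cross moment \<open>Z\<close> by orthogonality; eliminating \<open>Z\<close>
  links the norms.\<close>

lemma nrm_rec:
  assumes A: "regular A" and B: "regular B" and AB: "A * B = of_real (Q powi p)" and y: "y \<in> I_q Q"
  shows "CQ * ((1 - of_real y * A) * (1 - of_real y * B)) * nrm A B (Q * y) = (1 + of_real y) * nrm A B y"
proof -
  note Qy = I_q_scale[OF y] and QQy = I_q_scale[OF I_q_scale[OF y]]
  have neq: "y \<noteq> Q * y" "Q * y \<noteq> y" "Q * (Q * y) \<noteq> y"
  proof -
    have "Q * Q < 1" using mult_strict_mono[of Q 1 Q 1] Q_pos Q_less_1 by simp
    then show "y \<noteq> Q * y" "Q * y \<noteq> y" "Q * (Q * y) \<noteq> y"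
      using Q_less_1 I_q_nz[OF y] by (auto simp flip: mult.assoc)
  qed
  define w where "w = (\<lambda>x. of_real \<bar>x\<bar> * weight A B x)"
  define Z where "Z = (\<Sum>\<^sub>\<infinity>x\<in>I_q Q. w x * (of_real x * (jj A B (Q * y) x * jj B A y x)))"
  have Zs: "((\<lambda>x. w x * (of_real x * (jj A B (Q * y) x * jj B A y x))) has_sum Z) (I_q Q)"
    unfolding Z_def w_def
    by (rule has_sum_infsum[OF abs_summable_summable[OF inner_abs_summable(2)[OF A B AB Qy y]]])
  have rec: "(1 - of_real t * A) * (1 - of_real t * B) * jj A B (Q * t) x + CQ * (1 + of_real (t / Q)) * jj A B (t / Q) x
     + (of_real (t\<^sup>2 / Q * x) * A * B + of_real t * (A + B - 1) - (CQ + 1)) * jj A B t x = 0" for t x A B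
    using jj_rec[of t A B x] unfolding jj_commute[of A B x] .
  have h1: "((\<lambda>x. w x * (jj A B y x * jj B A y x)) has_sum nrm A B y) (I_q Q)"
    unfolding w_def by (rule nrm_has_sum[OF A B AB y])
  have h2: "((\<lambda>x. w x * (jj A B (Q * y) x * jj B A (Q * y) x)) has_sum nrm A B (Q * y)) (I_q Q)"
    unfolding w_def by (rule nrm_has_sum[OF A B AB Qy])
  have h3: "((\<lambda>x. w x * (jj A B (Q * y) x * jj B A y x)) has_sum 0) (I_q Q)"
    unfolding w_def by (rule orthogonality_has_sum[OF A B AB Qy y neq(2)])
  have h4: "((\<lambda>x. w x * (jj A B (Q * (Q * y)) x * jj B A y x)) has_sum 0) (I_q Q)"
    unfolding w_def by (rule orthogonality_has_sum[OF A B AB QQy y neq(3)])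
  define P where "P = (1 - of_real (Q * y) * A) * (1 - of_real (Q * y) * B)"
  define c where "c = CQ * of_real (y\<^sup>2) * A * B"
  define d where "d = of_real (Q * y) * (A + B - 1) - (CQ + 1)"
  have "((\<lambda>x. P * (w x * (jj A B (Q * (Q * y)) x * jj B A y x)) + CQ * (1 + of_real y) * (w x * (jj A B y x * jj B A y x))
      + (c * (w x * (of_real x * (jj A B (Q * y) x * jj B A y x))) + d * (w x * (jj A B (Q * y) x * jj B A y x))))
     has_sum (P * 0 + CQ * (1 + of_real y) * nrm A B y + (c * Z + d * 0))) (I_q Q)"
    by (intro has_sum_add has_sum_cmult_right h1 h3 h4 Zs)
  moreover have "P * (w x * (jj A B (Q * (Q * y)) x * jj B A y x)) + CQ * (1 + of_real y) * (w x * (jj A B y x * jj B A y x))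
      + (c * (w x * (of_real x * (jj A B (Q * y) x * jj B A y x))) + d * (w x * (jj A B (Q * y) x * jj B A y x))) = 0" for x
  proof -
    have "P * jj A B (Q * (Q * y)) x + CQ * (1 + of_real y) * jj A B y x + (c * of_real x + d) * jj A B (Q * y) x = 0"
      using rec[of "Q * y" A B x] Q_nz by (simp add: P_def c_def d_def power2_eq_square mult_ac add_diff_eq)
    then have "w x * jj B A y x * (P * jj A B (Q * (Q * y)) x + CQ * (1 + of_real y) * jj A B y x + (c * of_real x + d) * jj A B (Q * y) x) = 0"
      by simp
    moreover have "W * j * (P * k + e * l + (c * X + d) * m) = P * (W * (k * j)) + e * (W * (l * j))
        + (c * (W * (X * (m * j))) + d * (W * (m * j)))" for W j k l m e X :: complex
      by (simp add: algebra_simps)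
    ultimately show ?thesis by (simp only:)
  qed
  ultimately have "P * 0 + CQ * (1 + of_real y) * nrm A B y + (c * Z + d * 0) = 0"
    by (rule has_sum_zero_unique)
  then have eq1: "CQ * (1 + of_real y) * nrm A B y + c * Z = 0"
    by simp
  define P' where "P' = (1 - of_real y * A) * (1 - of_real y * B)"
  define c' where "c' = of_real (y\<^sup>2 / Q) * A * B"
  define d' where "d' = of_real y * (A + B - 1) - (CQ + 1)"
  define f where "f = (\<lambda>x. CQ * (1 + of_real (y / Q)) * (w x * (jj A B (Q * y) x * jj B A (y / Q) x)))"
  have fs: "(f has_sum 0) (I_q Q)"
  proof (cases "y = - Q")
    case True
    then have "f = (\<lambda>x. 0)" using Q_nz by (simp add: f_def)
    then show ?thesis by (simp add: has_sum_0)
  next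
    case False
    have "y / Q \<in> I_q Q"
      using y
    proof (cases rule: I_q_cases)
      case (small n)
      then have "y / Q = Q powi (int n - 1)" using Q_nz by (simp add: power_int_diff)
      then show ?thesis using I_q_intros(1) by metis
    next
      case (large n)
      then have "y / Q = inverse Q ^ Suc (Suc n)" by (simp add: divide_inverse mult_ac)
      then show ?thesis using I_q_intros(3)[of "Suc (Suc n)"] by (simp only:)
    next
      case (neg n)
      with False obtain k where "n = Suc k" by (cases n) auto
      then have "y / Q = - (Q * Q ^ k)" using neg Q_nz by simp
      then show ?thesis using I_q_intros(4)[of k] by (simp only:)
    qed
    moreover have "Q * y \<noteq> y / Q"
    proof -
      have "Q * Q < 1" using mult_strict_mono[of Q 1 Q 1] Q_pos Q_less_1 by simp
      then show ?thesis using I_q_nz[OF y] Q_pos by (auto simp: field_simps)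
    qed
    ultimately have "((\<lambda>x. w x * (jj A B (Q * y) x * jj B A (y / Q) x)) has_sum 0) (I_q Q)"
      unfolding w_def by (intro orthogonality_has_sum[OF A B AB Qy])
    from has_sum_cmult_right[OF this, of "CQ * (1 + of_real (y / Q))"] show ?thesis
      by (simp add: f_def)
  qed
  have "((\<lambda>x. P' * (w x * (jj A B (Q * y) x * jj B A (Q * y) x)) + f x
      + (c' * (w x * (of_real x * (jj A B (Q * y) x * jj B A y x))) + d' * (w x * (jj A B (Q * y) x * jj B A y x))))
     has_sum (P' * nrm A B (Q * y) + 0 + (c' * Z + d' * 0))) (I_q Q)"
    by (intro has_sum_add has_sum_cmult_right h2 h3 fs Zs)
  moreover have "P' * (w x * (jj A B (Q * y) x * jj B A (Q * y) x)) + f x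
      + (c' * (w x * (of_real x * (jj A B (Q * y) x * jj B A y x))) + d' * (w x * (jj A B (Q * y) x * jj B A y x))) = 0" for x
  proof -
    have "P' * jj B A (Q * y) x + CQ * (1 + of_real (y / Q)) * jj B A (y / Q) x + (c' * of_real x + d') * jj B A y x = 0"
      using rec[of y B A x] by (simp only: P'_def c'_def d'_def mult_ac add_diff_eq of_real_mult of_real_divide add.commute[of B A])
    then have "w x * jj A B (Q * y) x * (P' * jj B A (Q * y) x + CQ * (1 + of_real (y / Q)) * jj B A (y / Q) x + (c' * of_real x + d') * jj B A y x) = 0"
      by simp
    moreover have "W * m * (P' * k + e * l + (c' * X + d') * j) = P' * (W * (m * k)) + e * (W * (m * l))
        + (c' * (W * (X * (m * j))) + d' * (W * (m * j)))" for W j k l m e X :: complex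
      by (simp add: algebra_simps)
    ultimately show ?thesis unfolding f_def by (simp only:)
  qed
  ultimately have "P' * nrm A B (Q * y) + 0 + (c' * Z + d' * 0) = 0"
    by (rule has_sum_zero_unique)
  then have eq2: "P' * nrm A B (Q * y) + c' * Z = 0"
    by simp
  have "c = CQ * CQ * c'" using Q_nz by (simp add: c_def c'_def)
  have "CQ * ((1 + of_real y) * nrm A B y) = - (c * Z)"
    using eq1 by (simp only: eq_neg_iff_add_eq_0 mult.assoc)
  also have "\<dots> = CQ * (CQ * - (c' * Z))"
    unfolding \<open>c = CQ * CQ * c'\<close> by (simp only: mult_minus_right mult.assoc)
  also have "- (c' * Z) = P' * nrm A B (Q * y)"
    using eq2 by (metis eq_neg_iff_add_eq_0)
  finally have "(1 + of_real y) * nrm A B y = CQ * (P' * nrm A B (Q * y))"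
    using Q_nz(2) by (simp only: mult_left_cancel not_False_eq_True)
  then show ?thesis by (simp only: P'_def mult.assoc)
qed

text \<open>Since \<open>J\<close> is symmetric, the weight in \<open>x\<close> is also the natural
  weight in the index \<open>y\<close>; with it \<open>nrm_rec\<close> becomes invariance under
  scaling of \<open>y\<close> by \<open>Q\<close>.\<close>

definition nrmw :: "complex \<Rightarrow> complex \<Rightarrow> real \<Rightarrow> complex" where
  "nrmw A B y = of_real \<bar>y\<bar> * weight A B y * nrm A B y"

lemma nrmw_scale:
  assumes A: "regular A" and B: "regular B" and AB: "A * B = of_real (Q powi p)" and y: "y \<in> I_q Q"
  shows "nrmw A B (Q * y) = nrmw A B y"
proof -
  have "1 + complex_of_real y \<noteq> 0"
  proof -
    have "1 + y \<noteq> 0" using I_q_gt[OF y] by simp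
    then have "complex_of_real (1 + y) \<noteq> 0" by (simp only: of_real_eq_0_iff not_False_eq_True)
    then show ?thesis by simp
  qed
  moreover have "(1 + of_real y) * nrmw A B (Q * y) = (1 + of_real y) * nrmw A B y"
  proof -
    have "(1 + of_real y) * nrmw A B (Q * y)
      = CQ * of_real \<bar>y\<bar> * ((1 + of_real y) * weight A B (Q * y)) * nrm A B (Q * y)"
      using Q_pos by (simp add: nrmw_def abs_mult mult_ac)
    also have "\<dots> = of_real \<bar>y\<bar> * weight A B y * (CQ * ((1 - of_real y * A) * (1 - of_real y * B)) * nrm A B (Q * y))"
      unfolding weight_rec[OF A B y, symmetric] by (simp only: mult_ac)
    also have "\<dots> = (1 + of_real y) * nrmw A B y"
      unfolding nrm_rec[OF A B AB y] nrmw_def by (simp only: mult_ac)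
    finally show ?thesis .
  qed
  ultimately show ?thesis by simp
qed

text \<open>Scaling by \<open>Q\<close> connects all positive points with 1 and all negative points
  with \<open>- Q\<close>, but never points of different sign.\<close>

lemma nrmw_const:
  assumes A: "regular A" and B: "regular B" and AB: "A * B = of_real (Q powi p)" and y: "y \<in> I_q Q"
  shows "nrmw A B y = nrmw A B (if y > 0 then 1 else - Q)"
proof -
  have Qn: "t * Q ^ n \<in> I_q Q \<and> nrmw A B (t * Q ^ n) = nrmw A B t" if "t \<in> I_q Q" for t n
  proof (induction n)
    case 0
    show ?case using that by simp
  next
    case (Suc n)
    have eq: "t * Q ^ Suc n = Q * (t * Q ^ n)" by simp
    show ?case unfolding eq using nrmw_scale[OF A B AB, of "t * Q ^ n"] Suc I_q_scale by simp
  qed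
  show ?thesis
    using y
  proof (cases rule: I_q_cases)
    case (small n)
    then show ?thesis using Qn[of 1 n] I_q_intros(2)[of 0] Q_pos by simp
  next
    case (large n)
    have "y * Q ^ Suc n = 1"
      unfolding large power_mult_distrib[symmetric] using Q_pos by simp
    moreover have "y > 0"
      unfolding large using Q_pos by (intro zero_less_power) simp
    ultimately show ?thesis using Qn[OF y, of "Suc n"] by simp
  next
    case (neg n)
    have "\<not> y > 0" using neg zero_less_power[OF Q_pos, of "Suc n"] by linarith
    moreover have "y = - Q * Q ^ n" using neg by simp
    ultimately show ?thesis using Qn[OF I_q_intros(5), of n] by simp
  qed
qed

subsection \<open>The constants on the two half-lattices agree\<close>

lemma of_real_norm_sq: "(complex_of_real (norm z))\<^sup>2 = z * cnj z"
  by (metis complex_norm_square of_real_power)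

lemma cnj_qpoch: "cnj (qpoch a CQ n) = qpoch (cnj a) CQ n"
  by (simp add: qpoch_def)

lemma cnj_pinf: "cnj (pinf a) = pinf (cnj a)"
proof -
  have "(\<lambda>n. cnj (qpoch a CQ n)) \<longlonglongrightarrow> cnj (pinf a)"
    using qpoch_LIMSEQ[of a] by (intro tendsto_cnj) simp
  then show ?thesis
    using qpoch_LIMSEQ[of "cnj a"] by (simp add: cnj_qpoch LIMSEQ_unique)
qed

lemma cnj_jj: "cnj (jj A B y x) = jj (cnj A) (cnj B) y x"
proof -
  have "cnj (phi_term a b c d z n) = phi_term (cnj a) (cnj b) (cnj c) (cnj d) (cnj z) n" for a b c d z n
    by (simp add: phi_term_def cnj_qpoch cnj_pinf)
  then have "cnj (phi22_reg a b c d CQ z) = phi22_reg (cnj a) (cnj b) (cnj c) (cnj d) CQ (cnj z)" for a b c d z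
    using phi22_sums[of a b c d z] phi22_sums[of "cnj a" "cnj b" "cnj c" "cnj d" "cnj z"]
    by (simp add: sums_cnj[of "phi_term a b c d z", symmetric] sums_unique2)
  then show ?thesis by (simp add: J_def)
qed

lemma pinf_uminus_I_q: "x \<in> I_q Q \<Longrightarrow> pinf (- of_real x) = of_real (qpoch_inf (- x) Q)"
  by (simp add: of_real_qpoch_inf)

lemma qpoch_inf_I_q_pos: "x \<in> I_q Q \<Longrightarrow> qpoch_inf (- x) Q > 0"
  using I_q_gt[of x] by (intro qpoch_inf_pos) simp

context
  fixes B :: complex and p :: int
  assumes B: "regular B" "regular (cnj B)" "cnj B * B = of_real (Q powi p)"
begin

text \<open>For \<open>A = cnj B\<close>, which is the case
  \<open>\<bar>\<lambda>\<bar> = 1\<close>, the two denominators of the weight are conjugate, and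
  the numerator is positive because lattice points exceed -1.\<close>

definition W :: "real \<Rightarrow> real" where
  "W x = \<bar>x\<bar> * (qpoch_inf (- x) Q / (norm (pinf (of_real x * B)))\<^sup>2)"

lemma W_eq: "x \<in> I_q Q \<Longrightarrow> of_real (W x) = of_real \<bar>x\<bar> * weight (cnj B) B x"
proof -
  assume x: "x \<in> I_q Q"
  have "pinf (of_real x * cnj B) = cnj (pinf (of_real x * B))"
    by (simp add: cnj_pinf)
  then show ?thesis
    by (simp add: W_def weight_def pinf_uminus_I_q[OF x] of_real_norm_sq mult.commute)
qed

lemma W_pos: "x \<in> I_q Q \<Longrightarrow> W x > 0"
  using qpoch_inf_I_q_pos[of x] regular_nz(2)[OF B(1), of x] I_q_nz[of x]
  by (simp add: W_def)

definition j :: "real \<Rightarrow> real \<Rightarrow> complex" where "j y x = jj (cnj B) B y x"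

lemma j_commute: "j y x = j x y"
  unfolding j_def by (rule jj_commute)

lemma cnj_j: "cnj (j y x) = jj B (cnj B) y x"
  by (simp add: j_def cnj_jj)

lemma j_orth:
  assumes "y \<in> I_q Q" "y' \<in> I_q Q" "y \<noteq> y'"
  shows "((\<lambda>x. of_real (W x) * (j y x * cnj (j y' x))) has_sum 0) (I_q Q)"
  using orthogonality_has_sum[OF B(2,1,3) assms]
  by (rule has_sum_cong[THEN iffD1, rotated]) (simp add: W_eq j_def cnj_jj)

definition n2 :: "real \<Rightarrow> real" where "n2 y = Re (nrm (cnj B) B y)"

lemma n2_has_sum:
  assumes "y \<in> I_q Q"
  shows "((\<lambda>x. W x * (norm (j y x))\<^sup>2) has_sum n2 y) (I_q Q)" "nrm (cnj B) B y = of_real (n2 y)"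
proof -
  have *: "of_real \<bar>x\<bar> * weight (cnj B) B x * (jj (cnj B) B y x * jj B (cnj B) y x)
      = of_real (W x * (norm (j y x))\<^sup>2)" if "x \<in> I_q Q" for x
    using W_eq[OF that] cnj_j[of y x] by (simp add: j_def of_real_norm_sq)
  have h: "((\<lambda>x. complex_of_real (W x * (norm (j y x))\<^sup>2)) has_sum nrm (cnj B) B y) (I_q Q)"
    using nrm_has_sum[OF B(2,1,3) assms] * by (rule has_sum_cong[THEN iffD1, rotated])
  from has_sum_Re[OF this] show 1: "((\<lambda>x. W x * (norm (j y x))\<^sup>2) has_sum n2 y) (I_q Q)"
    by (simp add: n2_def)
  from has_sum_unique[OF h has_sum_of_real[OF 1]] show "nrm (cnj B) B y = of_real (n2 y)" .
qed

lemma n2_pos: "y \<in> I_q Q \<Longrightarrow> n2 y > 0"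
proof -
  assume y: "y \<in> I_q Q"
  have "j y (- Q) = pinf (- (CQ * cnj B)) * pinf (- (CQ * B))"
    unfolding j_commute[of y] by (simp add: j_def J_minus_Q)
  then have "j y (- Q) \<noteq> 0"
    using regular_nz(2)[OF B(1), of "- Q"] regular_nz(2)[OF B(2), of "- Q"] by simp
  then have "0 < W (- Q) * (norm (j y (- Q)))\<^sup>2"
    using W_pos[of "- Q"] by simp
  also have "\<dots> \<le> n2 y"
  proof (rule has_sum_mono2[OF has_sum_finite n2_has_sum(1)[OF y], of "{- Q}", simplified])
    show "\<And>x. x \<in> I_q Q \<and> x \<noteq> - Q \<Longrightarrow> 0 \<le> W x * (norm (j y x))\<^sup>2"
      by (simp add: W_pos less_imp_le)
  qed
  finally show ?thesis .
qed

text \<open>\<open>g\<close> is the projection of the point mass at \<open>x0\<close>, divided by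
  \<open>W x0\<close>, onto the span of the functions with index in \<open>F\<close>. Its value at
  \<open>x0\<close> and its squared norm are both \<open>G\<close>, so keeping only the summand at
  \<open>x0\<close> of the norm gives \<open>W x0 * G\<^sup>2 \<le> G\<close>.\<close>

lemma bessel:
  assumes F: "finite F" "F \<subseteq> I_q Q" and x0: "x0 \<in> I_q Q"
  shows "W x0 * (\<Sum>y\<in>F. (norm (j y x0))\<^sup>2 / n2 y) \<le> 1"
proof -
  define c where "c = (\<lambda>y. cnj (j y x0) / of_real (n2 y))"
  define g where "g = (\<lambda>x. \<Sum>y\<in>F. c y * j y x)"
  define G where "G = (\<Sum>y\<in>F. (norm (j y x0))\<^sup>2 / n2 y)"
  have n2: "n2 y > 0" if "y \<in> F" for y using that F n2_pos by blast
  have G0: "G \<ge> 0" unfolding G_def using n2 by (intro sum_nonneg) (simp add: less_imp_le)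
  have gx0: "g x0 = of_real G"
    unfolding g_def c_def G_def of_real_sum
    by (intro sum.cong) (simp_all add: of_real_norm_sq mult.commute)
  have inner: "((\<lambda>x. of_real (W x) * (j y x * cnj (j y' x))) has_sum (if y = y' then of_real (n2 y) else 0)) (I_q Q)"
    if "y \<in> F" "y' \<in> F" for y y'
  proof (cases "y = y'")
    case True
    have "complex_of_real (W x * (norm (j y x))\<^sup>2) = of_real (W x) * (j y x * cnj (j y x))" for x
      by (simp add: of_real_norm_sq)
    moreover have "((\<lambda>x. complex_of_real (W x * (norm (j y x))\<^sup>2)) has_sum of_real (n2 y)) (I_q Q)"
      using that F by (intro has_sum_of_real n2_has_sum(1)) auto
    ultimately show ?thesis using True by (simp only: if_True simp_thms)
  next
    case False
    then show ?thesis using j_orth[of y y'] that F by auto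
  qed
  have "((\<lambda>x. \<Sum>y\<in>F. \<Sum>y'\<in>F. c y * cnj (c y') * (of_real (W x) * (j y x * cnj (j y' x))))
      has_sum (\<Sum>y\<in>F. \<Sum>y'\<in>F. c y * cnj (c y') * (if y = y' then of_real (n2 y) else 0))) (I_q Q)"
    by (intro has_sum_sum has_sum_cmult_right inner)
  moreover have "(\<Sum>y\<in>F. \<Sum>y'\<in>F. c y * cnj (c y') * (of_real (W x) * (j y x * cnj (j y' x))))
      = of_real (W x * (norm (g x))\<^sup>2)" for x
  proof -
    have "complex_of_real ((norm (g x))\<^sup>2) = (\<Sum>y\<in>F. \<Sum>y'\<in>F. (c y * j y x) * (cnj (c y') * cnj (j y' x)))"
      unfolding complex_norm_square g_def by (simp only: cnj_sum complex_cnj_mult sum_product)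
    then show ?thesis
      unfolding of_real_mult sum_distrib_left
      by (simp only: sum_distrib_left) (intro sum.cong refl, simp only: mult_ac)
  qed
  moreover have "(\<Sum>y\<in>F. \<Sum>y'\<in>F. c y * cnj (c y') * (if y = y' then of_real (n2 y) else 0)) = of_real G"
  proof -
    have "(\<Sum>y'\<in>F. c y * cnj (c y') * (if y = y' then of_real (n2 y) else 0)) = of_real ((norm (j y x0))\<^sup>2 / n2 y)"
      if "y \<in> F" for y
    proof -
      have "(\<Sum>y'\<in>F. c y * cnj (c y') * (if y = y' then complex_of_real (n2 y) else 0))
          = (\<Sum>y'\<in>F. if y' = y then c y * cnj (c y) * of_real (n2 y) else 0)"
        by (intro sum.cong) auto
      also have "\<dots> = c y * cnj (c y) * of_real (n2 y)"
        using F(1) that by simp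
      also have "\<dots> = of_real ((norm (j y x0))\<^sup>2 / n2 y)"
        using n2[OF that] by (simp add: c_def of_real_norm_sq field_simps)
      finally show ?thesis .
    qed
    then show ?thesis unfolding G_def of_real_sum by (intro sum.cong) auto
  qed
  ultimately have "((\<lambda>x. complex_of_real (W x * (norm (g x))\<^sup>2)) has_sum of_real G) (I_q Q)"
    by simp
  from has_sum_Re[OF this] have hs: "((\<lambda>x. W x * (norm (g x))\<^sup>2) has_sum G) (I_q Q)"
    by simp
  have "W x0 * (norm (g x0))\<^sup>2 \<le> G"
  proof (rule has_sum_mono2[OF has_sum_finite hs, of "{x0}", simplified])
    show "\<And>x. x \<in> I_q Q \<and> x \<noteq> x0 \<Longrightarrow> 0 \<le> W x * (norm (g x))\<^sup>2"
      by (simp add: W_pos less_imp_le)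
  qed (use x0 in auto)
  then have "W x0 * G * G \<le> 1 * G"
    using gx0 G0 by (simp add: power2_eq_square mult_ac)
  then show ?thesis
    using G0 unfolding G_def[symmetric] by (cases "G = 0") (auto simp: mult_le_cancel_right)
qed

lemma nrmw_eq: "y \<in> I_q Q \<Longrightarrow> nrmw (cnj B) B y = of_real (W y * n2 y)"
  using W_eq[of y] n2_has_sum(2)[of y] by (simp add: nrmw_def)

text \<open>The row sums equal the column sums by symmetry, so that two different values of the norms
  would violate Bessel's inequality.\<close>

lemma not_less_nrmw:
  assumes xy: "x0 \<in> I_q Q" "y0 \<in> I_q Q" and nz: "j y0 x0 \<noteq> 0"
    and two: "\<And>y. y \<in> I_q Q \<Longrightarrow> W y * n2 y \<in> {W x0 * n2 x0, W y0 * n2 y0}"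
  shows "\<not> W y0 * n2 y0 < W x0 * n2 x0"
proof
  define k where "k = W x0 * n2 x0"
  define l where "l = W y0 * n2 y0"
  assume lk: "W y0 * n2 y0 < W x0 * n2 x0"
  have pos: "k > 0" "l > 0" using xy W_pos n2_pos by (auto simp: k_def l_def)
  \<comment> \<open>The amount by which the term at \<open>y0\<close> in Bessel's sum exceeds the
    value it would have with the constant \<open>k\<close> in place of \<open>l\<close>.\<close>
  define \<delta> where "\<delta> = W y0 * (norm (j y0 x0))\<^sup>2 * (1 / l - 1 / k)"
  have "1 / k < 1 / l" using lk pos by (simp add: k_def l_def divide_strict_left_mono)
  then have \<delta>: "\<delta> > 0" using W_pos[OF xy(2)] nz by (simp add: \<delta>_def)
  have le: "(\<Sum>y\<in>F. W y * (norm (j x0 y))\<^sup>2) \<le> k * (1 / W x0 - \<delta>)" if F: "finite F" "F \<subseteq> I_q Q" for F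
  proof -
    define F' where "F' = insert y0 F"
    have F': "finite F'" "F' \<subseteq> I_q Q" "y0 \<in> F'" using F xy by (auto simp: F'_def)
    have nn: "0 \<le> W y * (norm (j x0 y))\<^sup>2" if "y \<in> I_q Q" for y
      using W_pos[OF that] by simp
    have "(\<Sum>y\<in>F. W y * (norm (j x0 y))\<^sup>2) \<le> (\<Sum>y\<in>F'. W y * (norm (j x0 y))\<^sup>2)"
      using F' nn by (intro sum_mono2) (auto simp: F'_def)
    also have "\<dots> = k * ((\<Sum>y\<in>F'. W y * (norm (j x0 y))\<^sup>2 / k + (if y = y0 then \<delta> else 0)) - \<delta>)"
      using F'(1,3) pos by (simp add: sum.distrib sum_divide_distrib[symmetric])
    also have "\<dots> \<le> k * ((\<Sum>y\<in>F'. (norm (j y x0))\<^sup>2 / n2 y) - \<delta>)"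
    proof (intro mult_left_mono diff_right_mono sum_mono)
      fix y assume y: "y \<in> F'"
      then have yI: "y \<in> I_q Q" using F' by auto
      have Wn: "W y > 0" "n2 y > 0" using W_pos n2_pos yI by auto
      have e: "(norm (j y x0))\<^sup>2 / n2 y = W y * (norm (j x0 y))\<^sup>2 / (W y * n2 y)"
        using Wn by (simp add: j_commute[of x0 y])
      show "W y * (norm (j x0 y))\<^sup>2 / k + (if y = y0 then \<delta> else 0) \<le> (norm (j y x0))\<^sup>2 / n2 y"
      proof (cases "y = y0")
        case True
        then show ?thesis
          unfolding e by (simp add: \<delta>_def l_def[symmetric] j_commute[of x0 y0] field_simps)
      next
        case False
        have "1 / k \<le> 1 / (W y * n2 y)"
          using two[OF yI] lk pos \<open>1 / k < 1 / l\<close> by (auto simp: k_def l_def)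
        from mult_left_mono[OF this nn[OF yI]] show ?thesis unfolding e using False by simp
      qed
    qed (use pos in auto)
    also have "\<dots> \<le> k * (1 / W x0 - \<delta>)"
      using bessel[OF F'(1,2) xy(1)] W_pos[OF xy(1)] pos
      by (intro mult_left_mono diff_right_mono) (auto simp: field_simps)
    finally show ?thesis .
  qed
  \<comment> \<open>The finite sums in \<open>le\<close> run over the index in Bessel's inequality;
    read with the roles of index and variable exchanged, they exhaust the norm \<open>n2 x0\<close>,
    which equals \<open>k / W x0\<close>.\<close>
  have "n2 x0 \<le> k * (1 / W x0 - \<delta>)"
    by (rule has_sum_le_finite_sums[OF n2_has_sum(1)[OF xy(1)] le])
  also have "\<dots> = n2 x0 - k * \<delta>"
    using W_pos[OF xy(1)] by (simp add: k_def right_diff_distrib)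
  also have "\<dots> < n2 x0" using pos \<delta> by simp
  finally show False by simp
qed

text \<open>By \<open>J_minus_Q\<close> the entry of \<open>j\<close> at \<open>1\<close> and
  \<open>- Q\<close> is nonzero, so \<open>not_less_nrmw\<close> applies between the two signs in
  either direction.\<close>

lemma nrmw_one_eq: "nrmw (cnj B) B 1 = nrmw (cnj B) B (- Q)"
proof -
  have I: "1 \<in> I_q Q" "- Q \<in> I_q Q" using I_q_intros(2)[of 0] by auto
  have "j 1 (- Q) = pinf (- (CQ * cnj B)) * pinf (- (CQ * B))"
    unfolding j_commute[of 1] by (simp add: j_def J_minus_Q)
  then have nz: "j 1 (- Q) \<noteq> 0" "j (- Q) 1 \<noteq> 0"
    using regular_nz(2)[OF B(1), of "- Q"] regular_nz(2)[OF B(2), of "- Q"] j_commute[of 1 "- Q"] by auto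
  have two: "W y * n2 y \<in> {W 1 * n2 1, W (- Q) * n2 (- Q)}" if "y \<in> I_q Q" for y
  proof -
    have "complex_of_real (W y * n2 y) = of_real (W (if y > 0 then 1 else - Q) * n2 (if y > 0 then 1 else - Q))"
      using nrmw_const[OF B(2,1,3) that] nrmw_eq[OF that] nrmw_eq[OF I(1)] nrmw_eq[OF I(2)]
      by (simp split: if_splits)
    then show ?thesis unfolding of_real_eq_iff by (simp split: if_splits)
  qed
  have "\<not> W 1 * n2 1 < W (- Q) * n2 (- Q)"
    by (rule not_less_nrmw[OF I(2,1) nz(1)]) (use two in blast)
  moreover have "\<not> W (- Q) * n2 (- Q) < W 1 * n2 1"
    by (rule not_less_nrmw[OF I nz(2)]) (use two in blast)
  ultimately show ?thesis
    using nrmw_eq[OF I(1)] nrmw_eq[OF I(2)] by simp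
qed

end

subsection \<open>Analytic continuation in \<open>B\<close>\<close>

text \<open>Jacobi's theta function without the factor \<open>pinf CQ\<close>. Its zeros are the
  integral powers of \<open>CQ\<close>, which lets it clear the poles coming from the
  lattice.\<close>

definition theta :: "complex \<Rightarrow> complex" where
  "theta B = pinf (CQ * B) * pinf (1 / B)"

lemma CQ_powi_nz: "CQ powi n \<noteq> 0"
  using Q_nz by simp

lemma pinf_powi_rec: "pinf (CQ powi n * B) = (1 - CQ powi n * B) * pinf (CQ powi (n + 1) * B)"
  "pinf (CQ powi n / B) = (1 - CQ powi n / B) * pinf (CQ powi (n + 1) / B)"
  using pinf_rec[of "CQ powi n * B"] pinf_rec[of "CQ powi n / B"] Q_nz
  by (simp_all add: power_int_add mult_ac)

text \<open>Quasi-periodicity, arranged so that the pair of products can be moved to any position: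
  \<open>n\<close> is chosen to make a prescribed denominator one of the two factors.\<close>

lemma theta_shift:
  assumes B: "B \<noteq> 0"
  shows "theta B = (- B) powi (- n) * CQ powi (n * (n - 1) div 2) * (pinf (CQ powi (1 - n) * B) * pinf (CQ powi n / B))"
proof (induction n rule: int_induct[where k = 0])
  case base
  then show ?case by (simp add: theta_def)
next
  case (step1 n)
  have nz: "CQ powi n \<noteq> 0" "- B \<noteq> 0" by (use B Q_nz in auto)
  have e: "(n + 1) * (n + 1 - 1) div 2 = n * (n - 1) div 2 + n"
  proof -
    have "(n + 1) * (n + 1 - 1) = n * (n - 1) + n * 2" by (simp add: algebra_simps)
    then show ?thesis by simp
  qed
  have "pinf (CQ powi (1 - (n + 1)) * B) * pinf (CQ powi (n + 1) / B) * (1 - CQ powi n / B)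
      = (1 - CQ powi (- n) * B) * (pinf (CQ powi (1 - n) * B) * pinf (CQ powi n / B))"
    using pinf_powi_rec(1)[of "- n" B] pinf_powi_rec(2)[of n B] by (simp add: mult_ac)
  moreover have "1 - CQ powi (- n) * B = (- B) * CQ powi (- n) * (1 - CQ powi n / B)"
    using nz B by (simp add: power_int_minus field_simps)
  ultimately have 1: "pinf (CQ powi (1 - (n + 1)) * B) * pinf (CQ powi (n + 1) / B) * (1 - CQ powi n / B)
      = (- B) * CQ powi (- n) * (pinf (CQ powi (1 - n) * B) * pinf (CQ powi n / B)) * (1 - CQ powi n / B)"
    by (simp only: mult_ac)
  show ?case
  proof (cases "CQ powi n / B = 1")
    case False
    then have 4: "pinf (CQ powi (1 - (n + 1)) * B) * pinf (CQ powi (n + 1) / B)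
      = (- B) * CQ powi (- n) * (pinf (CQ powi (1 - n) * B) * pinf (CQ powi n / B))"
      using 1 by (subst (asm) mult_right_cancel) auto
    have 5: "(- B) powi (- (n + 1)) * (- B) = (- B) powi (- n)"
      using power_int_add_1[OF disjI1[OF nz(2)], of "- (n + 1)"] by simp
    have 6: "CQ powi ((n + 1) * (n + 1 - 1) div 2) * CQ powi (- n) = CQ powi (n * (n - 1) div 2)"
      unfolding e power_int_add[OF Q_nz(2)[THEN disjI1]] using nz by (simp add: power_int_minus)
    show ?thesis
      unfolding step1(2) 4 5[symmetric] 6[symmetric] by (simp only: mult_ac)
  next
    \<comment> \<open>Here the factor to be cancelled is 0, but then both sides vanish.\<close>
    case True
    then have Bn: "B = CQ powi n" using B by (simp add: field_simps)
    have "pinf (CQ powi n / B) = 0" "pinf (CQ powi (1 - (n + 1)) * B) = 0"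
      using pinf_rec[of "CQ powi n / B"] pinf_rec[of "CQ powi (1 - (n + 1)) * B"] True Bn nz
      by (simp_all add: power_int_minus)
    then show ?thesis using step1(2) by simp
  qed
next
  case (step2 n)
  have nz: "CQ powi (n - 1) \<noteq> 0" "- B \<noteq> 0" by (use B Q_nz in auto)
  have e: "n * (n - 1) div 2 = (n - 1) * (n - 1 - 1) div 2 + (n - 1)"
  proof -
    have "n * (n - 1) = (n - 1) * (n - 1 - 1) + (n - 1) * 2" by (simp add: algebra_simps)
    then show ?thesis by simp
  qed
  have 1: "pinf (CQ powi (1 - n) * B) = (1 - CQ powi (1 - n) * B) * pinf (CQ powi (1 - (n - 1)) * B)"
    using pinf_powi_rec(1)[of "1 - n" B] by (simp add: algebra_simps)
  have 2: "pinf (CQ powi (n - 1) / B) = (1 - CQ powi (n - 1) / B) * pinf (CQ powi n / B)"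
    using pinf_powi_rec(2)[of "n - 1" B] by simp
  have "CQ powi (1 - n) = inverse (CQ powi (n - 1))"
    using power_int_minus[of CQ "n - 1"] by simp
  then have 3: "1 - CQ powi (1 - n) * B = (- B) * inverse (CQ powi (n - 1)) * (1 - CQ powi (n - 1) / B)"
    using nz B by (simp add: field_simps)
  have 4: "pinf (CQ powi (1 - n) * B) * pinf (CQ powi n / B)
     = (- B) * inverse (CQ powi (n - 1)) * (pinf (CQ powi (1 - (n - 1)) * B) * pinf (CQ powi (n - 1) / B))"
    unfolding 1 2 3 by (simp only: mult_ac)
  have 5: "(- B) powi (- n) * (- B) = (- B) powi (- (n - 1))"
    using power_int_add_1[OF disjI1[OF nz(2)], of "- n"] by (simp add: algebra_simps)
  have 6: "CQ powi (n * (n - 1) div 2) * inverse (CQ powi (n - 1)) = CQ powi ((n - 1) * (n - 1 - 1) div 2)"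
    unfolding e power_int_add[OF Q_nz(2)[THEN disjI1]] using nz by simp
  show ?case
    unfolding step2(2) 4 5[symmetric] 6[symmetric] by (simp only: mult_ac)
qed

text \<open>Both signs are excluded because the lattice has points of both signs and
  \<open>s_formula\<close> has a denominator \<open>theta (- B)\<close>. The condition is invariant
  under \<open>B\<close> to \<open>CQ powi p / B\<close>, so it covers \<open>A\<close> as
  well.\<close>

definition generic :: "complex \<Rightarrow> bool" where
  "generic B \<longleftrightarrow> B \<noteq> 0 \<and> (\<forall>n::int. B \<noteq> CQ powi n \<and> B \<noteq> - (CQ powi n))"

lemma generic_neq: "generic B \<Longrightarrow> s = 1 \<or> s = - 1 \<Longrightarrow> B \<noteq> s * CQ powi n"
  unfolding generic_def by (elim disjE) simp_all

lemma I_q_powi: "x \<in> I_q Q \<Longrightarrow> \<exists>n. x = Q powi n \<or> x = - (Q powi n)"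
  unfolding I_q_def by (auto intro: exI[of _ "int _"])

lemma generic_pinf_nz:
  assumes "generic B" "s = 1 \<or> s = - 1"
  shows "pinf (s * CQ powi n * B) \<noteq> 0" "pinf (s * CQ powi n / B) \<noteq> 0"
proof -
  have nzn: "CQ powi n \<noteq> 0" for n by (rule CQ_powi_nz)
  have B: "B \<noteq> 0" using assms(1) by (simp add: generic_def)
  have ss: "s * s = 1" using assms(2) by auto
  have "s * CQ powi n * B * CQ ^ k \<noteq> 1" for k
  proof
    assume "s * CQ powi n * B * CQ ^ k = 1"
    then have sW: "s * (B * (CQ powi n * CQ ^ k)) = 1" by (simp only: mult_ac)
    have "B * (CQ powi n * CQ ^ k) = s * (s * (B * (CQ powi n * CQ ^ k)))"
      unfolding mult.assoc[symmetric, of s s] ss by simp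
    then have "B * (CQ powi n * CQ ^ k) = s" unfolding sW by simp
    also have "CQ powi n * CQ ^ k = CQ powi (n + int k)"
      using Q_nz by (simp add: power_int_add)
    finally have BX: "B * CQ powi (n + int k) = s" .
    have "B = B * CQ powi (n + int k) * inverse (CQ powi (n + int k))"
      using nzn[of "n + int k"] by (simp only: mult.assoc right_inverse not_False_eq_True mult_1_right)
    then have "B = s * CQ powi (- (n + int k))" unfolding BX power_int_minus .
    then show False using generic_neq[OF assms] by blast
  qed
  then show "pinf (s * CQ powi n * B) \<noteq> 0" by (simp add: qpoch_inf_eq_0_iff)
  have "s * CQ powi n / B * CQ ^ k \<noteq> 1" for k
  proof
    assume "s * CQ powi n / B * CQ ^ k = 1"
    then have "B = s * (CQ powi n * CQ ^ k)" using B by (simp add: field_simps)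
    also have "CQ powi n * CQ ^ k = CQ powi (n + int k)"
      using Q_nz by (simp add: power_int_add)
    finally show False using generic_neq[OF assms] by blast
  qed
  then show "pinf (s * CQ powi n / B) \<noteq> 0" using B by (simp add: qpoch_inf_eq_0_iff)
qed

lemma generic_regular:
  assumes "generic B"
  shows "regular B" "regular (CQ powi p / B)"
proof -
  have "pinf (of_real x * B) \<noteq> 0 \<and> pinf (of_real x * (CQ powi p / B)) \<noteq> 0" if x: "x \<in> I_q Q" for x
  proof -
    obtain n where "x = Q powi n \<or> x = - (Q powi n)" using I_q_powi[OF x] ..
    then have "\<exists>s. (s = 1 \<or> s = - 1) \<and> complex_of_real x = s * CQ powi n"
      by (elim disjE) (auto intro: exI[of _ 1] exI[of _ "- 1"])
    then obtain s where s: "s = 1 \<or> s = - 1" "complex_of_real x = s * CQ powi n" by blast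
    have e: "of_real x * (CQ powi p / B) = s * CQ powi (n + p) / B"
      using Q_nz by (simp add: s(2) power_int_add)
    show ?thesis
      unfolding e unfolding s(2)
      by (intro conjI generic_pinf_nz assms s(1))
  qed
  moreover have "B \<noteq> 0" using assms by (simp add: generic_def)
  moreover from this have "CQ powi p / B \<noteq> 0" using CQ_powi_nz[of p] by simp
  ultimately show "regular B" "regular (CQ powi p / B)"
    unfolding regular_def by blast+
qed

lemma generic_inverse: "generic B \<Longrightarrow> generic (CQ powi p / B)"
proof -
  assume g: "generic B"
  have B: "B \<noteq> 0" using g by (simp add: generic_def)
  have "CQ powi p / B \<noteq> s * CQ powi n" if "s = 1 \<or> s = - 1" for s n
  proof
    assume "CQ powi p / B = s * CQ powi n"
    then have "CQ powi p = s * (CQ powi n * B)" using B by (simp add: field_simps)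
    then have "s * CQ powi p = CQ powi n * B" using that by auto
    then have "B = s * (CQ powi p / CQ powi n)" using CQ_powi_nz[of n] by (simp add: field_simps)
    also have "CQ powi p / CQ powi n = CQ powi (p - n)"
      by (rule power_int_diff[OF disjI1[OF Q_nz(2)], symmetric])
    finally show False using generic_neq[OF g that] by blast
  qed
  from this[of 1] this[of "- 1"] show ?thesis
    using B CQ_powi_nz by (simp add: generic_def)
qed

lemma generic_theta_nz: "generic B \<Longrightarrow> theta B \<noteq> 0"
  using generic_pinf_nz[of B 1 1] generic_pinf_nz[of B 1 0] by (simp add: theta_def)

lemma generic_not_real: "Im B \<noteq> 0 \<Longrightarrow> generic B"
proof -
  assume "Im B \<noteq> 0"
  moreover have "Im (CQ powi n) = 0" for n
    by (simp flip: of_real_power_int)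
  ultimately show ?thesis
    unfolding generic_def by (metis neg_equal_0_iff_equal uminus_complex.sel(2) zero_complex.sel(2))
qed

lemma generic_norm:
  assumes "B \<noteq> 0" "\<And>n. norm B \<noteq> Q powi n"
  shows "generic B"
proof -
  have "norm (CQ powi n) = Q powi n" for n
    using Q_pos by (simp add: norm_power_int)
  then have "B \<noteq> CQ powi n \<and> B \<noteq> - (CQ powi n)" for n
    using assms(2)[of n] by (metis norm_minus_cancel)
  then show ?thesis using assms(1) by (simp add: generic_def)
qed

text \<open>Since exceptional points are isolated in the punctured plane, identities proved for
  generic \<open>B\<close> extend to them by continuity.\<close>

lemma eventually_generic:
  assumes "z \<noteq> 0"
  shows "eventually generic (at z)"
proof (cases "Im z = 0")
  case False
  have "eventually (\<lambda>w. Im w \<noteq> 0) (at z)"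
    by (rule tendsto_imp_eventually_ne[OF tendsto_Im[OF tendsto_ident_at] False])
  then show ?thesis by eventually_elim (rule generic_not_real)
next
  case True
  text \<open>The product below is entire in \<open>B\<close> and \<open>1 / B\<close> and vanishes at all points that are not generic.\<close>
  define f where "f = (\<lambda>B. theta B * theta (- B))"
  have hol: "f holomorphic_on - {0}"
    unfolding f_def theta_def by (intro holomorphic_intros) auto
  have "f \<i> \<noteq> 0"
    using generic_theta_nz[OF generic_not_real[of \<i>]] generic_theta_nz[OF generic_not_real[of "- \<i>"]]
    by (simp add: f_def)
  moreover have "connected (- {0 :: complex})"
    by (rule connected_punctured_universe) simp
  ultimately have ev1: "eventually (\<lambda>w. f w \<noteq> 0) (at z)"
    using non_zero_neighbour_alt[OF hol, of z \<i>] assms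
    by (simp add: open_Compl eventually_mono)
  have gen: "generic w" if "f w \<noteq> 0" "w \<noteq> 0" for w
  proof -
    have 0: "theta (CQ powi n) = 0" for n
    proof (cases "n \<ge> 0")
      case True
      then have "1 / CQ powi n * CQ ^ nat n = 1"
        using Q_nz by (simp add: power_int_def)
      then have "pinf (1 / CQ powi n) = 0"
        using qpoch_inf_eq_0_iff[of "1 / CQ powi n"] by auto
      then show ?thesis by (simp add: theta_def)
    next
      case False
      then have "CQ * CQ powi n * CQ ^ nat (- n - 1) = CQ powi (1 + n + (- n - 1))"
      proof -
        have "CQ ^ nat (- n - 1) = CQ powi (- n - 1)" using False by (simp add: power_int_def)
        then show ?thesis
          by (simp only: power_int_add[OF disjI1[OF Q_nz(2)]] power_int_1_right)
      qed
      then have "pinf (CQ * CQ powi n) = 0"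
        using qpoch_inf_eq_0_iff[of "CQ * CQ powi n"] by auto
      then show ?thesis by (simp add: theta_def)
    qed
    show ?thesis
      using that 0 by (auto simp: generic_def f_def)
  qed
  have "eventually (\<lambda>w. w \<noteq> 0) (at z)"
    by (rule tendsto_imp_eventually_ne[OF tendsto_ident_at assms])
  with ev1 show ?thesis by eventually_elim (rule gen)
qed

text \<open>Reading the product backwards trades \<open>w\<close> for \<open>1 / w\<close>; in
  \<open>core_extension\<close> factors in \<open>B\<close> become factors in \<open>1 / B\<close>
  that cancel a denominator.\<close>

lemma qpoch_reverse:
  assumes "w \<noteq> 0"
  shows "qpoch w CQ n = (\<Prod>i<n. - (w * CQ ^ i)) * qpoch (CQ powi (1 - int n) / w) CQ n"
proof -
  have "qpoch (CQ powi (1 - int n) / w) CQ n = (\<Prod>i<n. 1 - CQ powi (1 - int n) / w * CQ ^ (n - Suc i))"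
    unfolding qpoch_def by (rule prod.nat_diff_reindex[symmetric])
  also have "(\<Prod>i<n. - (w * CQ ^ i)) * \<dots> = (\<Prod>i<n. 1 - w * CQ ^ i)"
    unfolding prod.distrib[symmetric]
  proof (intro prod.cong refl)
    fix i assume "i \<in> {..<n}"
    then have e: "(1 - int n) + int (n - Suc i) = - int i" by (simp add: of_nat_diff)
    have "CQ powi (1 - int n) * CQ ^ (n - Suc i) = CQ powi ((1 - int n) + int (n - Suc i))"
      using Q_nz by (simp add: power_int_add)
    then have "CQ powi (1 - int n) / w * CQ ^ (n - Suc i) = 1 / (w * CQ ^ i)"
      unfolding e using Q_nz by (simp add: power_int_minus divide_inverse mult_ac)
    then show "- (w * CQ ^ i) * (1 - CQ powi (1 - int n) / w * CQ ^ (n - Suc i)) = 1 - w * CQ ^ i"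
      using assms Q_nz by (simp add: right_diff_distrib)
  qed
  finally show ?thesis by (simp add: qpoch_def)
qed

lemma pinf_powi_split: "pinf (CQ powi n / B) = qpoch (CQ powi n / B) CQ k * pinf (CQ powi (n + int k) / B)"
  "pinf (CQ powi n * B) = qpoch (CQ powi n * B) CQ k * pinf (CQ powi (n + int k) * B)"
  using pinf_split[of "CQ powi n / B" k] pinf_split[of "CQ powi n * B" k] Q_nz
  by (simp_all add: power_int_add mult_ac)

section \<open>Removal of the poles in \<open>B\<close>\<close>

text \<open>For fixed \<open>m\<close> the product \<open>A * B\<close> is fixed, so only one
  analytic variable remains. With \<open>p = 1 + m\<close> this involution is inversion of
  \<lambda>.\<close>

definition AA :: "int \<Rightarrow> complex \<Rightarrow> complex" where "AA p B = CQ powi p / B"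

lemma AA_mult: "B \<noteq> 0 \<Longrightarrow> AA p B * B = of_real (Q powi p)"
  by (simp add: AA_def)

lemma AA_holomorphic [holomorphic_intros]: "AA p holomorphic_on - {0}"
  unfolding AA_def by (intro holomorphic_intros) auto

text \<open>Up to a monomial in \<open>B\<close> this is \<open>s\<close> as a function of
  \<lambda>, see \<open>s_formula_eq\<close>. In a product of values at \<open>B\<close> and
  \<open>AA p B\<close> the denominators in \<open>x\<close> assemble to those of
  \<open>weight\<close>.\<close>

definition core :: "int \<Rightarrow> real \<Rightarrow> real \<Rightarrow> complex \<Rightarrow> complex" where
  "core p x y B = theta B * jj (AA p B) B y x / (pinf (of_real y * B) * pinf (of_real x * AA p B))"

lemma J_poly_holomorphic [holomorphic_intros]:
  "A holomorphic_on S \<Longrightarrow> B holomorphic_on S \<Longrightarrow> (\<lambda>s. J_poly (A s) (B s) l c) holomorphic_on S"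
proof (induction l rule: induct_nat_012)
  case 0
  then show ?case by simp
next
  case 1
  then show ?case unfolding J_poly.simps by (intro holomorphic_intros) auto
next
  case (ge2 l)
  then show ?case unfolding J_poly.simps by (intro holomorphic_intros) auto
qed

lemma I_q_cases2 [consumes 1, case_names pos neg]:
  assumes "x \<in> I_q Q"
  obtains n :: int where "x = Q powi n" | n where "x = - (Q ^ Suc n)"
  using assms
proof (cases rule: I_q_cases)
  case (small n)
  then show ?thesis using that(1)[of "int n"] by simp
next
  case (large n)
  then show ?thesis using that(1)[of "- int (Suc n)"] by (simp only: power_int_minus power_int_of_nat power_inverse)
next
  case (neg n)
  then show ?thesis by (rule that(2))
qed

text \<open>For a negative variable the polynomial form of \<open>J\<close> supplies products that
  cancel a denominator; for a positive one \<open>theta_shift\<close> makes the denominator a factor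
  of \<open>theta B\<close>. If both are positive, \<open>theta B\<close> absorbs one denominator
  exactly and the other up to finitely many factors; if these remain below,
  \<open>phi22_shift\<close> exhibits them in \<open>J\<close>.\<close>

lemma core_extension:
  assumes x: "x \<in> I_q Q" and y: "y \<in> I_q Q"
  shows "\<exists>H. H holomorphic_on - {0} \<and> (\<forall>B. generic B \<longrightarrow> H B = core p x y B)"
proof -
  have o: "open (- {0 :: complex})" by auto
  have B0: "B \<noteq> 0" if "generic B" for B using that by (simp add: generic_def)
  have reg: "regular (AA p B)" "regular B" if "generic B" for B
    using generic_regular[OF that] by (simp_all add: AA_def)
  have powi_hol: "(\<lambda>B. (- B) powi n) holomorphic_on - {0}" for n
    by (intro holomorphic_intros) auto
  have polyy: "jj (AA p B) B y x = pinf (of_real y * AA p B) * pinf (of_real y * B) * J_poly (AA p B) B l (of_real x)"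
    if "y = - (Q ^ Suc l)" "generic B" for l B
    using J_eq_J_poly[OF reg[OF that(2)], of "of_real x" l] that(1) by simp
  have polyx: "jj (AA p B) B y x = pinf (of_real x * AA p B) * pinf (of_real x * B) * J_poly (AA p B) B l (of_real y)"
    if "x = - (Q ^ Suc l)" "generic B" for l B
  proof -
    have e: "jj (AA p B) B y x = J (AA p B) B (of_real y) (- (CQ ^ Suc l))"
      using that(1) by (subst J_commute) simp
    show ?thesis unfolding e J_eq_J_poly[OF reg[OF that(2)]] using that(1) by simp
  qed
  have nz: "pinf (of_real y * B) \<noteq> 0" "pinf (of_real x * AA p B) \<noteq> 0" if "generic B" for B
    using regular_nz(2)[OF reg(2)[OF that] y] regular_nz(2)[OF reg(1)[OF that] x] .
  show ?thesis
    using x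
  proof (cases rule: I_q_cases2)
    case x: (pos k)
    have xA: "of_real x * AA p B = CQ powi (k + p) / B" for B
      using Q_nz by (simp add: x AA_def power_int_add)
    show ?thesis
      using y
    proof (cases rule: I_q_cases2)
      case y: (pos l)
      have yB: "of_real y * B = CQ powi l * B" for B by (simp add: y)
      define c where "c = (\<lambda>B. (- B) powi (- (1 - l)) * CQ powi ((1 - l) * (1 - l - 1) div 2))"
      have ch: "c holomorphic_on - {0}" unfolding c_def by (intro holomorphic_intros powi_hol)
      have th: "theta B = c B * (pinf (CQ powi l * B) * pinf (CQ powi (1 - l) / B))" if "B \<noteq> 0" for B
        using theta_shift[OF that, of "1 - l"] by (simp add: c_def)
      have core: "core p x y B = c B * (pinf (CQ powi (1 - l) / B) / pinf (CQ powi (k + p) / B)) * jj (AA p B) B y x"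
        if "generic B" for B
        using nz[OF that] unfolding core_def th[OF B0[OF that]] yB xA by (simp add: field_simps)
      show ?thesis
      proof (cases "k + l + p \<ge> 1")
        case True
        \<comment> \<open>The theta factor contains the whole denominator
          \<open>pinf (CQ powi (k + p) / B)\<close>, with \<open>N\<close> factors to spare.\<close>
        define N where "N = nat (k + l + p - 1)"
        have N: "1 - l + int N = k + p" using True by (simp add: N_def)
        define H where "H = (\<lambda>B. c B * qpoch (CQ powi (1 - l) / B) CQ N * jj (AA p B) B y x)"
        have "H holomorphic_on - {0}"
          unfolding H_def by (intro holomorphic_intros ch o; simp)
        moreover have "H B = core p x y B" if "generic B" for B
          using nz(2)[OF that] pinf_powi_split(1)[of "1 - l" B N] unfolding core[OF that] H_def N xA by simp
        ultimately show ?thesis by blast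
      next
        case False
        \<comment> \<open>Now the denominator has \<open>r\<close> factors in excess of the theta
          factor. The same \<open>r\<close> counts the vanishing terms of the series, so
          \<open>J\<close> carries \<open>qpoch (of_real y * B) CQ r\<close>, which read backwards
          is this excess up to a monomial.\<close>
        define r where "r = nat (1 - (k + l + p))"
        have r: "k + p + int r = 1 - l" using False by (simp add: r_def)
        define Z where "Z = (\<lambda>B. phi22_reg (of_real y * B * CQ ^ r) (of_real x * B * CQ ^ r) (CQ ^ Suc r)
            (- (CQ * B) * CQ ^ r) CQ (- (CQ * AA p B) * CQ ^ r))"
        define H where "H = (\<lambda>B. c B * (\<Prod>i<r. - (CQ powi l * B * CQ ^ i))
           * (qpoch (of_real x * B) CQ r * (CQ * AA p B) ^ r * CQ ^ (r choose 2) * Z B))"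
        have "H holomorphic_on - {0}"
          unfolding H_def Z_def by (intro holomorphic_intros ch o; simp)
        moreover have "H B = core p x y B" if g: "generic B" for B
        proof -
          have Bn: "B \<noteq> 0" by (rule B0[OF g])
          have "of_real x * of_real y * AA p B * B * CQ ^ r = CQ"
          proof -
            have "of_real x * of_real y * AA p B * B = CQ powi (k + l + p)"
              using Q_nz Bn by (simp add: x y AA_def power_int_add)
            then have "of_real x * of_real y * AA p B * B * CQ ^ r = CQ powi (k + l + p + int r)"
              using Q_nz by (simp add: power_int_add)
            also have "k + l + p + int r = 1" using r by simp
            finally show ?thesis by simp
          qed
          note J = phi22_shift[OF this, of "of_real y * B" "of_real x * B" "- (CQ * B)" "- (CQ * AA p B)", folded J_def, folded Z_def]
          have q: "qpoch (of_real y * B) CQ r = (\<Prod>i<r. - (CQ powi l * B * CQ ^ i)) * qpoch (CQ powi (k + p) / B) CQ r"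
          proof -
            have "k + p = (1 - int r) - l" using r by simp
            then have "CQ powi (1 - int r) / (CQ powi l * B) = CQ powi (k + p) / B"
              using Q_nz by (simp add: power_int_diff)
            then show ?thesis
              unfolding yB using qpoch_reverse[of "CQ powi l * B" r] Bn CQ_powi_nz[of l] by simp
          qed
          have pp: "pinf (CQ powi (k + p) / B) = qpoch (CQ powi (k + p) / B) CQ r * pinf (CQ powi (1 - l) / B)"
            using pinf_powi_split(1)[of "k + p" B r] unfolding r .
          have "qpoch (CQ powi (k + p) / B) CQ r \<noteq> 0" "pinf (CQ powi (1 - l) / B) \<noteq> 0"
            using nz(2)[OF g] unfolding xA pp by auto
          then show ?thesis
            unfolding core[OF g] J q H_def pp Z_def by (simp add: mult_ac)
        qed
        ultimately show ?thesis by blast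
      qed
    next
      case y: (neg l)
      define n where "n = k + p"
      define c where "c = (\<lambda>B. (- B) powi (- n) * CQ powi (n * (n - 1) div 2))"
      have ch: "c holomorphic_on - {0}" unfolding c_def by (intro holomorphic_intros powi_hol)
      define H where "H = (\<lambda>B. c B * pinf (CQ powi (1 - n) * B) * (pinf (of_real y * AA p B) * J_poly (AA p B) B l (of_real x)))"
      have "H holomorphic_on - {0}"
        unfolding H_def by (intro holomorphic_intros ch o; simp)
      moreover have "H B = core p x y B" if g: "generic B" for B
      proof -
        have "theta B = c B * pinf (CQ powi (1 - n) * B) * pinf (of_real x * AA p B)"
          using theta_shift[OF B0[OF g], of n] by (simp add: c_def xA n_def)
        then show ?thesis
          using nz[OF g] unfolding core_def polyy[OF y g] H_def by simp
      qed
      ultimately show ?thesis by blast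
    qed
  next
    case x: (neg k)
    show ?thesis
      using y
    proof (cases rule: I_q_cases2)
      case y: (pos l)
      define c where "c = (\<lambda>B. (- B) powi (- (1 - l)) * CQ powi ((1 - l) * (1 - l - 1) div 2))"
      have ch: "c holomorphic_on - {0}" unfolding c_def by (intro holomorphic_intros powi_hol)
      define H where "H = (\<lambda>B. c B * pinf (CQ powi (1 - l) / B) * (pinf (of_real x * B) * J_poly (AA p B) B k (of_real y)))"
      have "H holomorphic_on - {0}"
        unfolding H_def by (intro holomorphic_intros ch o; simp)
      moreover have "H B = core p x y B" if g: "generic B" for B
      proof -
        have "theta B = c B * pinf (CQ powi (1 - l) / B) * pinf (of_real y * B)"
          using theta_shift[OF B0[OF g], of "1 - l"] by (simp add: c_def y mult_ac)
        then show ?thesis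
          using nz[OF g] unfolding core_def polyx[OF x g] H_def by simp
      qed
      ultimately show ?thesis by blast
    next
      case y: (neg l)
      have tail: "pinf (of_real (- (Q ^ Suc a)) * C) = qpoch (of_real (- (Q ^ Suc a)) * C) CQ (b - a) * pinf (of_real (- (Q ^ Suc b)) * C)"
        if "a \<le> b" for a b C
        using pinf_split[of "of_real (- (Q ^ Suc a)) * C" "b - a"] that
        by (simp add: mult_ac flip: power_add)
      have th: "theta holomorphic_on - {0}" unfolding theta_def by (intro holomorphic_intros) auto
      show ?thesis
      \<comment> \<open>The polynomial form is taken in the variable of larger modulus: its products
        contain those of the other one, and the quotient is finite.\<close>
      proof (cases "l \<le> k")
        case True
        define H where "H = (\<lambda>B. theta B * qpoch (of_real y * AA p B) CQ (k - l) * J_poly (AA p B) B l (of_real x))"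
        have "H holomorphic_on - {0}"
          unfolding H_def by (intro holomorphic_intros th o; simp)
        moreover have "H B = core p x y B" if g: "generic B" for B
        proof -
          have t: "pinf (of_real y * AA p B) = qpoch (of_real y * AA p B) CQ (k - l) * pinf (of_real x * AA p B)"
            using tail[OF True, of "AA p B"] by (simp only: x y)
          show ?thesis
            using nz[OF g] unfolding core_def polyy[OF y g] H_def t by simp
        qed
        ultimately show ?thesis by blast
      next
        case False
        define H where "H = (\<lambda>B. theta B * qpoch (of_real x * B) CQ (l - k) * J_poly (AA p B) B k (of_real y))"
        have "H holomorphic_on - {0}"
          unfolding H_def by (intro holomorphic_intros th o; simp)
        moreover have "H B = core p x y B" if g: "generic B" for B
        proof -
          have t: "pinf (of_real x * B) = qpoch (of_real x * B) CQ (l - k) * pinf (of_real y * B)"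
            using tail[of k l B] False by (simp only: x y)
          show ?thesis
            using nz[OF g] unfolding core_def polyx[OF x g] H_def t by simp
        qed
        ultimately show ?thesis by blast
      qed
    qed
  qed
qed

text \<open>Any two choices agree on the punctured plane for lattice points \<open>x\<close> and
  \<open>y\<close>, because generic points are dense there and the extensions are
  continuous.\<close>

definition ext :: "int \<Rightarrow> real \<Rightarrow> real \<Rightarrow> complex \<Rightarrow> complex" where
  "ext p x y = (SOME H. H holomorphic_on - {0} \<and> (\<forall>B. generic B \<longrightarrow> H B = core p x y B))"

lemma ext:
  assumes "x \<in> I_q Q" "y \<in> I_q Q"
  shows "ext p x y holomorphic_on - {0}" "generic B \<Longrightarrow> ext p x y B = core p x y B"
  using someI_ex[OF core_extension[OF assms, of p]] unfolding ext_def by blast+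

section \<open>Locally uniform summability and analytic sums\<close>

text \<open>Among arguments of a given modulus each factor of the product is smallest in norm at the
  positive real one and largest at the negative real one.\<close>

lemma norm_pinf_bounds:
  "norm (pinf (of_real (norm w))) \<le> norm (pinf w)" "norm (pinf w) \<le> norm (pinf (- of_real (norm w)))"
proof -
  have lims: "(\<lambda>n. norm (qpoch v CQ n)) \<longlonglongrightarrow> norm (pinf v)" for v
    by (intro tendsto_norm qpoch_LIMSEQ[where ?'a = complex, simplified])
  have e: "norm (1 - complex_of_real (norm w) * CQ ^ k) = \<bar>1 - norm w * Q ^ k\<bar>"
    "norm (1 - (- complex_of_real (norm w)) * CQ ^ k) = 1 + norm w * Q ^ k" for k
  proof -
    have "1 - complex_of_real (norm w) * CQ ^ k = of_real (1 - norm w * Q ^ k)"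
      "1 - (- complex_of_real (norm w)) * CQ ^ k = of_real (1 + norm w * Q ^ k)" by simp_all
    moreover have "0 \<le> 1 + norm w * Q ^ k" using Q_pos by simp
    ultimately show "norm (1 - complex_of_real (norm w) * CQ ^ k) = \<bar>1 - norm w * Q ^ k\<bar>"
      "norm (1 - (- complex_of_real (norm w)) * CQ ^ k) = 1 + norm w * Q ^ k"
      by (simp_all only: norm_of_real abs_of_nonneg)
  qed
  have n: "norm (w * CQ ^ k) = norm w * Q ^ k" for k
    using Q_pos by (simp add: norm_mult norm_power)
  have 1: "\<bar>1 - norm w * Q ^ k\<bar> \<le> norm (1 - w * CQ ^ k)" for k
    using norm_triangle_ineq3[of 1 "w * CQ ^ k"] unfolding n by simp
  have 2: "norm (1 - w * CQ ^ k) \<le> 1 + norm w * Q ^ k" for k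
    using norm_triangle_ineq4[of 1 "w * CQ ^ k"] unfolding n by simp
  show "norm (pinf (of_real (norm w))) \<le> norm (pinf w)"
  proof (rule LIMSEQ_le[OF lims lims], intro exI allI impI)
    fix n show "norm (qpoch (of_real (norm w)) CQ n) \<le> norm (qpoch w CQ n)"
      unfolding qpoch_def prod_norm[symmetric] e using 1 by (intro prod_mono) auto
  qed
  show "norm (pinf w) \<le> norm (pinf (- of_real (norm w)))"
  proof (rule LIMSEQ_le[OF lims lims], intro exI allI impI)
    fix n show "norm (qpoch w CQ n) \<le> norm (qpoch (- of_real (norm w)) CQ n)"
      unfolding qpoch_def prod_norm[symmetric] e using 2 by (intro prod_mono) auto
  qed
qed

lemma I_q_abs: "x \<in> I_q Q \<Longrightarrow> \<bar>x\<bar> \<in> I_q Q"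
proof (elim I_q_cases2)
  fix n assume "x = Q powi n"
  then show ?thesis using Q_pos by simp
next
  fix n assume "x = - (Q ^ Suc n)"
  then have "\<bar>x\<bar> = Q ^ Suc n" using Q_pos by (simp del: power_Suc)
  then show ?thesis using I_q_intros(2)[of "Suc n"] by (simp only:)
qed

text \<open>The majorant depends on the parameters only through their moduli, hence is constant on
  circles; regularity of the moduli keeps its denominators nonzero.\<close>

lemma norm_weight_le:
  assumes "regular (of_real (norm A))" "regular (of_real (norm B))" "x \<in> I_q Q"
  shows "norm (weight A B x) \<le> norm (weight (of_real (norm A)) (of_real (norm B)) \<bar>x\<bar>)"
proof -
  have 1: "norm (pinf (- of_real x)) \<le> norm (pinf (- of_real \<bar>x\<bar>))"
    using norm_pinf_bounds(2)[of "- of_real x"] by simp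
  have 2: "0 < norm (pinf (of_real \<bar>x\<bar> * of_real (norm C)))"
    "norm (pinf (of_real \<bar>x\<bar> * of_real (norm C))) \<le> norm (pinf (of_real x * C))"
    if "regular (of_real (norm C))" for C
    using regular_nz(2)[OF that I_q_abs[OF assms(3)]] norm_pinf_bounds(1)[of "of_real x * C"]
    by (simp_all add: norm_mult)
  show ?thesis
    unfolding weight_def norm_divide norm_mult[of "pinf _"]
    using 1 2[OF assms(1)] 2[OF assms(2)] by (intro frac_le mult_mono) auto
qed

lemma I_q_abs_summable_abs:
  fixes f :: "real \<Rightarrow> complex"
  assumes "f abs_summable_on I_q Q"
  shows "(\<lambda>x. f \<bar>x\<bar>) abs_summable_on I_q Q"
proof (rule I_q_abs_summable)
  note s = abs_summable_I_q_sequences[OF assms]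
  have Qn: "\<bar>Q ^ n\<bar> = Q ^ n" "\<bar>inverse Q ^ n\<bar> = inverse Q ^ n" for n using Q_pos by simp_all
  show "summable (\<lambda>n. norm (f \<bar>Q ^ n\<bar>))" "summable (\<lambda>n. norm (f \<bar>inverse Q ^ Suc n\<bar>))"
    unfolding Qn by (rule s)+
  show "summable (\<lambda>n. norm (f \<bar>- (Q ^ Suc n)\<bar>))"
    unfolding abs_minus_cancel Qn using s(1) by (subst summable_Suc_iff)
qed

lemma AA_circle: "norm B = \<rho> \<Longrightarrow> norm (AA p B) = Q powi p / \<rho>"
  using Q_pos by (simp add: AA_def norm_divide norm_power_int)

lemma off_lattice_inverse:
  assumes "\<rho> > 0" "\<And>n. \<rho> \<noteq> Q powi n"
  shows "Q powi p / \<rho> \<noteq> Q powi n"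
proof
  assume "Q powi p / \<rho> = Q powi n"
  then have "\<rho> = Q powi p / Q powi n" using assms(1) Q_nz by (simp add: field_simps)
  also have "\<dots> = Q powi (p - n)" using Q_nz by (simp add: power_int_diff)
  finally show False using assms(2) by blast
qed

lemma off_lattice_regular:
  assumes "\<rho> > 0" "\<And>n. \<rho> \<noteq> Q powi n" "norm B = \<rho>"
  shows "generic B"
  using assms by (intro generic_norm) auto

text \<open>On a circle about 0 the moduli of \<open>B\<close> and \<open>AA p B\<close> are
  constant. If the radius is no integral power of \<open>Q\<close>, \<open>norm_weight_le\<close>
  gives a single majorant for the weight and \<open>J_tempered\<close> a single polynomial bound for
  \<open>J\<close>.\<close>

lemma circle_bound:
  assumes t: "t \<in> I_q Q" "t' \<in> I_q Q"
    and \<rho>: "\<rho> > 0" "\<And>n. \<rho> \<noteq> Q powi n"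
  shows "\<exists>M. M summable_on I_q Q \<and> (\<forall>x\<in>I_q Q. \<forall>B. norm B = \<rho> \<longrightarrow>
    norm (of_real \<bar>x\<bar> * weight (AA p B) B x * (jj (AA p B) B t x * jj B (AA p B) t' x)) \<le> M x)"
proof -
  define a where "a = Q powi p / \<rho>"
  have a: "a > 0" "\<And>n. a \<noteq> Q powi n"
    using \<rho>(1) Q_pos off_lattice_inverse[OF \<rho>] by (auto simp: a_def)
  define S where "S = {(AA p B, B) | B. norm B = \<rho>}"
  define S' where "S' = {(B, AA p B) | B. norm B = \<rho>}"
  have gB: "generic B" if "norm B = \<rho>" for B using off_lattice_regular[OF \<rho> that] .
  have S: "norm A \<le> max a \<rho> \<and> norm B \<le> max a \<rho> \<and> regular A \<and> regular B \<and> A * B = of_real (Q powi p)"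
    if "(A, B) \<in> S" for A B
    using that generic_regular[OF gB] AA_circle[of B \<rho> p] AA_mult[of B p] \<rho>(1)
    by (auto simp: S_def a_def AA_def[symmetric])
  have S': "norm A \<le> max a \<rho> \<and> norm B \<le> max a \<rho> \<and> regular A \<and> regular B \<and> A * B = of_real (Q powi p)"
    if "(A, B) \<in> S'" for A B
    using that S[of B A] by (auto simp: S_def S'_def mult.commute)
  have T: "tempered S (\<lambda>(A, B) x. jj A B t x)" "tempered S' (\<lambda>(A, B) x. jj A B t' x)"
    using J_tempered[of S, OF S t(1)] J_tempered[of S', OF S' t(2)] by blast+
  have "tempered {B. norm B = \<rho>} (\<lambda>B. jj (AA p B) B t)"
    using tempered_reindex[OF T(1), where h = "\<lambda>B. (AA p B, B)" and S' = "{B. norm B = \<rho>}"]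
    by (auto simp: S_def image_subset_iff)
  moreover have "tempered {B. norm B = \<rho>} (\<lambda>B. jj B (AA p B) t')"
    using tempered_reindex[OF T(2), where h = "\<lambda>B. (B, AA p B)" and S' = "{B. norm B = \<rho>}"]
    by (auto simp: S'_def image_subset_iff)
  ultimately have "tempered {B. norm B = \<rho>} (\<lambda>B x. jj (AA p B) B t x * jj B (AA p B) t' x)"
    by (rule tempered_mult)
  from temperedD[OF this] obtain C N where C: "C \<ge> 0" and
    CN: "\<And>B x. norm B = \<rho> \<Longrightarrow> x \<in> I_q Q \<Longrightarrow> norm (jj (AA p B) B t x * jj B (AA p B) t' x) \<le> C * max 1 \<bar>x\<bar> ^ N"
    by auto
  have reg: "regular (of_real a)" "regular (of_real \<rho>)"
    using generic_regular(1)[OF off_lattice_regular[OF a]] generic_regular(1)[OF off_lattice_regular[OF \<rho>]]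
      a(1) \<rho>(1) by auto
  define M where "M = (\<lambda>x. C * norm (of_real (\<bar>x\<bar> * max 1 \<bar>x\<bar> ^ N) * weight (of_real a) (of_real \<rho>) \<bar>x\<bar>))"
  have "M summable_on I_q Q"
    unfolding M_def
    using I_q_abs_summable_abs[OF weight_abs_summable[OF reg, of N]]
    by (intro summable_on_cmult_right) simp
  moreover have "norm (of_real \<bar>x\<bar> * weight (AA p B) B x * (jj (AA p B) B t x * jj B (AA p B) t' x)) \<le> M x"
    if x: "x \<in> I_q Q" and B: "norm B = \<rho>" for x B
  proof -
    have nA: "norm (AA p B) = a" using AA_circle[OF B] by (simp add: a_def)
    have w: "norm (weight (AA p B) B x) \<le> norm (weight (of_real a) (of_real \<rho>) \<bar>x\<bar>)"
      using norm_weight_le[of "AA p B" B x] reg x unfolding nA B by blast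
    have "norm (of_real \<bar>x\<bar> * weight (AA p B) B x * (jj (AA p B) B t x * jj B (AA p B) t' x))
      = \<bar>x\<bar> * norm (weight (AA p B) B x) * norm (jj (AA p B) B t x * jj B (AA p B) t' x)"
      by (simp add: norm_mult)
    also have "\<dots> \<le> \<bar>x\<bar> * norm (weight (of_real a) (of_real \<rho>) \<bar>x\<bar>) * (C * max 1 \<bar>x\<bar> ^ N)"
      using w CN[OF B x] by (intro mult_mono) auto
    also have "\<dots> = M x"
      unfolding M_def by (simp add: norm_mult norm_power mult_ac)
    finally show ?thesis .
  qed
  ultimately show ?thesis by blast
qed

lemma off_lattice_between:
  assumes "a < (b :: real)"
  shows "\<exists>\<rho>. a < \<rho> \<and> \<rho> < b \<and> (\<forall>n. \<rho> \<noteq> Q powi n)"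
proof -
  have "countable (range (\<lambda>n :: int. Q powi n))" by simp
  then obtain \<rho> where "\<rho> \<in> {a<..<b}" "\<rho> \<notin> range (\<lambda>n :: int. Q powi n)"
    using real_interval_avoid_countable_set[OF assms] by blast
  then show ?thesis by auto
qed

text \<open>At exceptional radii the weight gives no majorant, although each \<open>G x\<close> is
  holomorphic there. The maximum modulus principle carries the bounds from two good circles to the
  annulus between them, and the M-test yields an analytic sum at every nonzero \<open>B\<close>.
  \<open>D\<close> collects the factors free of \<open>x\<close>.\<close>

lemma kernel_sum:
  fixes G :: "real \<Rightarrow> complex \<Rightarrow> complex"
  assumes t: "t \<in> I_q Q" "t' \<in> I_q Q"
    and hol: "\<And>x. x \<in> I_q Q \<Longrightarrow> G x holomorphic_on - {0}"
    and G: "\<And>x B. x \<in> I_q Q \<Longrightarrow> generic B \<Longrightarrow>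
      G x B = D B * (of_real \<bar>x\<bar> * weight (AA p B) B x * (jj (AA p B) B t x * jj B (AA p B) t' x))"
    and D: "\<And>\<rho>. \<rho> > 0 \<Longrightarrow> (\<And>n. \<rho> \<noteq> Q powi n) \<Longrightarrow> continuous_on {B. norm B = \<rho>} D"
  shows "\<exists>F. F holomorphic_on - {0} \<and> (\<forall>B. B \<noteq> 0 \<longrightarrow> ((\<lambda>x. G x B) has_sum F B) (I_q Q))"
proof -
  have circle: "\<exists>M. M summable_on I_q Q \<and> (\<forall>x\<in>I_q Q. \<forall>B. norm B = \<rho> \<longrightarrow> norm (G x B) \<le> M x)"
    if \<rho>: "\<rho> > 0" "\<And>n. \<rho> \<noteq> Q powi n" for \<rho>
  proof -
    obtain M where M: "M summable_on I_q Q" "\<And>x B. x \<in> I_q Q \<Longrightarrow> norm B = \<rho> \<Longrightarrow>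
       norm (of_real \<bar>x\<bar> * weight (AA p B) B x * (jj (AA p B) B t x * jj B (AA p B) t' x)) \<le> M x"
      using circle_bound[OF t \<rho>, where p = p] by blast
    have "{B. norm B = \<rho>} = sphere (0 :: complex) \<rho>" by auto
    then have "compact {B :: complex. norm B = \<rho>}" by simp
    then have "bounded (D ` {B. norm B = \<rho>})"
      by (intro compact_imp_bounded compact_continuous_image D[OF \<rho>])
    then obtain C where C: "C > 0" "\<And>B. norm B = \<rho> \<Longrightarrow> norm (D B) \<le> C"
      unfolding bounded_pos by blast
    have "norm (G x B) \<le> C * M x" if "x \<in> I_q Q" "norm B = \<rho>" for x B
      unfolding G[OF that(1) off_lattice_regular[OF \<rho> that(2)]] norm_mult[of "D B"]
      using C(1) C(2)[OF that(2)] M(2)[OF that] by (intro mult_mono) auto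
    moreover have "(\<lambda>x. C * M x) summable_on I_q Q"
      by (intro summable_on_cmult_right M(1))
    ultimately show ?thesis by blast
  qed
  define F where "F = (\<lambda>B. \<Sum>\<^sub>\<infinity>x\<in>I_q Q. G x B)"
  have loc: "\<exists>d>0. cball B0 d \<subseteq> - {0} \<and> uniform_limit (cball B0 d) (\<lambda>X B. \<Sum>x\<in>X. G x B) F (finite_subsets_at_top (I_q Q))
      \<and> (\<lambda>x. G x B0) abs_summable_on I_q Q" if "B0 \<noteq> 0" for B0
  proof -
    obtain \<rho>1 where \<rho>1: "0 < \<rho>1" "\<rho>1 < norm B0" "\<And>n. \<rho>1 \<noteq> Q powi n"
      using off_lattice_between[of 0 "norm B0"] \<open>B0 \<noteq> 0\<close> by auto
    obtain \<rho>2 where \<rho>2: "norm B0 < \<rho>2" "\<And>n. \<rho>2 \<noteq> Q powi n"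
      using off_lattice_between[of "norm B0" "norm B0 + 1"] by auto
    have \<rho>2_pos: "\<rho>2 > 0" using \<rho>1 \<rho>2 by linarith
    obtain M1 where M1: "M1 summable_on I_q Q" "\<And>x B. x \<in> I_q Q \<Longrightarrow> norm B = \<rho>1 \<Longrightarrow> norm (G x B) \<le> M1 x"
      using circle[OF \<rho>1(1,3)] by blast
    obtain M2 where M2: "M2 summable_on I_q Q" "\<And>x B. x \<in> I_q Q \<Longrightarrow> norm B = \<rho>2 \<Longrightarrow> norm (G x B) \<le> M2 x"
      using circle[OF \<rho>2_pos \<rho>2(2)] by blast
    define S where "S = {B :: complex. \<rho>1 \<le> norm B \<and> norm B \<le> \<rho>2}"
    define U where "U = {B :: complex. \<rho>1 < norm B \<and> norm B < \<rho>2}"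
    have "S = cball 0 \<rho>2 - ball 0 \<rho>1" "U = ball 0 \<rho>2 - cball 0 \<rho>1" by (auto simp: S_def U_def)
    then have "closed S" "open U" "bounded S"
      by (auto intro!: closed_Diff open_Diff bounded_subset[OF bounded_cball])
    have "U \<subseteq> interior S"
      using \<open>open U\<close> by (intro interior_maximal) (auto simp: U_def S_def)
    have S0: "S \<subseteq> - {0}" using \<rho>1(1) by (auto simp: S_def)
    have M_nonneg: "0 \<le> M1 x" "0 \<le> M2 x" if x: "x \<in> I_q Q" for x
      by (rule order_trans[OF norm_ge_zero M1(2)[OF x, of "of_real \<rho>1"]],
          use \<rho>1(1) in simp)
         (rule order_trans[OF norm_ge_zero M2(2)[OF x, of "of_real \<rho>2"]],
          use \<rho>2_pos in simp)
    have bd: "norm (G x B) \<le> norm (M1 x + M2 x)" if x: "x \<in> I_q Q" and B: "B \<in> S" for x B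
    proof (rule maximum_modulus_frontier[OF _ _ \<open>bounded S\<close> _ B])
      show "G x holomorphic_on interior S"
        using holomorphic_on_subset[OF hol[OF x]] interior_subset S0 by blast
      show "continuous_on (closure S) (G x)"
        using holomorphic_on_imp_continuous_on[OF hol[OF x]] S0 closure_closed[OF \<open>closed S\<close>]
        by (metis continuous_on_subset)
      fix z assume "z \<in> frontier S"
      then have "z \<in> S" "z \<notin> U"
        using closure_closed[OF \<open>closed S\<close>] \<open>U \<subseteq> interior S\<close> by (auto simp: frontier_def)
      then have "norm z = \<rho>1 \<or> norm z = \<rho>2" by (auto simp: S_def U_def)
      moreover note M_nonneg[OF x]
      ultimately show "norm (G x z) \<le> norm (M1 x + M2 x)"
        using M1(2)[OF x, of z] M2(2)[OF x, of z] by auto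
    qed
    have M: "(\<lambda>x. norm (M1 x + M2 x)) summable_on I_q Q"
    proof -
      have "0 \<le> M1 x + M2 x" if "x \<in> I_q Q" for x
        using M_nonneg[OF that] by simp
      then show ?thesis
        using summable_on_add[OF M1(1) M2(1)]
        by (subst summable_on_cong[of _ _ "\<lambda>x. M1 x + M2 x"]) auto
    qed
    have "B0 \<in> U" using \<rho>1 \<rho>2 by (simp add: U_def)
    then obtain d where d: "d > 0" "cball B0 d \<subseteq> U"
      using \<open>open U\<close> open_contains_cball by blast
    have US: "U \<subseteq> S" by (auto simp: U_def S_def)
    have "uniform_limit (cball B0 d) (\<lambda>X B. \<Sum>x\<in>X. G x B) F (finite_subsets_at_top (I_q Q))"
      unfolding F_def
      by (rule Weierstrass_m_test_general[OF _ M]) (use bd d US in blast)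
    moreover have "(\<lambda>x. G x B0) abs_summable_on I_q Q"
      by (rule Infinite_Sum.abs_summable_on_comparison_test[of "\<lambda>x. M1 x + M2 x"])
        (use M bd \<open>B0 \<in> U\<close> US in blast)+
    moreover have "cball B0 d \<subseteq> - {0}" using d(2) US S0 by (rule subset_trans[OF _ subset_trans])
    ultimately show ?thesis using d(1) by blast
  qed
  have "F holomorphic_on - {0}"
  proof -
    have "F field_differentiable (at B0)" if "B0 \<noteq> 0" for B0
    proof -
      obtain d where d: "d > 0" "cball B0 d \<subseteq> - {0}"
        "uniform_limit (cball B0 d) (\<lambda>X B. \<Sum>x\<in>X. G x B) F (finite_subsets_at_top (I_q Q))"
        using loc[OF \<open>B0 \<noteq> 0\<close>] by blast
      have holX: "(\<lambda>B. \<Sum>x\<in>X. G x B) holomorphic_on - {0}" if "X \<subseteq> I_q Q" for X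
        using that hol by (intro holomorphic_on_sum) auto
      have "\<forall>\<^sub>F X in finite_subsets_at_top (I_q Q). continuous_on (cball B0 d) (\<lambda>B. \<Sum>x\<in>X. G x B)
          \<and> (\<lambda>B. \<Sum>x\<in>X. G x B) holomorphic_on ball B0 d"
        using eventually_finite_subsets_at_top_weakI[of "I_q Q" "\<lambda>X. X \<subseteq> I_q Q"]
      proof (rule eventually_mono)
        fix X assume "X \<subseteq> I_q Q"
        from holX[OF this] show "continuous_on (cball B0 d) (\<lambda>B. \<Sum>x\<in>X. G x B)
          \<and> (\<lambda>B. \<Sum>x\<in>X. G x B) holomorphic_on ball B0 d"
          using d(2) ball_subset_cball[of B0 d]
          by (meson holomorphic_on_imp_continuous_on holomorphic_on_subset order_trans)
      qed auto
      from holomorphic_uniform_limit[OF this d(3)]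
      have "F holomorphic_on ball B0 d" by auto
      then show ?thesis
        using d(1) by (metis centre_in_ball holomorphic_on_imp_differentiable_at open_ball)
    qed
    then show ?thesis
      by (simp add: holomorphic_on_def field_differentiable_at_within)
  qed
  moreover have "((\<lambda>x. G x B) has_sum F B) (I_q Q)" if "B \<noteq> 0" for B
  proof -
    have "(\<lambda>x. G x B) abs_summable_on I_q Q" using loc[OF that] by blast
    then show ?thesis unfolding F_def by (rule has_sum_infsum[OF abs_summable_summable])
  qed
  ultimately show ?thesis by blast
qed

lemma generic_eqI:
  assumes "F holomorphic_on - {0}" "H holomorphic_on - {0}"
    and "\<And>B. generic B \<Longrightarrow> F B = H B" and "B \<noteq> 0"
  shows "F B = H B"
proof -
  have "isCont F B" "isCont H B"
    using holomorphic_on_imp_continuous_on[OF assms(1)] holomorphic_on_imp_continuous_on[OF assms(2)] assms(4)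
    by (simp_all add: continuous_on_eq_continuous_at open_Compl)
  then have "(F \<longlongrightarrow> F B) (at B)" "(H \<longlongrightarrow> H B) (at B)"
    by (auto simp: isCont_def)
  moreover have "eventually (\<lambda>w. F w = H w) (at B)"
    using eventually_generic[OF \<open>B \<noteq> 0\<close>] by eventually_elim (rule assms(3))
  ultimately have "(H \<longlongrightarrow> F B) (at B)"
    using Lim_transform_eventually by blast
  then show ?thesis
    using \<open>(H \<longlongrightarrow> H B) (at B)\<close> by (rule tendsto_unique[rotated]) simp
qed

section \<open>The total mass of the weight\<close>

definition mass :: "complex \<Rightarrow> complex \<Rightarrow> complex" where
  "mass A B = (\<Sum>\<^sub>\<infinity>x\<in>I_q Q. of_real \<bar>x\<bar> * weight A B x)"

lemma regular_scale: "regular A \<Longrightarrow> regular (CQ * A)"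
proof -
  assume A: "regular A"
  have "pinf (of_real x * (CQ * A)) \<noteq> 0" if "x \<in> I_q Q" for x
    using regular_nz(2)[OF A I_q_scale[OF that]] by (simp add: mult_ac)
  then show ?thesis using regular_nz(1)[OF A] Q_nz by (simp add: regular_def)
qed

text \<open>By the Pearson equation the increments of
  \<open>(1 + of_real x) * weight A B (Q * x)\<close> are polynomials times the weight. They sum to
  0 by \<open>I_q_telescope\<close>, which expresses the first moment by the mass.\<close>

lemma mass_moments:
  assumes A: "regular A" and B: "regular B"
  shows "((\<lambda>x. of_real \<bar>x\<bar> * weight A B x) has_sum mass A B) (I_q Q)"
    "\<exists>\<mu>. ((\<lambda>x. of_real \<bar>x\<bar> * weight A B x * of_real x) has_sum \<mu>) (I_q Q)
       \<and> CQ * A * B * \<mu> = (CQ * (A + B) + 1) * mass A B"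
proof -
  have s0: "(\<lambda>x. of_real \<bar>x\<bar> * weight A B x * 1) abs_summable_on I_q Q"
    by (rule tempered_weight_abs_summable[OF A B tempered_const])
  have s1: "(\<lambda>x. of_real \<bar>x\<bar> * weight A B x * of_real x) abs_summable_on I_q Q"
    by (rule tempered_weight_abs_summable[OF A B tempered_x])
  show h0: "((\<lambda>x. of_real \<bar>x\<bar> * weight A B x) has_sum mass A B) (I_q Q)"
    unfolding mass_def using has_sum_infsum[OF abs_summable_summable[OF s0]] by simp
  define \<mu> where "\<mu> = (\<Sum>\<^sub>\<infinity>x\<in>I_q Q. of_real \<bar>x\<bar> * weight A B x * of_real x)"
  have h1: "((\<lambda>x. of_real \<bar>x\<bar> * weight A B x * of_real x) has_sum \<mu>) (I_q Q)"
    unfolding \<mu>_def by (rule has_sum_infsum[OF abs_summable_summable[OF s1]])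
  define V where "V = (\<lambda>x. (1 + of_real x) * weight A B (Q * x))"
  define h where "h = (\<lambda>x. CQ * A * B * of_real x - (CQ * (A + B) + 1))"
  define g where "g = (\<lambda>x. of_real \<bar>x\<bar> * weight A B x * h x)"
  have th: "tempered {()} (\<lambda>_. h)"
    unfolding h_def by (intro tempered_diff tempered_mult tempered_const tempered_x)
  have gs: "g abs_summable_on I_q Q"
    unfolding g_def by (rule tempered_weight_abs_summable[OF A B th])
  have V_eq: "V x = weight A B x * ((1 - of_real x * A) * (1 - of_real x * B))" if "x \<in> I_q Q" for x
    unfolding V_def by (rule weight_rec[OF A B that, symmetric])
  have "((\<lambda>x. inverse CQ * g x) has_sum 0) (I_q Q)"
  proof (rule I_q_telescope[where V = V])
    show "(\<lambda>x. inverse CQ * g x) abs_summable_on I_q Q"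
      unfolding norm_mult[of "inverse CQ"] by (intro summable_on_cmult_right gs)
    fix x assume x: "x \<in> I_q Q"
    have "V x - V (x / Q) = weight A B x * ((1 - of_real x * A) * (1 - of_real x * B) - (1 + of_real x / CQ))"
    proof -
      have "V (x / Q) = weight A B x * (1 + of_real x / CQ)"
        unfolding V_def using Q_nz by (simp add: mult.commute)
      then show ?thesis unfolding V_eq[OF x] by (simp only: right_diff_distrib)
    qed
    also have "(1 - of_real x * A) * (1 - of_real x * B) - (1 + of_real x / CQ) = inverse CQ * (of_real x * h x)"
      unfolding h_def using Q_nz by (simp add: field_simps)
    also have "of_real (sgn x) * (weight A B x * (inverse CQ * (of_real x * h x))) = inverse CQ * g x"
    proof -
      have "\<bar>x\<bar> = sgn x * x" by (simp add: abs_sgn mult.commute)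
      then have "complex_of_real \<bar>x\<bar> = of_real (sgn x) * of_real x" by (simp only: of_real_mult)
      then show ?thesis unfolding g_def by (simp only: mult_ac)
    qed
    finally show "inverse CQ * g x = of_real (sgn x) * (V x - V (x / Q))" by simp
  next
    have lim: "(\<lambda>n. V (s * Q ^ n)) \<longlonglongrightarrow> (1 + of_real 0) * 1" for s
      unfolding V_def by (intro tendsto_intros Q_power_LIMSEQ weight_lim tendsto_mult_right_zero)
    show "(\<lambda>n. V (Q ^ n)) \<longlonglongrightarrow> 1" "(\<lambda>n. V (- (Q ^ n))) \<longlonglongrightarrow> 1"
      using lim[of 1] lim[of "- 1"] by simp_all
    define k where "k = (\<lambda>x. (1 - complex_of_real x * A) * (1 - of_real x * B))"
    have "tempered {()} (\<lambda>_. k)"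
      unfolding k_def by (intro tempered_mult tempered_diff tempered_const tempered_x)
    from abs_summable_I_q_sequences(2)[OF tempered_weight_abs_summable[OF A B this]]
    have "(\<lambda>n. norm (of_real \<bar>inverse Q ^ Suc n\<bar> * weight A B (inverse Q ^ Suc n) * k (inverse Q ^ Suc n))) \<longlonglongrightarrow> 0"
      by (rule summable_LIMSEQ_zero)
    then have l0: "(\<lambda>n. norm (of_real \<bar>inverse Q ^ n\<bar> * weight A B (inverse Q ^ n) * k (inverse Q ^ n))) \<longlonglongrightarrow> 0"
      by (rule LIMSEQ_imp_Suc)
    have "norm (V (inverse Q ^ n)) \<le> norm (of_real \<bar>inverse Q ^ n\<bar> * weight A B (inverse Q ^ n) * k (inverse Q ^ n))" for n
    proof -
      have x: "inverse Q ^ n \<ge> 1"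
        using one_le_power[of "inverse Q" n] Q_pos Q_less_1 by (auto simp: one_le_inverse)
      then have "1 * norm (V (inverse Q ^ n)) \<le> inverse Q ^ n * norm (V (inverse Q ^ n))"
        by (intro mult_right_mono) auto
      moreover have "norm (complex_of_real \<bar>inverse Q ^ n\<bar>) = inverse Q ^ n" unfolding norm_of_real using x by simp
      ultimately show ?thesis
        unfolding V_eq[OF I_q_intros(3)] k_def mult.assoc norm_mult[of "of_real _"] by (simp only: mult_1)
    qed
    then show "(\<lambda>n. V (inverse Q ^ n)) \<longlonglongrightarrow> 0"
      by (intro Lim_null_comparison[OF _ l0]) auto
    show "V (- 1) = 0" by (simp add: V_def)
  qed
  from has_sum_cmult_right[OF this, of CQ] have "(g has_sum 0) (I_q Q)"
    using Q_nz by (simp flip: mult.assoc)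
  moreover have "(g has_sum (CQ * A * B * \<mu> - (CQ * (A + B) + 1) * mass A B)) (I_q Q)"
  proof -
    have "((\<lambda>x. CQ * A * B * (of_real \<bar>x\<bar> * weight A B x * of_real x)
        + - (CQ * (A + B) + 1) * (of_real \<bar>x\<bar> * weight A B x))
      has_sum (CQ * A * B * \<mu> + - (CQ * (A + B) + 1) * mass A B)) (I_q Q)"
      by (intro has_sum_add has_sum_cmult_right h0 h1)
    moreover have "CQ * A * B * (w * X) + - (CQ * (A + B) + 1) * w = w * (CQ * A * B * X - (CQ * (A + B) + 1))"
      for w X by (simp add: algebra_simps)
    ultimately show ?thesis unfolding g_def h_def by (simp only: mult_minus_left add_uminus_conv_diff)
  qed
  ultimately have "CQ * A * B * \<mu> - (CQ * (A + B) + 1) * mass A B = 0"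
    using has_sum_unique by blast
  then show "\<exists>\<mu>. ((\<lambda>x. of_real \<bar>x\<bar> * weight A B x * of_real x) has_sum \<mu>) (I_q Q)
       \<and> CQ * A * B * \<mu> = (CQ * (A + B) + 1) * mass A B"
    using h1 by auto
qed

text \<open>\<open>weight (CQ * A) B x\<close> is \<open>1 - of_real x * A\<close> times
  \<open>weight A B x\<close>, so the shifted mass combines the mass and the first moment, and
  \<open>mass_moments\<close> eliminates the latter.\<close>

lemma mass_scale:
  assumes A: "regular A" and B: "regular B"
  shows "CQ * B * mass (CQ * A) B = - (1 + CQ * A) * mass A B"
proof -
  obtain \<mu> where \<mu>: "((\<lambda>x. of_real \<bar>x\<bar> * weight A B x * of_real x) has_sum \<mu>) (I_q Q)"
    "CQ * A * B * \<mu> = (CQ * (A + B) + 1) * mass A B"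
    using mass_moments(2)[OF A B] by blast
  have "((\<lambda>x. of_real \<bar>x\<bar> * weight A B x + - A * (of_real \<bar>x\<bar> * weight A B x * of_real x)) has_sum (mass A B + - A * \<mu>)) (I_q Q)"
    by (intro has_sum_add has_sum_cmult_right \<mu>(1) mass_moments(1)[OF A B])
  moreover have "of_real \<bar>x\<bar> * weight A B x + - A * (of_real \<bar>x\<bar> * weight A B x * of_real x)
      = of_real \<bar>x\<bar> * weight (CQ * A) B x" if x: "x \<in> I_q Q" for x
  proof -
    have "pinf (of_real x * A) = (1 - of_real x * A) * pinf (of_real x * (CQ * A))"
      using pinf_rec[of "of_real x * A"] by (simp add: mult_ac)
    then have w: "weight (CQ * A) B x = (1 - of_real x * A) * weight A B x"
      using regular_nz(2)[OF A x] regular_factor[OF A x] by (simp add: weight_def)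
    show ?thesis unfolding w by (simp add: algebra_simps)
  qed
  ultimately have "((\<lambda>x. of_real \<bar>x\<bar> * weight (CQ * A) B x) has_sum (mass A B + - A * \<mu>)) (I_q Q)"
    by (rule has_sum_cong[THEN iffD1, rotated])
  then have m: "mass (CQ * A) B = mass A B + - A * \<mu>"
    using has_sum_unique[OF mass_moments(1)[OF regular_scale[OF A] B]] by blast
  have "CQ * B * mass (CQ * A) B = CQ * B * mass A B - CQ * A * B * \<mu>"
    unfolding m by (simp add: algebra_simps)
  then show ?thesis unfolding \<mu>(2) by (simp add: algebra_simps)
qed

lemma mass_commute: "mass A B = mass B A"
  by (simp add: mass_def weight_commute)

lemma theta_scale: "B \<noteq> 0 \<Longrightarrow> CQ * B * theta (CQ * B) = - theta B"
proof -
  assume B: "B \<noteq> 0"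
  have 1: "pinf (1 / (CQ * B)) = (1 - 1 / (CQ * B)) * pinf (1 / B)"
    using pinf_rec[of "1 / (CQ * B)"] Q_nz by simp
  have 2: "pinf (CQ * B) = (1 - CQ * B) * pinf (CQ * (CQ * B))"
    using pinf_rec[of "CQ * B"] by (simp add: mult_ac)
  have "CQ * B * theta (CQ * B) = (CQ * B * (1 - 1 / (CQ * B))) * (pinf (CQ * (CQ * B)) * pinf (1 / B))"
    unfolding theta_def 1 by (simp only: mult_ac)
  also have "CQ * B * (1 - 1 / (CQ * B)) = - (1 - CQ * B)"
    using B Q_nz by (simp add: right_diff_distrib)
  also have "- (1 - CQ * B) * (pinf (CQ * (CQ * B)) * pinf (1 / B)) = - theta B"
    unfolding theta_def 2 by (simp only: mult_minus_left mult.assoc)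
  finally show ?thesis .
qed

text \<open>The prefactors absorb the factor \<open>- (1 + CQ * A)\<close> of
  \<open>mass_scale\<close>, so that scaling \<open>A\<close> by \<open>CQ\<close> costs only the
  multiplier \<open>1 / (CQ * CQ * A * B)\<close>, which is symmetric in \<open>A\<close> and
  \<open>B\<close>.\<close>

definition total :: "complex \<Rightarrow> complex \<Rightarrow> complex" where
  "total A B = theta A * theta B * (pinf (- (CQ * A)) * pinf (- (CQ * B))) * mass A B"

lemma total_scale:
  assumes A: "regular A" and B: "regular B"
  shows "CQ * CQ * A * B * total (CQ * A) B = total A B"
proof -
  have "pinf (- (CQ * A)) = (1 + CQ * A) * pinf (- (CQ * (CQ * A)))"
    using pinf_rec[of "- (CQ * A)"] by (simp add: mult_ac)
  then have "total A B = (- (CQ * A * theta (CQ * A))) * theta B * (((1 + CQ * A) * pinf (- (CQ * (CQ * A)))) * pinf (- (CQ * B))) * mass A B"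
    using theta_scale[OF regular_nz(1)[OF A]] by (simp add: total_def)
  also have "\<dots> = CQ * A * (theta (CQ * A) * theta B * (pinf (- (CQ * (CQ * A))) * pinf (- (CQ * B)))) * (- (1 + CQ * A) * mass A B)"
    by (simp only: mult_ac mult_minus_left mult_minus_right)
  also have "\<dots> = CQ * CQ * A * B * total (CQ * A) B"
    unfolding mass_scale[OF A B, symmetric] total_def by (simp only: mult_ac)
  finally show ?thesis by simp
qed

lemma total_commute: "total A B = total B A"
  by (simp add: total_def mass_commute[of A B] mult_ac)

text \<open>Scaling either argument of the pair \<open>(A', B)\<close> by \<open>CQ\<close> produces
  the same multiplier, so the two results agree. Moving a factor \<open>CQ\<close> from one argument
  to the other keeps the product, and hence \<open>p\<close>, fixed.\<close>

lemma total_shift: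
  assumes g: "generic B" "generic (CQ * B)"
  shows "total (AA p (CQ * B)) (CQ * B) = total (AA p B) B"
proof -
  have B: "B \<noteq> 0" using g(1) by (simp add: generic_def)
  define A' where "A' = AA p (CQ * B)"
  have A': "CQ * A' = AA p B" using Q_nz B by (simp add: A'_def AA_def)
  have r: "regular A'" "regular B" "regular (CQ * B)"
    using generic_regular[OF g(1)] generic_regular[OF g(2)] by (simp_all add: A'_def AA_def)
  have "CQ * CQ * A' * B * total (CQ * A') B = CQ * CQ * A' * B * total A' (CQ * B)"
    using total_scale[OF r(1,2)] total_scale[OF r(2,1)]
    unfolding total_commute[of "CQ * B" A'] total_commute[of B A'] by (simp only: mult_ac)
  then have "total (CQ * A') B = total A' (CQ * B)"
    using regular_nz(1)[OF r(1)] B Q_nz by simp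
  then show ?thesis unfolding A' by (simp add: A'_def)
qed

lemma nrmw_minus_Q:
  assumes A: "regular A" and B: "regular B"
  shows "nrmw A B (- Q) = CQ * pinf CQ * (pinf (- (CQ * A)) * pinf (- (CQ * B))) * mass A B"
proof -
  define c where "c = pinf (- (CQ * A)) * pinf (- (CQ * B))"
  have c: "c \<noteq> 0" using regular_nz(2)[OF A I_q_intros(5)] regular_nz(2)[OF B I_q_intros(5)] by (simp add: c_def)
  have j: "jj A B (- Q) x * jj B A (- Q) x = c * c" for x
    by (simp add: J_minus_Q c_def mult_ac)
  have "((\<lambda>x. c * c * (of_real \<bar>x\<bar> * weight A B x)) has_sum (c * c * mass A B)) (I_q Q)"
    by (intro has_sum_cmult_right mass_moments A B)
  then have "nrm A B (- Q) = c * c * mass A B"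
    unfolding nrm_def j by (simp add: infsumI mult.commute)
  moreover have "weight A B (- Q) = pinf CQ / c"
    by (simp add: weight_def c_def)
  ultimately show ?thesis
    using c Q_pos by (simp add: nrmw_def c_def[symmetric])
qed

lemma theta_holomorphic [holomorphic_intros]: "theta holomorphic_on - {0}"
  unfolding theta_def by (intro holomorphic_intros) auto

lemma AA_nz: "B \<noteq> 0 \<Longrightarrow> AA p B \<noteq> 0"
  using Q_nz by (simp add: AA_def)

lemma AA_AA: "B \<noteq> 0 \<Longrightarrow> AA p (AA p B) = B"
  using Q_nz by (simp add: AA_def)

lemma compose_AA:
  assumes "f holomorphic_on - {0}" shows "(\<lambda>B. f (AA p B)) holomorphic_on - {0}"
proof -
  have "AA p ` (- {0}) \<subseteq> - {0}" by (rule image_subsetI) (simp add: AA_nz)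
  from holomorphic_on_compose_gen[OF AA_holomorphic assms this] show ?thesis by (simp add: o_def)
qed

section \<open>Kernels for the two relations\<close>

text \<open>Up to coefficients the summand of the first relation, with \<open>x\<close> standing for
  the first variable of \<open>s\<close>; inversion of \<lambda> appears as \<open>AA p B\<close>.
  In \<open>kern'\<close> the roles of the variables are exchanged. Written with \<open>ext\<close>,
  both make sense at exceptional \<open>B\<close>.\<close>

definition kern :: "int \<Rightarrow> real \<Rightarrow> real \<Rightarrow> real \<Rightarrow> complex \<Rightarrow> complex" where
  "kern p t t' x B = of_real \<bar>x\<bar> * pinf (- of_real x) * (ext p x t B * ext p x t' (AA p B))"

definition kern' :: "int \<Rightarrow> real \<Rightarrow> real \<Rightarrow> real \<Rightarrow> complex \<Rightarrow> complex" where
  "kern' p t t' x B = of_real \<bar>x\<bar> * pinf (- of_real x) * (ext p t x B * ext p t' x (AA p B))"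

definition kern_fac :: "int \<Rightarrow> complex \<Rightarrow> complex" where
  "kern_fac p B = theta B * theta (AA p B)"

lemma generic_AA: "generic B \<Longrightarrow> generic (AA p B)"
  unfolding AA_def by (rule generic_inverse)

text \<open>By the symmetry of \<open>J\<close> both kernels are multiples, with factors free of
  \<open>x\<close>, of the same orthogonality summand, so one orthogonality theorem serves both
  relations.\<close>

lemma kern_generic:
  assumes g: "generic B" and x: "x \<in> I_q Q" and t: "t \<in> I_q Q" "t' \<in> I_q Q"
  shows "kern p t t' x B = kern_fac p B / (pinf (of_real t * B) * pinf (of_real t' * AA p B))
      * (of_real \<bar>x\<bar> * weight (AA p B) B x * (jj (AA p B) B t x * jj B (AA p B) t' x))"
    "kern' p t t' x B = kern_fac p B / (pinf (of_real t * AA p B) * pinf (of_real t' * B))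
      * (of_real \<bar>x\<bar> * weight (AA p B) B x * (jj (AA p B) B t x * jj B (AA p B) t' x))"
proof -
  have B: "B \<noteq> 0" using g by (simp add: generic_def)
  show "kern p t t' x B = kern_fac p B / (pinf (of_real t * B) * pinf (of_real t' * AA p B))
      * (of_real \<bar>x\<bar> * weight (AA p B) B x * (jj (AA p B) B t x * jj B (AA p B) t' x))"
    unfolding kern_def kern_fac_def ext(2)[OF x t(1) g] ext(2)[OF x t(2) generic_AA[OF g]] core_def
      AA_AA[OF B] weight_def by (simp add: mult_ac)
  show "kern' p t t' x B = kern_fac p B / (pinf (of_real t * AA p B) * pinf (of_real t' * B))
      * (of_real \<bar>x\<bar> * weight (AA p B) B x * (jj (AA p B) B t x * jj B (AA p B) t' x))"
    unfolding kern'_def kern_fac_def ext(2)[OF t(1) x g] ext(2)[OF t(2) x generic_AA[OF g]] core_def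
      AA_AA[OF B] weight_def jj_commute[of "AA p B" B x] jj_commute[of B "AA p B" x] by (simp add: mult_ac)
qed

lemma kern_sums:
  assumes t: "t \<in> I_q Q" "t' \<in> I_q Q"
  shows "\<exists>F. F holomorphic_on - {0} \<and> (\<forall>B. B \<noteq> 0 \<longrightarrow> ((\<lambda>x. kern p t t' x B) has_sum F B) (I_q Q))"
    "\<exists>F. F holomorphic_on - {0} \<and> (\<forall>B. B \<noteq> 0 \<longrightarrow> ((\<lambda>x. kern' p t t' x B) has_sum F B) (I_q Q))"
proof -
  have th: "continuous_on (- {0}) theta" "continuous_on (- {0}) (AA p)" "continuous_on (- {0}) (\<lambda>B. theta (AA p B))"
    by (intro holomorphic_on_imp_continuous_on theta_holomorphic AA_holomorphic compose_AA)+
  have c: "continuous_on {B. norm B = \<rho>} (\<lambda>B. kern_fac p B / (pinf (of_real t * B) * pinf (of_real t' * AA p B)))"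
    "continuous_on {B. norm B = \<rho>} (\<lambda>B. kern_fac p B / (pinf (of_real t * AA p B) * pinf (of_real t' * B)))"
    if \<rho>: "\<rho> > 0" "\<And>n. \<rho> \<noteq> Q powi n" for \<rho>
  proof -
    have sub: "{B. norm B = \<rho>} \<subseteq> - {0 :: complex}" using \<rho>(1) by auto
    note th' = th[THEN continuous_on_subset, OF sub]
    have "pinf (of_real s * B) \<noteq> 0" "pinf (of_real s * AA p B) \<noteq> 0" if "norm B = \<rho>" "s \<in> I_q Q" for s B
      using regular_nz(2)[OF generic_regular(1)[OF off_lattice_regular[OF \<rho> that(1)]] that(2)]
        regular_nz(2)[OF generic_regular(2)[OF off_lattice_regular[OF \<rho> that(1)]] that(2)]
      by (simp_all add: AA_def)
    then show "continuous_on {B. norm B = \<rho>} (\<lambda>B. kern_fac p B / (pinf (of_real t * B) * pinf (of_real t' * AA p B)))"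
      "continuous_on {B. norm B = \<rho>} (\<lambda>B. kern_fac p B / (pinf (of_real t * AA p B) * pinf (of_real t' * B)))"
      unfolding kern_fac_def using t
      by (intro continuous_intros th'; simp)+
  qed
  have hol: "kern p t t' x holomorphic_on - {0}" "kern' p t t' x holomorphic_on - {0}" if "x \<in> I_q Q" for x
    unfolding kern_def[abs_def] kern'_def[abs_def]
    by (intro holomorphic_on_mult holomorphic_on_const ext(1) compose_AA[OF ext(1)] that t)+
  show "\<exists>F. F holomorphic_on - {0} \<and> (\<forall>B. B \<noteq> 0 \<longrightarrow> ((\<lambda>x. kern p t t' x B) has_sum F B) (I_q Q))"
    by (rule kernel_sum[OF t hol(1) kern_generic(1)[OF _ _ t] c(1)])
  show "\<exists>F. F holomorphic_on - {0} \<and> (\<forall>B. B \<noteq> 0 \<longrightarrow> ((\<lambda>x. kern' p t t' x B) has_sum F B) (I_q Q))"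
    by (rule kernel_sum[OF t hol(2) kern_generic(2)[OF _ _ t] c(2)])
qed

subsection \<open>The norm as a constant\<close>

lemma kern_generic_sums:
  assumes g: "generic B" and t: "t \<in> I_q Q" "t' \<in> I_q Q"
    and F: "((\<lambda>x. kern p t t' x B) has_sum F) (I_q Q) \<or> ((\<lambda>x. kern' p t t' x B) has_sum F) (I_q Q)"
  shows "t \<noteq> t' \<Longrightarrow> F = 0"
    "t = t' \<Longrightarrow> F * (of_real \<bar>t\<bar> * pinf (- of_real t)) = kern_fac p B * nrmw (AA p B) B t"
proof -
  have B0: "B \<noteq> 0" using g by (simp add: generic_def)
  have r: "regular (AA p B)" "regular B"
    using generic_regular[OF g] by (simp_all add: AA_def)
  note AB = AA_mult[OF B0, of p]
  define w where "w = (\<lambda>x. of_real \<bar>x\<bar> * weight (AA p B) B x * (jj (AA p B) B t x * jj B (AA p B) t' x))"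
  obtain D where D: "((\<lambda>x. D * w x) has_sum F) (I_q Q)"
    and Dt: "t = t' \<Longrightarrow> D = kern_fac p B / (pinf (of_real t * AA p B) * pinf (of_real t * B))"
    using F
  proof
    assume "((\<lambda>x. kern p t t' x B) has_sum F) (I_q Q)"
    then have "((\<lambda>x. kern_fac p B / (pinf (of_real t * B) * pinf (of_real t' * AA p B)) * w x) has_sum F) (I_q Q)"
      by (rule has_sum_cong[THEN iffD1, rotated]) (simp only: kern_generic(1)[OF g _ t] w_def)
    then show ?thesis by (rule that) (simp add: mult.commute)
  next
    assume "((\<lambda>x. kern' p t t' x B) has_sum F) (I_q Q)"
    then have "((\<lambda>x. kern_fac p B / (pinf (of_real t * AA p B) * pinf (of_real t' * B)) * w x) has_sum F) (I_q Q)"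
      by (rule has_sum_cong[THEN iffD1, rotated]) (simp only: kern_generic(2)[OF g _ t] w_def)
    then show ?thesis by (rule that) simp
  qed
  show "F = 0" if "t \<noteq> t'"
  proof -
    have "((\<lambda>x. D * w x) has_sum (D * 0)) (I_q Q)"
      unfolding w_def by (intro has_sum_cmult_right orthogonality_has_sum[OF r AB t that])
    then show ?thesis using has_sum_unique[OF D] by simp
  qed
  show "F * (of_real \<bar>t\<bar> * pinf (- of_real t)) = kern_fac p B * nrmw (AA p B) B t" if tt: "t = t'"
  proof -
    have "((\<lambda>x. D * w x) has_sum (D * nrm (AA p B) B t)) (I_q Q)"
      unfolding w_def tt[symmetric] by (intro has_sum_cmult_right nrm_has_sum[OF r AB t(1)])
    then have "F = D * nrm (AA p B) B t" using has_sum_unique[OF D] by simp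
    then show ?thesis
      unfolding Dt[OF tt] nrmw_def weight_def by (simp add: mult_ac)
  qed
qed

text \<open>Supplies an accumulation point for the identity theorem; nonreal points are taken
  because they are automatically generic.\<close>

lemma circle_islimpt:
  assumes "\<rho> > 0"
  shows "\<exists>\<xi>. \<xi> \<noteq> 0 \<and> \<xi> islimpt {B. norm B = \<rho> \<and> Im B \<noteq> 0}"
proof -
  define f where "f = (\<lambda>n. of_real \<rho> * cis (1 + 1 / real (Suc n)))"
  have ang: "1 + 1 / real (Suc n) \<in> {1<..2}" for n
    by (auto simp: field_simps)
  have "f \<longlonglongrightarrow> of_real \<rho> * cis (1 + 0)"
    unfolding f_def cis_conv_exp
    by (intro tendsto_intros LIMSEQ_inverse_real_of_nat[unfolded inverse_eq_divide])
  then have lim: "f \<longlonglongrightarrow> of_real \<rho> * cis 1" by simp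
  have "f n \<in> {B. norm B = \<rho> \<and> Im B \<noteq> 0} - {of_real \<rho> * cis 1}" for n
  proof -
    define \<theta> where "\<theta> = 1 + 1 / real (Suc n)"
    have "1 < \<theta>" "\<theta> \<le> 2"
      using ang[of n] by (simp_all only: \<theta>_def greaterThanAtMost_iff)
    then have \<theta>: "1 < \<theta>" "\<theta> < pi" using pi_gt3 by linarith+
    have "sin \<theta> > 0" using \<theta> by (intro sin_gt_zero) auto
    moreover have "cos \<theta> < cos 1" using \<theta> by (intro cos_monotone_0_pi) auto
    then have "cis \<theta> \<noteq> cis 1" by (metis cis.sel(1) less_irrefl)
    moreover have "f n = of_real \<rho> * cis \<theta>" by (simp only: f_def \<theta>_def)
    ultimately show ?thesis
      using assms by (simp add: norm_mult)
  qed
  with lim have "(of_real \<rho> * cis 1) islimpt {B. norm B = \<rho> \<and> Im B \<noteq> 0}"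
    unfolding islimpt_sequential by blast
  then show ?thesis using assms by (intro exI[of _ "of_real \<rho> * cis 1"]) auto
qed

lemma nrmw_circle:
  assumes "norm B ^ 2 = Q powi p" "Im B \<noteq> 0" "t \<in> I_q Q"
  shows "nrmw (AA p B) B t = nrmw (AA p B) B (- Q)"
proof -
  have g: "generic B" by (rule generic_not_real[OF assms(2)])
  have B0: "B \<noteq> 0" using g by (simp add: generic_def)
  have "B * cnj B = of_real (Q powi p)"
    using assms(1) by (metis complex_norm_square)
  then have A: "AA p B = cnj B" using B0 by (simp add: AA_def field_simps)
  have r: "regular (cnj B)" "regular B" "cnj B * B = of_real (Q powi p)"
    using generic_regular[OF g] AA_mult[OF B0, of p] unfolding A[symmetric] by (simp_all add: AA_def)
  show ?thesis
    unfolding A nrmw_const[OF r assms(3)] using nrmw_one_eq[OF r(2,1,3)] by simp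
qed

text \<open>On the circle \<open>norm B ^ 2 = Q powi p\<close> one has \<open>AA p B = cnj B\<close>
  and the Hilbert space argument applies. Both sides are constant multiples of analytic kernel sums,
  so the identity theorem spreads the equality over the punctured plane.\<close>

lemma nrmw_indep:
  assumes g: "generic B" and t: "t \<in> I_q Q"
  shows "kern_fac p B * nrmw (AA p B) B t = kern_fac p B * nrmw (AA p B) B (- Q)"
proof -
  have mQ: "- Q \<in> I_q Q" by (rule I_q_intros)
  obtain F where F: "F holomorphic_on - {0}" "\<And>B. B \<noteq> 0 \<Longrightarrow> ((\<lambda>x. kern p t t x B) has_sum F B) (I_q Q)"
    using kern_sums(1)[OF t t, where p = p] by blast
  obtain H where H: "H holomorphic_on - {0}" "\<And>B. B \<noteq> 0 \<Longrightarrow> ((\<lambda>x. kern p (- Q) (- Q) x B) has_sum H B) (I_q Q)"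
    using kern_sums(1)[OF mQ mQ, where p = p] by blast
  define c where "c = (\<lambda>t. complex_of_real \<bar>t\<bar> * pinf (- of_real t))"
  have FB: "F B * c t = kern_fac p B * nrmw (AA p B) B t" "H B * c (- Q) = kern_fac p B * nrmw (AA p B) B (- Q)"
    if "generic B" for B
    using kern_generic_sums(2)[OF that t t disjI1[OF F(2)]] kern_generic_sums(2)[OF that mQ mQ disjI1[OF H(2)]] that
    by (simp_all add: generic_def c_def)
  define \<rho> where "\<rho> = sqrt (Q powi p)"
  have \<rho>: "\<rho> > 0" "\<rho> ^ 2 = Q powi p" using Q_pos by (simp_all add: \<rho>_def)
  obtain \<xi> where \<xi>: "\<xi> \<noteq> 0" "\<xi> islimpt {B. norm B = \<rho> \<and> Im B \<noteq> 0}"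
    using circle_islimpt[OF \<rho>(1)] by blast
  have B0: "B \<noteq> 0" using g by (simp add: generic_def)
  have "F B * c t - H B * c (- Q) = 0"
  proof (rule analytic_continuation[where f = "\<lambda>B. F B * c t - H B * c (- Q)" and S = "- {0}" and w = B,
        OF _ _ _ _ _ \<xi>(2)])
    show "(\<lambda>B. F B * c t - H B * c (- Q)) holomorphic_on - {0}"
      by (intro holomorphic_intros F(1) H(1))
    show "open (- {0 :: complex})" by auto
    show "connected (- {0 :: complex})" by (rule connected_punctured_universe) simp
    show "{B. norm B = \<rho> \<and> Im B \<noteq> 0} \<subseteq> - {0}" by auto
    show "\<xi> \<in> - {0}" "B \<in> - {0}" using \<xi>(1) B0 by auto
    fix z assume z: "z \<in> {B. norm B = \<rho> \<and> Im B \<noteq> 0}"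
    then have "generic z" by (intro generic_not_real) auto
    then show "F z * c t - H z * c (- Q) = 0"
      using FB nrmw_circle[of z p t] z \<rho>(2) t by simp
  qed
  then show ?thesis using FB[OF g] by simp
qed

lemma generic_scale: "generic B \<Longrightarrow> generic (CQ * B)"
proof -
  assume g: "generic B"
  have "CQ * B \<noteq> s * CQ powi n" if "s = 1 \<or> s = - 1" for s n
  proof
    assume "CQ * B = s * CQ powi n"
    then have "B = s * CQ powi (n - 1)"
      using Q_nz by (simp add: power_int_diff field_simps)
    then show False using generic_neq[OF g that] by blast
  qed
  from this[of 1] this[of "- 1"] show ?thesis
    using g Q_nz by (simp add: generic_def)
qed

text \<open>By periodicity all values are attained on the compact annulus \<open>R\<close>, so
  \<open>F \<circ> exp\<close> is a bounded entire function and Liouville's theorem applies.\<close>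

lemma periodic_constant:
  assumes hol: "F holomorphic_on - {0}" and per: "\<And>B. B \<noteq> 0 \<Longrightarrow> F (CQ * B) = F B"
    and "B \<noteq> 0" "B' \<noteq> 0"
  shows "F B = F B'"
proof -
  have nat: "F (CQ ^ n * B) = F B" if "B \<noteq> 0" for B n
  proof (induction n)
    case (Suc n)
    then show ?case using per[of "CQ ^ n * B"] that Q_nz by (simp add: mult.assoc)
  qed simp
  have int: "F (CQ powi n * B) = F B" if "B \<noteq> 0" for B n
  proof (cases "n \<ge> 0")
    case True
    then show ?thesis using nat[OF that, of "nat n"] by (simp add: power_int_def)
  next
    case False
    have e: "CQ ^ nat (- n) * (CQ powi n * B) = B"
      using False Q_nz by (simp add: power_int_def power_inverse)
    have "CQ powi n * B \<noteq> 0" using that Q_nz by simp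
    from nat[OF this, of "nat (- n)"] show ?thesis unfolding e by (rule sym)
  qed
  define R where "R = cball (0 :: complex) 1 - ball 0 Q"
  have "compact R" unfolding R_def by (intro compact_diff) auto
  moreover have "continuous_on R F"
    using Q_pos by (intro continuous_on_subset[OF holomorphic_on_imp_continuous_on[OF hol]]) (auto simp: R_def)
  ultimately have bR: "bounded (F ` R)" by (intro compact_imp_bounded compact_continuous_image)
  have "F w \<in> F ` R" if w: "w \<noteq> 0" for w
  proof -
    define x where "x = log Q (norm w)"
    define n where "n = - \<lfloor>x\<rfloor>"
    have nw: "norm w = Q powr x" using w Q_pos Q_less_1 by (simp add: x_def)
    have "norm (CQ powi n * w) = Q powr (of_int n + x)"
      using Q_pos by (simp add: norm_mult norm_power_int nw powr_add powr_real_of_int')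
    moreover have "0 \<le> of_int n + x" "of_int n + x \<le> 1"
      unfolding n_def by linarith+
    then have "Q powr 1 \<le> Q powr (of_int n + x)" "Q powr (of_int n + x) \<le> Q powr 0"
      using Q_pos Q_less_1 by (intro powr_mono'; simp)+
    ultimately have "CQ powi n * w \<in> R" using Q_pos by (simp add: R_def)
    then show ?thesis using int[OF w, of n] by (metis imageI)
  qed
  then have "range (F \<circ> exp) \<subseteq> F ` R" by auto
  then have "bounded (range (F \<circ> exp))" using bR bounded_subset by blast
  moreover have "F \<circ> exp holomorphic_on UNIV"
    by (rule holomorphic_on_compose_gen[OF holomorphic_on_exp hol]) auto
  ultimately have "(F \<circ> exp) constant_on UNIV"
    using Liouville_theorem by blast
  then obtain c where c: "\<And>z. F (exp z) = c" by (auto simp: constant_on_def)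
  show ?thesis
    using c[of "Ln B"] c[of "Ln B'"] assms(3,4) by simp
qed

lemma pinf_neg_powi_nz: "pinf (- (CQ powi n)) \<noteq> 0"
proof -
  have "- (CQ powi n) * CQ ^ k \<noteq> 1" for k
  proof
    assume "- (CQ powi n) * CQ ^ k = 1"
    then have "complex_of_real (- (Q powi n * Q ^ k)) = of_real 1" by simp
    then have "- (Q powi n * Q ^ k) = 1" unfolding of_real_eq_iff .
    moreover have "Q powi n * Q ^ k > 0" using Q_pos by simp
    ultimately show False by linarith
  qed
  then show ?thesis by (simp add: qpoch_inf_eq_0_iff)
qed

lemma pinf_1: "pinf 1 = 0"
  using pinf_rec[of 1] by simp

text \<open>One factor \<open>CQ * pinf CQ\<close> is
  \<open>\<bar>x\<bar> * pinf (- of_real x)\<close> at the surviving point \<open>x = - Q\<close>,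
  the other is the same expression at \<open>t = - Q\<close> from
  \<open>kern_generic_sums\<close>.\<close>

definition norm_const :: "int \<Rightarrow> complex" where
  "norm_const p = (CQ * pinf CQ)\<^sup>2 * kern_fac p (- 1 / CQ)"

text \<open>At \<open>B = - 1 / q\<close> only the summand at \<open>x = - q\<close> survives.\<close>

lemma kern_at_special:
  assumes x: "x \<in> I_q Q"
  shows "kern p (- Q) (- Q) x (- 1 / CQ) = (if x = - Q then CQ * pinf CQ * kern_fac p (- 1 / CQ) else 0)"
proof -
  define B0 where "B0 = - 1 / CQ"
  have B0: "B0 \<noteq> 0" using Q_nz by (simp add: B0_def)
  have mQ: "- Q \<in> I_q Q" by (rule I_q_intros)
  define E where "E = (\<lambda>B. ext p x (- Q) B * ext p x (- Q) (AA p B))"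
  have E_hol: "E holomorphic_on - {0}"
    unfolding E_def by (intro holomorphic_on_mult ext(1) compose_AA[OF ext(1)] x mQ)
  have fac_hol: "kern_fac p holomorphic_on - {0}"
    unfolding kern_fac_def[abs_def] by (intro holomorphic_on_mult theta_holomorphic compose_AA[OF theta_holomorphic])
  have A_hol: "AA p holomorphic_on - {0}" by (rule AA_holomorphic)
  \<comment> \<open>Cleared of denominators the identity extends to \<open>B0\<close>, where it
    determines \<open>E B0\<close> as soon as the products on the left do not vanish.\<close>
  have E: "E B * (pinf (of_real x * AA p B) * pinf (of_real x * B))
      = kern_fac p B * (pinf (- (CQ * B)) * pinf (- (CQ * AA p B)))" if g: "generic B" for B
  proof -
    have Bn: "B \<noteq> 0" using g by (simp add: generic_def)
    have nz: "pinf (of_real s * B) \<noteq> 0" "pinf (of_real s * AA p B) \<noteq> 0" if "s \<in> I_q Q" for s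
      using regular_nz(2)[OF generic_regular(1)[OF g] that] regular_nz(2)[OF generic_regular(2)[OF g] that]
      by (simp_all add: AA_def)
    show ?thesis
      using nz[OF x] nz[OF mQ]
      unfolding E_def ext(2)[OF x mQ g] ext(2)[OF x mQ generic_AA[OF g]] core_def AA_AA[OF Bn] kern_fac_def
      by (simp add: J_minus_Q field_simps)
  qed
  have "E B0 = (if x = - Q then kern_fac p B0 else 0)"
    using x
  proof (cases rule: I_q_cases2)
    case (pos n)
    have "E B0 * (pinf (of_real x * AA p B0) * pinf (of_real x * B0))
      = kern_fac p B0 * (pinf (- (CQ * B0)) * pinf (- (CQ * AA p B0)))"
      by (rule generic_eqI[OF _ _ E B0]) (intro holomorphic_intros E_hol fac_hol A_hol)+
    moreover have "pinf (- (CQ * B0)) = 0" using Q_nz by (simp add: B0_def pinf_1)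
    moreover have "of_real x * B0 = - (CQ powi (n - 1))"
      using Q_nz by (simp add: pos B0_def power_int_diff)
    moreover have "of_real x * AA p B0 = - (CQ powi (n + p + 1))"
      using Q_nz by (simp add: pos B0_def AA_def power_int_add)
    moreover have "x \<noteq> - Q"
      using pos zero_less_power_int[OF Q_pos, of n] Q_pos by linarith
    ultimately show ?thesis
      using pinf_neg_powi_nz by simp
  next
    \<comment> \<open>Now the products on the left of \<open>E\<close> may vanish at
      \<open>B0\<close>, so they are cancelled for generic \<open>B\<close> before continuation; the
      remaining factor \<open>qpoch 1 CQ k\<close> selects \<open>k = 0\<close>.\<close>
    case (neg k)
    have "E B0 = kern_fac p B0 * (qpoch (- (CQ * B0)) CQ k * qpoch (- (CQ * AA p B0)) CQ k)"
    proof (rule generic_eqI[OF E_hol _ _ B0])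
      show "(\<lambda>B. kern_fac p B * (qpoch (- (CQ * B)) CQ k * qpoch (- (CQ * AA p B)) CQ k)) holomorphic_on - {0}"
        by (intro holomorphic_intros fac_hol A_hol)
      fix B assume g: "generic B"
      have nz: "pinf (of_real x * B) \<noteq> 0" "pinf (of_real x * AA p B) \<noteq> 0"
        using regular_nz(2)[OF generic_regular(1)[OF g] x] regular_nz(2)[OF generic_regular(2)[OF g] x]
        by (simp_all add: AA_def)
      have s: "pinf (- (CQ * C)) = qpoch (- (CQ * C)) CQ k * pinf (of_real x * C)" for C
        using pinf_split[of "- (CQ * C)" k] by (simp add: neg mult_ac)
      show "E B = kern_fac p B * (qpoch (- (CQ * B)) CQ k * qpoch (- (CQ * AA p B)) CQ k)"
        using E[OF g] nz unfolding s[of B] s[of "AA p B"] by simp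
    qed
    moreover have "- (CQ * B0) = 1" using Q_nz by (simp add: B0_def)
    moreover have "qpoch 1 CQ k = 0" if "k \<noteq> 0"
      using that by (auto simp: qpoch_eq_0_iff intro!: exI[of _ 0])
    moreover have "x = - Q \<longleftrightarrow> k = 0"
    proof -
      have "Q ^ k = 1 \<longleftrightarrow> k = 0"
        using power_Suc_less_one[OF Q_pos Q_less_1] by (cases k) (auto simp: less_le)
      then show ?thesis using neg Q_pos by simp
    qed
    ultimately show ?thesis by auto
  qed
  then show ?thesis
    unfolding kern_def E_def B0_def using Q_pos by (auto simp: mult_ac)
qed

text \<open>At \<open>t = - Q\<close> the function \<open>J\<close> is constant in \<open>x\<close>,
  so the kernel sum \<open>H\<close> equals \<open>total\<close> at generic points and
  \<open>total_shift\<close> makes it periodic. The point of evaluation \<open>- 1 / CQ\<close> is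
  not generic, which is why the analytic sum \<open>H\<close> is used there and not the
  norm.\<close>

lemma nrmw_value:
  assumes g: "generic B" and t: "t \<in> I_q Q"
  shows "kern_fac p B * nrmw (AA p B) B t = norm_const p"
proof -
  have mQ: "- Q \<in> I_q Q" by (rule I_q_intros)
  obtain H where H: "H holomorphic_on - {0}" "\<And>B. B \<noteq> 0 \<Longrightarrow> ((\<lambda>x. kern p (- Q) (- Q) x B) has_sum H B) (I_q Q)"
    using kern_sums(1)[OF mQ mQ, where p = p] by blast
  define c where "c = CQ * pinf CQ"
  have c: "c \<noteq> 0"
    using qpoch_inf_pos[OF Q_less_1] Q_nz of_real_qpoch_inf[of Q] by (auto simp: c_def simp flip: of_real_qpoch_inf)
  have HB: "H B * c = kern_fac p B * nrmw (AA p B) B (- Q)" if "generic B" for B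
    using kern_generic_sums(2)[OF that mQ mQ disjI1[OF H(2)]] that Q_pos
    by (simp add: generic_def c_def)
  have HT: "H B = total (AA p B) B" if gB: "generic B" for B
  proof -
    have r: "regular (AA p B)" "regular B"
      using generic_regular[OF gB] by (simp_all add: AA_def)
    have "H B * c = kern_fac p B * nrmw (AA p B) B (- Q)" by (rule HB[OF gB])
    also have "\<dots> = total (AA p B) B * c"
      unfolding nrmw_minus_Q[OF r] total_def kern_fac_def c_def by (simp only: mult_ac)
    finally show ?thesis using c by simp
  qed
  have per: "H (CQ * B) = H B" if "B \<noteq> 0" for B
  proof (rule generic_eqI[OF _ H(1) _ that])
    have "(\<lambda>B. CQ * B) ` (- {0}) \<subseteq> - {0}" using Q_nz by auto
    from holomorphic_on_compose_gen[OF _ H(1) this]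
    show "(\<lambda>B. H (CQ * B)) holomorphic_on - {0}" by (auto simp: o_def intro!: holomorphic_intros)
    fix B assume gB: "generic B"
    show "H (CQ * B) = H B"
      unfolding HT[OF gB] HT[OF generic_scale[OF gB]] by (rule total_shift[OF gB generic_scale[OF gB]])
  qed
  have B0: "B \<noteq> 0" using g by (simp add: generic_def)
  have s0: "- 1 / CQ \<noteq> 0" using Q_nz by simp
  have "((\<lambda>x. kern p (- Q) (- Q) x (- 1 / CQ)) has_sum (c * kern_fac p (- 1 / CQ))) (I_q Q)"
  proof -
    have "((\<lambda>x. kern p (- Q) (- Q) x (- 1 / CQ)) has_sum (\<Sum>x\<in>{- Q}. kern p (- Q) (- Q) x (- 1 / CQ))) {- Q}"
      by (rule has_sum_finite) simp
    then have "((\<lambda>x. kern p (- Q) (- Q) x (- 1 / CQ)) has_sum (c * kern_fac p (- 1 / CQ))) {- Q}"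
      using kern_at_special[OF mQ, of p] by (simp add: c_def)
    then show ?thesis
      by (rule has_sum_cong_neutral[THEN iffD1, rotated -1]) (use mQ kern_at_special[of _ p] in auto)
  qed
  then have "H (- 1 / CQ) = c * kern_fac p (- 1 / CQ)"
    using has_sum_unique[OF H(2)[OF s0]] by blast
  then have "H B = c * kern_fac p (- 1 / CQ)"
    using periodic_constant[OF H(1) per B0 s0] by simp
  then show ?thesis
    unfolding nrmw_indep[OF g t] HB[OF g, symmetric] by (simp add: norm_const_def c_def power2_eq_square mult_ac)
qed

theorem kern_has_sum:
  assumes t: "t \<in> I_q Q" "t' \<in> I_q Q" and B: "B \<noteq> 0"
  shows "((\<lambda>x. kern p t t' x B) has_sum (if t = t' then norm_const p / (of_real \<bar>t\<bar> * pinf (- of_real t)) else 0)) (I_q Q)"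
    "((\<lambda>x. kern' p t t' x B) has_sum (if t = t' then norm_const p / (of_real \<bar>t\<bar> * pinf (- of_real t)) else 0)) (I_q Q)"
proof -
  define c where "c = complex_of_real \<bar>t\<bar> * pinf (- of_real t)"
  have c: "c \<noteq> 0"
    using qpoch_inf_I_q_pos[OF t(1)] I_q_nz[OF t(1)] by (simp add: c_def pinf_uminus_I_q[OF t(1)])
  have val: "F B' = (if t = t' then norm_const p / c else 0)"
    if "generic B'" "((\<lambda>x. kern p t t' x B') has_sum F B') (I_q Q) \<or> ((\<lambda>x. kern' p t t' x B') has_sum F B') (I_q Q)" for F B'
    using kern_generic_sums(1)[OF that(1) t that(2)] kern_generic_sums(2)[OF that(1) t that(2), folded c_def]
      nrmw_value[OF that(1) t(1), of p] c
    by (cases "t = t'") (simp_all add: nonzero_eq_divide_eq)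
  obtain F where F: "F holomorphic_on - {0}" "\<And>B. B \<noteq> 0 \<Longrightarrow> ((\<lambda>x. kern p t t' x B) has_sum F B) (I_q Q)"
    using kern_sums(1)[OF t, where p = p] by blast
  have "F B = (if t = t' then norm_const p / c else 0)"
    by (rule generic_eqI[OF F(1) holomorphic_on_const _ B]) (rule val, assumption, use F(2) generic_def in blast)
  then show "((\<lambda>x. kern p t t' x B) has_sum (if t = t' then norm_const p / (of_real \<bar>t\<bar> * pinf (- of_real t)) else 0)) (I_q Q)"
    using F(2)[OF B] by (simp only: c_def)
  obtain H where H: "H holomorphic_on - {0}" "\<And>B. B \<noteq> 0 \<Longrightarrow> ((\<lambda>x. kern' p t t' x B) has_sum H B) (I_q Q)"
    using kern_sums(2)[OF t, where p = p] by blast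
  have "H B = (if t = t' then norm_const p / c else 0)"
    by (rule generic_eqI[OF H(1) holomorphic_on_const _ B]) (rule val, assumption, use H(2) generic_def in blast)
  then show "((\<lambda>x. kern' p t t' x B) has_sum (if t = t' then norm_const p / (of_real \<bar>t\<bar> * pinf (- of_real t)) else 0)) (I_q Q)"
    using H(2)[OF B] by (simp only: c_def)
qed

text \<open>\<open>AA p (- 1 / CQ)\<close> is \<open>- (CQ powi (p + 1))\<close>, and
  \<open>theta_shift\<close> at \<open>n = p + 1\<close> moves it to a fixed pair of products. Both
  theta factors become multiples of \<open>2 * (pinf (- CQ))\<^sup>2\<close>, where 2 is the initial
  factor of \<open>pinf (- 1)\<close>.\<close>

lemma norm_const_eq:
  "norm_const p = (CQ * pinf CQ)\<^sup>2 * (2 * (pinf (- CQ))\<^sup>2)\<^sup>2 * CQ powi (- ((p + 1) * (p + 2) div 2))"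
proof -
  have p1: "pinf (- 1) = 2 * pinf (- CQ)" using pinf_rec[of "- 1"] by simp
  have 1: "theta (- 1 / CQ) = 2 * (pinf (- CQ))\<^sup>2"
    using Q_nz by (simp add: theta_def p1 power2_eq_square)
  define n where "n = p + 1"
  define C where "C = - (CQ powi n)"
  have C: "C \<noteq> 0" using Q_nz by (simp add: C_def)
  have "AA p (- 1 / CQ) = C"
    using Q_nz by (simp add: AA_def C_def n_def power_int_add)
  moreover have "CQ powi (1 - n) * C = - CQ"
    using Q_nz by (simp add: C_def power_int_diff)
  moreover have "CQ powi n / C = - 1" using Q_nz by (simp add: C_def)
  moreover have "(- C) powi (- n) * CQ powi (n * (n - 1) div 2) = CQ powi (- ((p + 1) * (p + 2) div 2))"
  proof -
    have e: "n * - n + n * (n - 1) div 2 = - ((p + 1) * (p + 2) div 2)"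
    proof -
      have "even (n * (n - 1))" "even ((p + 1) * (p + 2))" by auto
      then have "n * (n - 1) div 2 * 2 = n * (n - 1)" "(p + 1) * (p + 2) div 2 * 2 = (p + 1) * (p + 2)"
        by (simp_all only: dvd_div_mult_self)
      moreover have "n * - n * 2 + n * (n - 1) = - ((p + 1) * (p + 2))"
        by (simp add: n_def algebra_simps)
      ultimately show ?thesis by linarith
    qed
    have "(- C) powi (- n) = CQ powi (n * - n)"
      by (simp only: C_def minus_minus power_int_mult)
    then show ?thesis
      using Q_nz by (simp only: power_int_add[OF disjI1[OF Q_nz(2)], symmetric] e)
  qed
  ultimately have "theta (AA p (- 1 / CQ)) = CQ powi (- ((p + 1) * (p + 2) div 2)) * (2 * (pinf (- CQ))\<^sup>2)"
    using theta_shift[OF C, of n] by (simp add: p1 power2_eq_square)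
  then show ?thesis
    unfolding norm_const_def kern_fac_def 1 by (simp add: power2_eq_square)
qed

end

subsection \<open>The function \<open>s\<close> in terms of \<open>J\<close>\<close>

context
  fixes q :: real
  assumes q: "0 < q" "q < 1"
begin

interpretation q_base "q\<^sup>2"
  by unfold_locales (use q in \<open>auto simp: power_less_one_iff\<close>)

lemma q_powr: "q powi n = q powr of_int n"
  using q by (simp add: powr_real_of_int')

lemma q2_powi: "q\<^sup>2 powi n = q powr (2 * of_int n)"
proof -
  have "q\<^sup>2 powi n = q powi (2 * n)" unfolding power_int_mult by simp
  then show ?thesis unfolding q_powr by simp
qed

lemma kappa_pos: "z > 0 \<Longrightarrow> kappa z = z\<^sup>2"
  by (simp add: kappa_def)

lemma I_q_elim:
  assumes "p \<in> I_q q"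
  obtains s k where "s = 1 \<or> s = (- 1 :: real)" "p = s * q powi k" "kappa p = s * q\<^sup>2 powi k"
    "chi q p = k" "kappa p \<in> I_q (q\<^sup>2)"
proof -
  from assms consider n :: nat where "p = - (q ^ n)" "n \<ge> 1" | k :: int where "p = q powi k"
    by (auto simp: I_q_def)
  then show ?thesis
  proof cases
    case 1
    have "kappa p = - (q\<^sup>2 ^ n)"
      using 1 q by (simp add: kappa_def power_mult[symmetric] mult.commute)
    moreover from this have "kappa p \<in> I_q (q\<^sup>2)" using 1(2) by (auto simp: I_q_def)
    moreover have "chi q p = int n" by (rule of_int_chi(1)) (use 1 q in auto)
    ultimately show ?thesis using 1 by (intro that[of "- 1" "int n"]) simp_all
  next
    case 2
    have "q\<^sup>2 powi k = (q powi k)\<^sup>2"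
      using q by (simp add: power2_eq_square power_int_mult_distrib)
    moreover have "q powi k > 0" using q by simp
    ultimately have kp: "kappa p = q\<^sup>2 powi k"
      using 2 kappa_pos by simp
    moreover from this have "kappa p \<in> I_q (q\<^sup>2)" by (auto simp: I_q_def)
    moreover have "chi q p = k" by (rule of_int_chi(1)) (use 2 q in auto)
    ultimately show ?thesis using 2 by (intro that[of 1 k]) simp_all
  qed
qed

lemma kappa_mult: "kappa (x * y) = kappa x * kappa y"
  by (simp add: kappa_def sgn_mult power_mult_distrib)

lemma kappa_eq_iff: "kappa x = kappa y \<longleftrightarrow> x = y"
proof
  assume h: "kappa x = kappa y"
  have "sgn (kappa z) = sgn z" "\<bar>kappa z\<bar> = z\<^sup>2" for z
    by (auto simp: kappa_def sgn_mult abs_mult sgn_if)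
  then have "sgn x = sgn y" "x\<^sup>2 = y\<^sup>2"
    using h by metis+
  then show "x = y"
    by (auto simp: power2_eq_iff sgn_minus sgn_eq_0_iff)
qed simp

lemma kappa_bij: "bij_betw kappa (I_q q) (I_q (q\<^sup>2))"
proof (rule bij_betw_imageI)
  show "inj_on kappa (I_q q)" by (auto simp: inj_on_def kappa_eq_iff)
  show "kappa ` I_q q = I_q (q\<^sup>2)"
  proof
    show "kappa ` I_q q \<subseteq> I_q (q\<^sup>2)" by (auto elim: I_q_elim)
    show "I_q (q\<^sup>2) \<subseteq> kappa ` I_q q"
    proof
      fix x assume "x \<in> I_q (q\<^sup>2)"
      then consider n :: nat where "x = - (q\<^sup>2 ^ n)" "n \<ge> 1" | k :: int where "x = q\<^sup>2 powi k"
        by (auto simp: I_q_def)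
      then show "x \<in> kappa ` I_q q"
      proof cases
        case 1
        have "kappa (- (q ^ n)) = x"
          using 1 q by (simp add: kappa_def power_mult[symmetric] mult.commute)
        then show ?thesis using 1(2) by (force simp: I_q_def)
      next
        case 2
        have "q\<^sup>2 powi k = (q powi k)\<^sup>2"
          using q by (simp add: power2_eq_square power_int_mult_distrib)
        moreover have "q powi k > 0" using q by simp
        ultimately have "kappa (q powi k) = x" using 2 kappa_pos by simp
        then show ?thesis by (force simp: I_q_def)
      qed
    qed
  qed
qed

text \<open>\<open>kpoch\<close> is the factor \<open>(- \<kappa>(p); q\<^sup>2)\<^sub>\<infinity>\<close> and \<open>sgn_fac\<close> the sign that makes the coefficient in
  \<open>s_formula_eq\<close> uniform in the sign of \<open>p\<^sub>2\<close>.\<close>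

definition kpoch :: "real \<Rightarrow> real" where "kpoch p = qpoch_inf (- kappa p) (q\<^sup>2)"

definition sgn_fac :: "real \<Rightarrow> real" where "sgn_fac p = (- sgn p) powi (1 - chi q p)"

text \<open>The exponent is what remains free of \<open>p1\<close> and \<open>p2\<close> when the
  quadratic exponents of the \<open>nu\<close> factors and of two theta shifts are collected in
  \<open>pref_eq\<close>.\<close>

definition s_const :: "int \<Rightarrow> real" where
  "s_const m = (c_q q)\<^sup>2 * qpoch_inf (q\<^sup>2) (q\<^sup>2) * q powr (2 - (of_int m * of_int m - of_int m) / 2)"

definition s_coef :: "real \<Rightarrow> real \<Rightarrow> int \<Rightarrow> complex \<Rightarrow> complex" where
  "s_coef p1 p2 m B = of_real (sgn_fac p2 * s_const m * q powr (of_int (chi q p2) - of_int (chi q p1) * of_int m)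
     * sqrt (kpoch p1 * kpoch p2)) * B powi (chi q p1 + m + 1)"

lemma theta_shift_aux:
  fixes a b :: complex
  assumes "X = a powi (- N) * b powi e * P" "a \<noteq> 0" "b \<noteq> 0"
  shows "P = X * (a powi N * b powi (- e))"
proof -
  have "a powi N * a powi (- N) = 1" "b powi e * b powi (- e) = 1"
    using assms(2,3) by (simp_all add: power_int_minus)
  moreover have "X * (a powi N * b powi (- e)) = (a powi N * a powi (- N)) * (b powi e * b powi (- e)) * P"
    unfolding assms(1) by (simp only: mult_ac)
  ultimately show ?thesis by simp
qed

lemma cancel_aux:
  fixes D :: complex
  assumes "D \<noteq> 0"
  shows "a * (b * (th * D * (r * w) / Y) / (X * D)) * h = (a * b * r) * w * (th * h / (Y * X))"
  using assms by (cases "X = 0"; cases "Y = 0"; simp add: field_simps)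

text \<open>With \<open>k\<close> and \<open>n\<close> the logarithms of the moduli, all exponents
  of \<open>q\<close> are quadratic in \<open>k\<close>, \<open>n\<close>, \<open>m\<close>. The
  squares of \<open>k\<close> and \<open>n\<close> and their product cancel against the theta
  shifts, leaving \<open>n - k * m\<close> and a term in \<open>m\<close>. Of the signs,
  \<open>t powi N\<close> occurs twice and drops out.\<close>

lemma pref_eq:
  fixes k n m N :: int
  assumes s: "s = 1 \<or> s = (- 1 :: real)" "p1 = s * q powi k" "chi q p1 = k"
    and t: "t = 1 \<or> t = (- 1 :: real)" "p2 = t * q powi n" "chi q p2 = n" and N: "N = k + n + m"
  shows "(c_q q ^ 2 * \<bar>p1 * p2\<bar> * p2 powi (chi q (p1 * p2) + m)
     * nu q (p1 * p2 * q powi (m + 1)) * nu q p1 * nu q p2 * sqrt (qpochs_inf [- kappa p1, - kappa p2] (q ^ 2)))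
     * qpoch_inf (q\<^sup>2) (q\<^sup>2) * (t powi N * (- t) powi (1 - n) * q\<^sup>2 powi (- (N * (N - 1) div 2) - (1 - n) * (1 - n - 1) div 2))
   = sgn_fac p2 * s_const m * q powr (of_int n - of_int k * of_int m) * sqrt (kpoch p1 * kpoch p2)"
proof -
  have abs1: "\<bar>p1 * p2\<bar> = q powi (k + n)"
    using s(1) t(1) q by (auto simp: s(2) t(2) abs_mult power_int_add)
  have chi12: "chi q (p1 * p2) = k + n"
    by (rule of_int_chi(1)[OF q abs1])
  have "\<bar>p1 * p2 * q powi (m + 1)\<bar> = q powi (k + n) * q powi (m + 1)"
    using q by (simp only: abs_mult[of "p1 * p2"] abs1) simp
  also have "\<dots> = q powi (N + 1)"
    using q by (simp add: N add_ac flip: power_int_add)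
  finally have chi3: "chi q (p1 * p2 * q powi (m + 1)) = N + 1"
    by (rule of_int_chi(1)[OF q])
  have p2N: "p2 powi (chi q (p1 * p2) + m) = t powi N * q powr (of_int n * of_int N)"
  proof -
    have "p2 powi N = t powi N * (q powi n) powi N" unfolding t(2) by (rule power_int_mult_distrib)
    also have "(q powi n) powi N = q powr (of_int n * of_int N)"
      using power_int_mult[of q n N] q_powr[of "n * N"] by simp
    finally show ?thesis unfolding chi12 N[symmetric] .
  qed
  have e: "2 * real_of_int (N * (N - 1) div 2) = of_int N * (of_int N - 1)"
     "2 * real_of_int ((1 - n) * (1 - n - 1) div 2) = (1 - of_int n) * (- of_int n)"
  proof -
    have *: "2 * real_of_int (i * (i - 1) div 2) = of_int i * (of_int i - 1)" for i :: int
    proof -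
      have "2 * (i * (i - 1) div 2) = i * (i - 1)" by simp
      then have "real_of_int (2 * (i * (i - 1) div 2)) = of_int (i * (i - 1))" by (rule arg_cong)
      then show ?thesis by (simp only: of_int_mult of_int_diff of_int_1 of_int_numeral)
    qed
    show "2 * real_of_int (N * (N - 1) div 2) = of_int N * (of_int N - 1)" by (rule *)
    show "2 * real_of_int ((1 - n) * (1 - n - 1) div 2) = (1 - of_int n) * (- of_int n)"
      using *[of "1 - n"] by (simp only: of_int_diff of_int_1) simp
  qed
  have e': "q\<^sup>2 powi (- (N * (N - 1) div 2) - (1 - n) * (1 - n - 1) div 2)
      = q powr (- (of_int N * (of_int N - 1)) - (1 - of_int n) * (- of_int n))"
    unfolding q2_powi using e by (intro arg_cong[where f = "\<lambda>x. q powr x"]) (simp only: of_int_diff of_int_minus right_diff_distrib mult_minus_right)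
  have sg: "(- t) powi (1 - n) = sgn_fac p2"
    using t q by (auto simp: sgn_fac_def sgn_mult)
  have tN: "t powi N * t powi N = 1"
    using t(1) by (auto simp flip: power_int_mult_distrib)
  have pw: "q powr of_int (k + n) * (q powr (of_int n * of_int N) * (q powr (1 / 2 * (real_of_int (N + 1) - 1) * (real_of_int (N + 1) - 2))
     * (q powr (1 / 2 * (real_of_int k - 1) * (real_of_int k - 2)) * (q powr (1 / 2 * (real_of_int n - 1) * (real_of_int n - 2))
      * q powr (- (of_int N * (of_int N - 1)) - (1 - of_int n) * (- of_int n))))))
     = q powr (2 - (of_int m * of_int m - of_int m) / 2) * q powr (of_int n - of_int k * of_int m)"
    unfolding powr_add[symmetric] N by (rule arg_cong[where f = "\<lambda>x. q powr x"]) (simp add: field_simps)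
  have sq: "qpochs_inf [- kappa p1, - kappa p2] (q ^ 2) = kpoch p1 * kpoch p2"
    by (simp add: qpochs_inf_def kpoch_def)
  have "(c_q q ^ 2 * \<bar>p1 * p2\<bar> * p2 powi (chi q (p1 * p2) + m)
     * nu q (p1 * p2 * q powi (m + 1)) * nu q p1 * nu q p2 * sqrt (qpochs_inf [- kappa p1, - kappa p2] (q ^ 2)))
     * qpoch_inf (q\<^sup>2) (q\<^sup>2) * (t powi N * (- t) powi (1 - n) * q\<^sup>2 powi (- (N * (N - 1) div 2) - (1 - n) * (1 - n - 1) div 2))
     = c_q q ^ 2 * qpoch_inf (q\<^sup>2) (q\<^sup>2) * (t powi N * t powi N) * sgn_fac p2 * sqrt (kpoch p1 * kpoch p2) *
     (q powr of_int (k + n) * (q powr (of_int n * of_int N) * (q powr (1 / 2 * (real_of_int (N + 1) - 1) * (real_of_int (N + 1) - 2))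
     * (q powr (1 / 2 * (real_of_int k - 1) * (real_of_int k - 2)) * (q powr (1 / 2 * (real_of_int n - 1) * (real_of_int n - 2))
      * q powr (- (of_int N * (of_int N - 1)) - (1 - of_int n) * (- of_int n)))))))"
    unfolding p2N e' sg sq abs1 nu_def chi3 s(3) t(3) unfolding q_powr by (simp only: mult_ac)
  then show ?thesis unfolding tN pw s_const_def by (simp only: mult_ac mult_1_left mult_1_right)
qed

text \<open>Two numerator products form \<open>theta B'\<close>; the third, with an inserted
  \<open>pinf (of_real y * B)\<close>, forms \<open>theta B''\<close>, up to monomials. Here
  \<open>B'\<close> and \<open>B''\<close> are \<open>B\<close> and \<open>- B\<close> in an order
  given by the sign of \<open>p2\<close>, so their product is \<open>theta B * theta (- B)\<close>
  in both cases, and \<open>theta (- B)\<close> cancels against the last two denominator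
  products.\<close>

lemma s_formula_eq:
  assumes p1: "p1 \<in> I_q q" and p2: "p2 \<in> I_q q" and l: "l \<noteq> 0"
    and B: "B = complex_of_real (q powi (1 + m)) * l" and g: "generic B"
  shows "s_formula q p1 p2 m l = s_coef p1 p2 m B * core (1 + m) (kappa p1) (kappa p2) B"
proof -
  obtain s k where s: "s = 1 \<or> s = (- 1 :: real)" "p1 = s * q powi k" "kappa p1 = s * q\<^sup>2 powi k"
    "chi q p1 = k" "kappa p1 \<in> I_q (q\<^sup>2)"
    using p1 by (rule I_q_elim)
  obtain t n where t: "t = 1 \<or> t = (- 1 :: real)" "p2 = t * q powi n" "kappa p2 = t * q\<^sup>2 powi n"
    "chi q p2 = n" "kappa p2 \<in> I_q (q\<^sup>2)"
    using p2 by (rule I_q_elim)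
  define Qp where "Qp = (\<lambda>j :: int. complex_of_real q powi j)"
  have Qp_nz: "Qp j \<noteq> 0" for j using q by (simp add: Qp_def)
  have pmul: "Qp i * Qp j = Qp (i + j)" for i j
    using q by (simp add: Qp_def power_int_add)
  have Qp_2: "Qp 2 = CQ" "Qp 1 = complex_of_real q" "Qp 0 = 1" by (simp_all add: Qp_def)
  have CQp: "CQ powi j = Qp (2 * j)" for j
    unfolding Qp_def power_int_mult by simp
  define x where "x = kappa p1"
  define y where "y = kappa p2"
  define T where "T = complex_of_real t"
  have T: "T = 1 \<or> T = - 1" "T * T = 1" "T \<noteq> 0" using t(1) by (auto simp: T_def)
  have B0: "B \<noteq> 0" using g by (simp add: generic_def)
  have BQ: "B = Qp (1 + m) * l" using B by (simp add: Qp_def)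
  define A where "A = AA (1 + m) B"
  have A: "A = Qp (1 + m) / l"
  proof -
    have "Qp (2 * (1 + m)) = Qp (1 + m) * Qp (1 + m)" unfolding pmul by simp
    then show ?thesis
      unfolding A_def AA_def CQp BQ using Qp_nz[of "1 + m"] l by simp
  qed
  have y: "complex_of_real y = T * Qp (2 * n)"
    unfolding y_def t(3) T_def CQp[symmetric] by simp
  have x0: "complex_of_real x \<noteq> 0" "complex_of_real y \<noteq> 0"
    using I_q_nz s(5) t(5) by (auto simp: x_def y_def)
  have P1: "(complex_of_real p1)\<^sup>2 = Qp (2 * k)"
  proof -
    have "(complex_of_real p1)\<^sup>2 = Qp k * Qp k"
      using s(1) by (auto simp: s(2) Qp_def power2_eq_square)
    then show ?thesis unfolding pmul by simp
  qed
  define N where "N = k + n + m"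
  define B' where "B' = - (T * B)"
  define B'' where "B'' = T * B"
  have B'0: "B' \<noteq> 0" "B'' \<noteq> 0" using B0 T by (auto simp: B'_def B''_def)
  have u1: "- (l * Qp (3 - m)) / (Qp (2 * k) * of_real y) = CQ powi (1 - N) * B'"
  proof -
    have "Qp (2 * (1 - N)) * Qp (1 + m) * Qp (2 * k) * Qp (2 * n) = Qp (3 - m)"
      unfolding pmul by (simp add: N_def algebra_simps)
    note e = this
    have "CQ powi (1 - N) * B' * (Qp (2 * k) * of_real y)
        = - (l * (Qp (2 * (1 - N)) * Qp (1 + m) * Qp (2 * k) * Qp (2 * n))) * (T * T)"
      unfolding CQp B'_def BQ y by (simp only: mult_ac mult_minus_left mult_minus_right)
    then have "- (l * Qp (3 - m)) = CQ powi (1 - N) * B' * (Qp (2 * k) * of_real y)"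
      unfolding e T(2) by simp
    then show ?thesis using Qp_nz x0 by (simp add: nonzero_divide_eq_eq)
  qed
  have u2: "- (Qp (2 * k) * of_real y * Qp (m - 1)) / l = CQ powi N / B'"
  proof -
    have "Qp (2 * k) * Qp (2 * n) * Qp (m - 1) * Qp (1 + m) = Qp (2 * N)"
      unfolding pmul by (simp add: N_def algebra_simps)
    note e = this
    have "- (Qp (2 * k) * of_real y * Qp (m - 1)) * B'
        = (Qp (2 * k) * Qp (2 * n) * Qp (m - 1) * Qp (1 + m)) * l * (T * T)"
      unfolding B'_def BQ y by (simp only: mult_ac mult_minus_left mult_minus_right minus_minus)
    then have "- (Qp (2 * k) * of_real y * Qp (m - 1)) * B' = CQ powi N * l"
      unfolding e T(2) CQp by simp
    then show ?thesis unfolding frac_eq_eq[OF l B'0(1)] .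
  qed
  have yl: "of_real y * l \<noteq> 0" using x0 l by simp
  have u3: "Qp (1 - m) / (of_real y * l) = CQ powi (1 - n) / B''"
  proof -
    have "Qp (1 - m) * Qp (1 + m) = Qp 2" "Qp (2 * (1 - n)) * Qp (2 * n) = Qp 2"
      unfolding pmul by (simp_all add: algebra_simps)
    note e = this
    have "Qp (1 - m) * B'' = (Qp (1 - m) * Qp (1 + m)) * (T * l)"
      unfolding B''_def BQ by (simp only: mult_ac)
    also have "\<dots> = (Qp (2 * (1 - n)) * Qp (2 * n)) * (T * l)"
      unfolding e ..
    also have "\<dots> = CQ powi (1 - n) * (of_real y * l)"
      unfolding CQp y by (simp only: mult_ac)
    finally have "Qp (1 - m) * B'' = CQ powi (1 - n) * (of_real y * l)" .
    then show ?thesis unfolding frac_eq_eq[OF yl B'0(2)] .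
  qed
  have v1: "of_real x * Qp (1 + m) / l = of_real x * A" by (simp add: A)
  have mB0: "- B \<noteq> 0" using B0 by simp
  have v2: "- Qp (- m - 1) / l = 1 / (- B)"
  proof -
    have "Qp (- m - 1) * Qp (1 + m) = 1" unfolding pmul by (simp add: Qp_2)
    then have "- Qp (- m - 1) * (- B) = 1 * l" unfolding BQ by (simp add: mult.assoc[symmetric])
    then show ?thesis unfolding frac_eq_eq[OF l mB0] .
  qed
  have v3: "- (Qp (3 + m) * l) = CQ * (- B)"
  proof -
    have "Qp (3 + m) = Qp 2 * Qp (1 + m)" unfolding pmul by (simp add: algebra_simps)
    then show ?thesis unfolding BQ Qp_2 by simp
  qed
  have a: "of_real y * Qp (1 + m) * l = of_real y * B" by (simp add: BQ)
  have b: "of_real y * Qp (1 + m) / l = of_real y * A" by (simp add: A)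
  have c: "of_real x * of_real y * Qp (2 + 2 * m) = of_real x * of_real y * A * B"
  proof -
    have "Qp (2 + 2 * m) = Qp (1 + m) * Qp (1 + m)" unfolding pmul by simp
    also have "\<dots> = A * B" using l by (simp add: A BQ)
    finally show ?thesis by simp
  qed
  have A0: "A \<noteq> 0" using Qp_nz l by (simp add: A)
  have phi: "phi22_reg (of_real y * B) (of_real x * of_real y * A * B / (of_real y * A)) (of_real x * of_real y * A * B)
      (of_real y * B * (- CQ / of_real y)) CQ (of_real y * A * (- CQ / of_real y)) = jj A B y x"
  proof -
    have "of_real x * of_real y * A * B / (of_real y * A) = of_real x * B"
      "of_real y * B * (- CQ / of_real y) = - (CQ * B)" "of_real y * A * (- CQ / of_real y) = - (CQ * A)"
      using x0 A0 by simp_all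
    then show ?thesis unfolding J_def by (simp only: mult.commute)
  qed
  have Qfold: "complex_of_real q powi j = Qp j" "(complex_of_real q)\<^sup>2 = CQ" for j
    by (simp_all add: Qp_def)
  have K12: "complex_of_real (kappa (p1 * p2)) = of_real x * of_real y"
    by (simp add: kappa_mult x_def y_def)
  have qp: "qpochs_inf [a, b, c, d] CQ = pinf a * (pinf b * (pinf c * pinf d))"
     "qpochs_inf [a, b, c] CQ = pinf a * (pinf b * pinf c)" for a b c d
    by (simp_all add: qpochs_inf_def)
  define pref where "pref = c_q q ^ 2 * \<bar>p1 * p2\<bar> * p2 powi (chi q (p1 * p2) + m)
     * nu q (p1 * p2 * q powi (m + 1)) * nu q p1 * nu q p2 * sqrt (qpochs_inf [- x, - y] (q ^ 2))"
  have sf: "s_formula q p1 p2 m l = of_real pref * (pinf CQ * (pinf (CQ powi (1 - N) * B') * (pinf (CQ powi N / B') * pinf (CQ powi (1 - n) / B'')))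
       / (pinf (of_real x * A) * (pinf (1 / (- B)) * pinf (CQ * (- B))))) * jj A B y x"
    by (simp only: s_formula_def Let_def K12 x_def[symmetric] y_def[symmetric] Qfold P1 u1 u2 u3 v1 v2 v3 a b c phi pref_def[symmetric] qp)
  define e1 where "e1 = N * (N - 1) div 2"
  define e2 where "e2 = (1 - n) * (1 - n - 1) div 2"
  have mB: "- B' \<noteq> 0" "- B'' \<noteq> 0" using B'0 by simp_all
  have th1: "pinf (CQ powi (1 - N) * B') * pinf (CQ powi N / B') = theta B' * ((- B') powi N * CQ powi (- e1))"
    using theta_shift[OF B'0(1), of N] mB(1) Q_nz(2) unfolding e1_def by (rule theta_shift_aux)
  have yB: "CQ powi (1 - (1 - n)) * B'' = of_real y * B"
    unfolding B''_def y CQp by simp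
  have th2: "pinf (of_real y * B) * pinf (CQ powi (1 - n) / B'') = theta B'' * ((- B'') powi (1 - n) * CQ powi (- e2))"
    using theta_shift[OF B'0(2), of "1 - n"] mB(2) Q_nz(2) unfolding e2_def yB by (rule theta_shift_aux)
  have th3: "theta B' * theta B'' = theta B * theta (- B)"
    using T(1) by (auto simp: B'_def B''_def)
  have Bp: "(- B') powi N * (- B'') powi (1 - n) = T powi N * (- T) powi (1 - n) * B powi (k + m + 1)"
  proof -
    have "- B' = T * B" "- B'' = (- T) * B" by (simp_all add: B'_def B''_def)
    moreover have "B powi (k + m + 1) = B powi N * B powi (1 - n)"
    proof -
      have "k + m + 1 = N + (1 - n)" by (simp add: N_def)
      then show ?thesis using power_int_add[of B N "1 - n"] B0 by (simp only: simp_thms)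
    qed
    ultimately show ?thesis by (simp only: power_int_mult_distrib mult_ac)
  qed
  have CQe: "CQ powi (- e1) * CQ powi (- e2) = CQ powi (- e1 - e2)"
    using Q_nz(2) by (simp flip: power_int_add)
  define R where "R = t powi N * (- t) powi (1 - n) * q\<^sup>2 powi (- e1 - e2)"
  have R: "T powi N * (- T) powi (1 - n) * CQ powi (- e1 - e2) = of_real R"
    by (simp add: R_def T_def)
  have gr: "pinf (of_real y * B) \<noteq> 0"
    unfolding y_def by (rule regular_nz(2)[OF generic_regular(1)[OF g] t(5)])
  have "pinf (of_real y * B) * (pinf (CQ powi (1 - N) * B') * (pinf (CQ powi N / B') * pinf (CQ powi (1 - n) / B'')))
     = (pinf (CQ powi (1 - N) * B') * pinf (CQ powi N / B')) * (pinf (of_real y * B) * pinf (CQ powi (1 - n) / B''))"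
    by (simp only: mult_ac)
  also have "\<dots> = (theta B' * theta B'') * (((- B') powi N * (- B'') powi (1 - n)) * (CQ powi (- e1) * CQ powi (- e2)))"
    unfolding th1 th2 by (simp only: mult_ac)
  also have "\<dots> = theta B * theta (- B) * ((T powi N * (- T) powi (1 - n) * CQ powi (- e1 - e2)) * B powi (k + m + 1))"
    unfolding th3 Bp CQe by (simp only: mult_ac)
  finally have th4: "pinf (CQ powi (1 - N) * B') * (pinf (CQ powi N / B') * pinf (CQ powi (1 - n) / B''))
     = theta B * theta (- B) * (of_real R * B powi (k + m + 1)) / pinf (of_real y * B)"
    unfolding R using gr by (metis nonzero_mult_div_cancel_left)
  have D: "pinf (1 / (- B)) * pinf (CQ * (- B)) = theta (- B)"
    unfolding theta_def by (rule mult.commute)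
  have "generic (- B)" using g unfolding generic_def by (metis minus_minus neg_0_equal_iff_equal)
  then have D0: "theta (- B) \<noteq> 0" by (rule generic_theta_nz)
  have re: "of_real pref * pinf CQ * of_real R = complex_of_real (sgn_fac p2 * s_const m * q powr (of_int n - of_int k * of_int m) * sqrt (kpoch p1 * kpoch p2))"
    unfolding pref_eq[OF s(1,2,4) t(1,2,4) N_def, symmetric] pref_def x_def y_def R_def e1_def e2_def of_real_mult of_real_qpoch_inf ..
  show ?thesis
    unfolding sf th4 D cancel_aux[OF D0] re s_coef_def s(4) t(4) core_def A_def x_def y_def ..
qed

text \<open>The right side is analytic in \<lambda> and agrees with the formula on a punctured
  neighbourhood of every nonzero point, as exceptional values are isolated, so it is the
  extension.\<close>

lemma s_fun_eq:
  assumes p1: "p1 \<in> I_q q" and p2: "p2 \<in> I_q q" and l: "l \<noteq> 0"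
    and B: "B = complex_of_real (q powi (1 + m)) * l"
  shows "s_fun q p1 p2 l m = s_coef p1 p2 m B * ext (1 + m) (kappa p1) (kappa p2) B"
proof -
  define al where "al = complex_of_real (q powi (1 + m))"
  have al: "al \<noteq> 0" using q by (simp add: al_def)
  have k: "kappa p1 \<in> I_q (q\<^sup>2)" "kappa p2 \<in> I_q (q\<^sup>2)"
    using I_q_elim[OF p1] I_q_elim[OF p2] by metis+
  have holo: "(\<lambda>l. ext (1 + m) (kappa p1) (kappa p2) (al * l)) holomorphic_on - {0}"
  proof -
    have "(\<lambda>l. al * l) ` (- {0}) \<subseteq> - {0}" using al by auto
    moreover have "(\<lambda>l. al * l) holomorphic_on - {0}" by (intro holomorphic_intros)
    ultimately show ?thesis
      using holomorphic_on_compose_gen[OF _ ext(1)[OF k, of "1 + m"]] by (fastforce simp: o_def)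
  qed
  have "s_fun q p1 p2 l m = s_coef p1 p2 m (al * l) * ext (1 + m) (kappa p1) (kappa p2) (al * l)"
  proof (rule s_fun_eqI[OF _ _ l])
    show "(\<lambda>l. s_coef p1 p2 m (al * l) * ext (1 + m) (kappa p1) (kappa p2) (al * l)) holomorphic_on - {0}"
      unfolding s_coef_def by (intro holomorphic_intros holo) (use al in auto)
  next
    fix z :: complex assume z: "z \<noteq> 0"
    have "filterlim (\<lambda>w. al * w) (at (al * z)) (at z)"
      by (intro filterlim_atI tendsto_intros) (use al in \<open>auto simp: eventually_at_filter\<close>)
    moreover have "eventually generic (at (al * z))" using z al by (intro eventually_generic) simp
    ultimately have "\<forall>\<^sub>F w in at z. generic (al * w)" by (rule eventually_compose_filterlim[rotated])
    moreover have "\<forall>\<^sub>F w in at z. w \<noteq> 0" by (rule tendsto_imp_eventually_ne[OF tendsto_ident_at z])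
    ultimately show "\<forall>\<^sub>F w in at z. s_coef p1 p2 m (al * w) * ext (1 + m) (kappa p1) (kappa p2) (al * w) = s_formula q p1 p2 m w"
    proof eventually_elim
      case (elim w)
      show ?case
        unfolding s_formula_eq[OF p1 p2 elim(2) al_def[THEN arg_cong, of "\<lambda>a. a * w"] elim(1)] ext(2)[OF k elim(1)] ..
    qed
  qed
  then show ?thesis unfolding B al_def .
qed

lemma s_coef_mult:
  assumes "B \<noteq> 0"
  shows "s_coef p1 p2 m B * s_coef p1' p2' m A =
    of_real (sgn_fac p2 * sgn_fac p2' * (s_const m)\<^sup>2 * q powr (of_int (chi q p2) + of_int (chi q p2') - (of_int (chi q p1) + of_int (chi q p1')) * of_int m)
     * (sqrt (kpoch p1 * kpoch p2) * sqrt (kpoch p1' * kpoch p2'))) * (B powi (chi q p1 + m + 1) * A powi (chi q p1' + m + 1))"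
proof -
  have "q powr (of_int (chi q p2) + of_int (chi q p2') - (of_int (chi q p1) + of_int (chi q p1')) * of_int m)
    = q powr (of_int (chi q p2) - of_int (chi q p1) * of_int m) * q powr (of_int (chi q p2') - of_int (chi q p1') * of_int m)"
    unfolding powr_add[symmetric] by (rule arg_cong[where f = "\<lambda>x. q powr x"]) (simp add: algebra_simps)
  then show ?thesis unfolding s_coef_def power2_eq_square of_real_mult by (simp only: of_real_mult mult_ac)
qed

lemma AA_powi:
  assumes "B \<noteq> 0"
  shows "B powi i * AA (1 + m) B powi i = of_real (q powr (2 * (1 + of_int m) * of_int i))"
proof -
  have "B powi i * AA (1 + m) B powi i = (AA (1 + m) B * B) powi i"
    by (simp only: power_int_mult_distrib mult.commute)
  also have "\<dots> = of_real ((q\<^sup>2 powi (1 + m)) powi i)" unfolding AA_mult[OF assms] by (simp only: of_real_power_int)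
  also have "(q\<^sup>2 powi (1 + m)) powi i = q powr (2 * (1 + of_int m) * of_int i)"
    using power_int_mult[of "q\<^sup>2" "1 + m" i] q2_powi[of "(1 + m) * i"] by (simp add: algebra_simps)
  finally show ?thesis .
qed

lemma kpoch_pos: "p \<in> I_q q \<Longrightarrow> kpoch p > 0"
  unfolding kpoch_def by (metis I_q_elim qpoch_inf_I_q_pos)

lemma pinf_kpoch: "pinf (- of_real (kappa p)) = of_real (kpoch p)"
  unfolding kpoch_def of_real_qpoch_inf by simp

lemma abs_kappa: "p \<in> I_q q \<Longrightarrow> \<bar>kappa p\<bar> = q powr (2 * of_int (chi q p))"
  using q by (elim I_q_elim) (auto simp: abs_mult simp flip: q2_powi)

lemma sgn_fac_sq: "p \<in> I_q q \<Longrightarrow> sgn_fac p * sgn_fac p = 1"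
  using q by (elim I_q_elim) (auto simp: sgn_fac_def sgn_mult simp flip: power_int_mult_distrib)

text \<open>This fixes the normalization: the fourth power of \<open>c_q\<close> cancels the
  infinite products, the factor 4 and \<open>q ^ 4\<close>, and the remaining exponents of
  \<open>q\<close> add up to 0.\<close>

lemma norm_const_s_const: "of_real ((s_const m)\<^sup>2 * q powr (2 * (1 + of_int m)\<^sup>2)) * norm_const (1 + m) = 1"
proof -
  define P where "P = qpoch_inf (q\<^sup>2) (q\<^sup>2)"
  define M where "M = qpoch_inf (- (q\<^sup>2)) (q\<^sup>2)"
  define a where "a = q powr (2 - (of_int m * of_int m - of_int m) / 2)"
  define E where "E = q powr (2 * (1 + of_int m)\<^sup>2)"
  define F where "F = q\<^sup>2 powi (- ((1 + m + 1) * (1 + m + 2) div 2))"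
  have nc: "norm_const (1 + m) = of_real ((q\<^sup>2 * P)\<^sup>2 * (2 * M\<^sup>2)\<^sup>2 * F)"
    unfolding norm_const_eq P_def M_def F_def of_real_mult of_real_power[of _ 2] of_real_qpoch_inf of_real_power_int by simp
  have "P > 0" "M > 0" unfolding P_def M_def using Q_pos Q_less_1 by (intro qpoch_inf_pos; linarith)+
  then have c: "c_q q * (sqrt 2 * q * (P * M)) = 1"
    using q by (simp add: c_q_def qpochs_inf_def field_simps flip: P_def M_def)
  have "2 * ((1 + m + 1) * (1 + m + 2) div 2) = (1 + m + 1) * (1 + m + 2)" by simp
  then have "2 * real_of_int ((1 + m + 1) * (1 + m + 2) div 2) = real_of_int ((1 + m + 1) * (1 + m + 2))" by linarith
  then have F: "F = q powr (- ((2 + of_int m) * (3 + of_int m)))"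
    unfolding F_def q2_powi by (simp add: add_ac)
  have aEF: "a * a * E * F = 1"
  proof -
    have "a * a * E * F = q powr 0"
      unfolding a_def E_def F powr_add[symmetric]
      by (rule arg_cong[where f = "\<lambda>x. q powr x"]) (simp add: field_simps power2_eq_square)
    then show ?thesis using q by simp
  qed
  have "((c_q q)\<^sup>2 * P * a)\<^sup>2 * E * ((q\<^sup>2 * P)\<^sup>2 * ((sqrt 2)\<^sup>2 * M\<^sup>2)\<^sup>2 * F)
      = (c_q q * (sqrt 2 * q * (P * M))) ^ 4 * (a * a * E * F)" by algebra
  also have "\<dots> = 1" unfolding c aEF by simp
  finally have "(s_const m)\<^sup>2 * E * ((q\<^sup>2 * P)\<^sup>2 * (2 * M\<^sup>2)\<^sup>2 * F) = 1"
    by (simp add: s_const_def P_def a_def)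
  then show ?thesis unfolding nc E_def[symmetric] of_real_mult[symmetric] by simp
qed

text \<open>A product of two coefficients \<open>s_coef\<close> splits into a part free of the
  summation variable and the weight of the kernel, so both relations are \<open>kern_has_sum\<close>
  transported along the bijection \<open>kappa\<close> from the lattice with base \<open>q\<close>
  to that with base \<open>q\<^sup>2\<close>.\<close>

lemma biorthogonality:
  assumes lam: "lam \<noteq> 0"
  shows "p2 \<in> I_q q \<Longrightarrow> p2' \<in> I_q q \<Longrightarrow>
      ((\<lambda>p1. s_fun q p1 p2 lam m * s_fun q p1 p2' (inverse lam) m) has_sum (if p2 = p2' then 1 else 0)) (I_q q)"
    and "p1 \<in> I_q q \<Longrightarrow> p1' \<in> I_q q \<Longrightarrow>
      ((\<lambda>p2. s_fun q p1 p2 lam m * s_fun q p1' p2 (inverse lam) m) has_sum (if p1 = p1' then 1 else 0)) (I_q q)"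
proof -
  define B where "B = complex_of_real (q powi (1 + m)) * lam"
  define A where "A = AA (1 + m) B"
  have B0: "B \<noteq> 0" using q lam by (simp add: B_def)
  have "CQ powi (1 + m) = complex_of_real (q powi (1 + m)) * complex_of_real (q powi (1 + m))"
    by (simp add: power2_eq_square power_int_mult_distrib)
  then have A: "A = complex_of_real (q powi (1 + m)) * inverse lam"
    unfolding A_def AA_def B_def using q lam by (simp add: divide_inverse)
  have il: "inverse lam \<noteq> 0" using lam by simp
  have kI: "kappa p \<in> I_q (q\<^sup>2)" if "p \<in> I_q q" for p
    using that by (metis I_q_elim)
  have prod: "s_fun q p p' lam m * s_fun q r r' (inverse lam) m
     = s_coef p p' m B * s_coef r r' m A * (ext (1 + m) (kappa p) (kappa p') B * ext (1 + m) (kappa r) (kappa r') A)"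
    if "p \<in> I_q q" "p' \<in> I_q q" "r \<in> I_q q" "r' \<in> I_q q" for p p' r r'
    unfolding s_fun_eq[OF that(1,2) lam B_def] s_fun_eq[OF that(3,4) il A] by (simp only: mult_ac)
  have transfer: "((\<lambda>p. f p) has_sum S) (I_q q)"
    if "\<And>p. p \<in> I_q q \<Longrightarrow> f p = c * k (kappa p)" "(k has_sum v) (I_q (q\<^sup>2))" "c * v = S"
    for f k :: "real \<Rightarrow> complex" and c v S
  proof -
    have "((\<lambda>p. k (kappa p)) has_sum v) (I_q q)"
      using that(2) has_sum_reindex_bij_betw[OF kappa_bij, of k v] by simp
    then have "((\<lambda>p. c * k (kappa p)) has_sum (c * v)) (I_q q)" by (rule has_sum_cmult_right)
    then show ?thesis unfolding that(3) using that(1) has_sum_cong[of "I_q q" f "\<lambda>p. c * k (kappa p)" S] by blast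
  qed
  have nz: "q powr r \<noteq> 0" for r using q by simp
  have sqr: "sqrt (a * b) * sqrt (a * c) = a * sqrt (b * c)" if "a > 0" for a b c
    using that by (simp add: real_sqrt_mult)
  show "((\<lambda>p1. s_fun q p1 p2 lam m * s_fun q p1 p2' (inverse lam) m) has_sum (if p2 = p2' then 1 else 0)) (I_q q)"
    if p: "p2 \<in> I_q q" "p2' \<in> I_q q"
  proof (rule transfer[OF _ kern_has_sum(1)[OF kI[OF p(1)] kI[OF p(2)] B0, of "1 + m"]])
    define c where "c = sgn_fac p2 * sgn_fac p2' * (s_const m)\<^sup>2 * q powr (of_int (chi q p2) + of_int (chi q p2') + 2 * (1 + of_int m)\<^sup>2) * sqrt (kpoch p2 * kpoch p2')"
    show "s_fun q p1 p2 lam m * s_fun q p1 p2' (inverse lam) m = of_real c * kern (1 + m) (kappa p2) (kappa p2') (kappa p1) B"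
      if p1: "p1 \<in> I_q q" for p1
    proof -
      define k where "k = chi q p1"
      \<comment> \<open>The second power comes from \<open>B\<close> and \<open>A\<close>, which
        occur with equal exponents and combine through \<open>A * B\<close>. All that remains of
        \<open>k\<close> is \<open>q powr (2 * of_int k)\<close>, the factor
        \<open>\<bar>kappa p1\<bar>\<close> of the kernel.\<close>
      have e: "q powr (of_int (chi q p2) + of_int (chi q p2') - (of_int k + of_int k) * of_int m) * q powr (2 * (1 + of_int m) * of_int (k + m + 1))
         = q powr (of_int (chi q p2) + of_int (chi q p2') + 2 * (1 + of_int m)\<^sup>2) * q powr (2 * of_int k)"
        unfolding powr_add[symmetric] by (rule arg_cong[where f = "\<lambda>x. q powr x"]) (simp add: algebra_simps power2_eq_square)
      have "s_coef p1 p2 m B * s_coef p1 p2' m A = of_real (sgn_fac p2 * sgn_fac p2' * (s_const m)\<^sup>2 *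
         (q powr (of_int (chi q p2) + of_int (chi q p2') - (of_int k + of_int k) * of_int m) * q powr (2 * (1 + of_int m) * of_int (k + m + 1)))
         * (sqrt (kpoch p1 * kpoch p2) * sqrt (kpoch p1 * kpoch p2')))"
        unfolding s_coef_mult[OF B0] unfolding k_def[symmetric] A_def AA_powi[OF B0] of_real_mult by (simp only: mult_ac)
      also have "\<dots> = of_real c * (of_real \<bar>kappa p1\<bar> * pinf (- of_real (kappa p1)))"
        unfolding e sqr[OF kpoch_pos[OF p1]] pinf_kpoch abs_kappa[OF p1] c_def k_def[symmetric] of_real_mult by (simp only: mult_ac)
      finally show ?thesis
        unfolding prod[OF p1 p(1) p1 p(2)] kern_def A_def by (simp only: mult_ac)
    qed
    show "of_real c * (if kappa p2 = kappa p2' then norm_const (1 + m) / (of_real \<bar>kappa p2\<bar> * pinf (- of_real (kappa p2))) else 0)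
        = (if p2 = p2' then 1 else 0)"
    proof (cases "p2 = p2'")
      case True
      have e: "q powr (of_int (chi q p2) + of_int (chi q p2) + 2 * (1 + of_int m)\<^sup>2) = q powr (2 * of_int (chi q p2)) * q powr (2 * (1 + of_int m)\<^sup>2)"
        by (simp flip: powr_add)
      have "c = (s_const m)\<^sup>2 * q powr (2 * (1 + of_int m)\<^sup>2) * (\<bar>kappa p2\<bar> * kpoch p2)"
        unfolding c_def True[symmetric] sgn_fac_sq[OF p(1)] e abs_kappa[OF p(1)] using kpoch_pos[OF p(1)] by simp
      moreover have "of_real (\<bar>kappa p2\<bar> * kpoch p2) \<noteq> (0::complex)"
        using kpoch_pos[OF p(1)] nz unfolding abs_kappa[OF p(1)] by simp
      ultimately show ?thesis
        using norm_const_s_const[of m] unfolding True[symmetric] pinf_kpoch of_real_mult[symmetric] by (simp add: mult.assoc)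
    qed (simp add: kappa_eq_iff)
  qed
  show "((\<lambda>p2. s_fun q p1 p2 lam m * s_fun q p1' p2 (inverse lam) m) has_sum (if p1 = p1' then 1 else 0)) (I_q q)"
    if p: "p1 \<in> I_q q" "p1' \<in> I_q q"
  proof (rule transfer[OF _ kern_has_sum(2)[OF kI[OF p(1)] kI[OF p(2)] B0, of "1 + m"]])
    \<comment> \<open>The powers of \<open>B\<close> and \<open>A\<close> may have different
      exponents here. They are free of the summation variable, and they combine when
      \<open>p1 = p1'\<close>, the only case with a nonzero sum.\<close>
    define c where "c = of_real ((s_const m)\<^sup>2 * q powr (- ((of_int (chi q p1) + of_int (chi q p1')) * of_int m)) * sqrt (kpoch p1 * kpoch p1'))
       * (B powi (chi q p1 + m + 1) * A powi (chi q p1' + m + 1))"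
    show "s_fun q p1 p2 lam m * s_fun q p1' p2 (inverse lam) m = c * kern' (1 + m) (kappa p1) (kappa p1') (kappa p2) B"
      if p2: "p2 \<in> I_q q" for p2
    proof -
      have e: "q powr (of_int (chi q p2) + of_int (chi q p2) - (of_int (chi q p1) + of_int (chi q p1')) * of_int m)
         = q powr (- ((of_int (chi q p1) + of_int (chi q p1')) * of_int m)) * q powr (2 * of_int (chi q p2))"
        by (simp flip: powr_add)
      have sq: "sqrt (kpoch p1 * kpoch p2) * sqrt (kpoch p1' * kpoch p2) = kpoch p2 * sqrt (kpoch p1 * kpoch p1')"
        using sqr[OF kpoch_pos[OF p2], of "kpoch p1" "kpoch p1'"] by (simp only: mult.commute)
      have "s_coef p1 p2 m B * s_coef p1' p2 m A = c * (of_real \<bar>kappa p2\<bar> * pinf (- of_real (kappa p2)))"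
        unfolding s_coef_mult[OF B0] sq e sgn_fac_sq[OF p2] pinf_kpoch abs_kappa[OF p2] c_def of_real_mult by (simp only: mult_ac of_real_1 mult_1_left)
      then show ?thesis
        unfolding prod[OF p(1) p2 p(2) p2] kern'_def A_def by (simp only: mult_ac)
    qed
    show "c * (if kappa p1 = kappa p1' then norm_const (1 + m) / (of_real \<bar>kappa p1\<bar> * pinf (- of_real (kappa p1))) else 0)
        = (if p1 = p1' then 1 else 0)"
    proof (cases "p1 = p1'")
      case True
      define k where "k = chi q p1"
      have e: "q powr (- ((of_int k + of_int k) * of_int m)) * q powr (2 * (1 + of_int m) * of_int (k + m + 1))
         = q powr (2 * (1 + of_int m)\<^sup>2) * q powr (2 * of_int k)"
        unfolding powr_add[symmetric] by (rule arg_cong[where f = "\<lambda>x. q powr x"]) (simp add: algebra_simps power2_eq_square)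
      have "c = of_real ((s_const m)\<^sup>2 * (q powr (- ((of_int k + of_int k) * of_int m)) * q powr (2 * (1 + of_int m) * of_int (k + m + 1))) * sqrt (kpoch p1 * kpoch p1))"
        unfolding c_def True[symmetric] k_def[symmetric] A_def AA_powi[OF B0] of_real_mult by (simp only: mult_ac)
      also have "\<dots> = of_real ((s_const m)\<^sup>2 * q powr (2 * (1 + of_int m)\<^sup>2) * (\<bar>kappa p1\<bar> * kpoch p1))"
        unfolding e abs_kappa[OF p(1)] k_def[symmetric] using kpoch_pos[OF p(1)] by simp
      finally have "c = of_real ((s_const m)\<^sup>2 * q powr (2 * (1 + of_int m)\<^sup>2) * (\<bar>kappa p1\<bar> * kpoch p1))" .
      moreover have "of_real (\<bar>kappa p1\<bar> * kpoch p1) \<noteq> (0::complex)"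
        using kpoch_pos[OF p(1)] nz unfolding abs_kappa[OF p(1)] by simp
      ultimately show ?thesis
        using norm_const_s_const[of m] unfolding True[symmetric] pinf_kpoch of_real_mult[symmetric] by (simp add: mult.assoc)
    qed (simp add: kappa_eq_iff)
  qed
qed

end

theorem theorem6p14:
  fixes q :: real and m :: int and lam :: complex
  assumes "0 < q" and "q < 1" and "lam \<noteq> 0"
  shows "(\<forall>p2 \<in> I_q q. \<forall>p2' \<in> I_q q.
            ((\<lambda>p1. s_fun q p1 p2 lam m * s_fun q p1 p2' (inverse lam) m)
               has_sum (if p2 = p2' then 1 else 0)) (I_q q)) \<and>
         (\<forall>p1 \<in> I_q q. \<forall>p1' \<in> I_q q.
            ((\<lambda>p2. s_fun q p1 p2 lam m * s_fun q p1' p2 (inverse lam) m)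
               has_sum (if p1 = p1' then 1 else 0)) (I_q q))"
  using biorthogonality[OF assms] by blast

end
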